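(* Let $G\in\mathfrak{R}H^\infty_{m\times p}$ and $K\in\mathfrak{R}H^\infty_{m\times q}$ be given by the minimal (observable and controllable) realization \[ \begin{bmatrix} G(z)&K(z)\end{bmatrix}=\begin{bmatrix}D_1&D_2\end{bmatrix}+zC(I_n-zA)^{-1}\begin{bmatrix}B_1&B_2\end{bmatrix}, \] with $A$ stable $n\times n$. Let $R(z)=G(z)G^*(z)-K(z)K^*(z)$, which equals $zC(I_n-zA)^{-1}\Gamma+R_0+\Gamma^*(zI_n-A^* )^{-1}C^*$ with $R_0=D_1D_1^*-D_2D_2^*+C(P_1-P_2)C^*$ and $\Gamma=B_1D_1^*-B_2D_2^*+A(P_1-P_2)C^*$, where $P_j$ is the controllability Gramian of $\{A,B_j\}$. Then $T_GT_G^*-T_KT_K^*$ is nonnegative if and only if the following two conditions hold: (i) $R(\zeta)\ge0$ for all $\zeta\in\mathbb{T}$, or equivalently $R$ has an outer spectral factor $\Phi\in\mathfrak{R}H^\infty_{r\times m}$ for some $r\le m$; (ii) the matrix $\Delta+P_2-P_1$ is nonnegative, where $\Delta$ is defined (when $R$ is not identically zero) as follows: $\mathcal{X}_\Phi=\{x\in\mathbb{C}^n:W_{obs}x\in\operatorname{Im}T_\Phi^*\}$; $C_\Phi$ is an $r\times n$ matrix with $\Phi(z)=\Phi(0)+zC_\Phi(I_n-zA)^{-1}\Gamma$ and $W_{obs}x=T_\Phi^*W_{\Phi,obs}x$ for all $x\in\mathcal{X}_\Phi$; $Q_\Phi$ is the observability Gramian of $\{C_\Phi,A\}$; $\Omega_\Phi=E_{\mathcal{X}_\Phi}^*Q_\Phi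 E_{\mathcal{X}_\Phi}$ (an invertible map on $\mathcal{X}_\Phi$); and $\Delta=E_{\mathcal{X}_\Phi}\Omega_\Phi^{-1}E_{\mathcal{X}_\Phi}^*$. In the special case when $R$ is identically zero, condition (i) is automatically fulfilled (with $r=0$) and condition (ii) is to be read with $\Delta=0$.
   Context: $\mathbb{T}$ is the unit circle; a stable matrix has all eigenvalues in the open unit disc. $\mathfrak{R}H^\infty_{k\times l}$: $k\times l$ rational matrix functions without poles in the closed unit disc. $\Omega^*(z)=\Omega(1/\bar z)^*$. $\ell^2_+(\mathbb{C}^k)$: square summable $\mathbb{C}^k$-valued sequences indexed by $j\ge0$; $T_\Omega$: block Toeplitz operator with $(i,j)$ block $\Omega_{i-j}$ ($\Omega_j$ Fourier coefficients). $W_{obs}=\operatorname{col}(CA^j)_{j\ge0}$, $W_{\Phi,obs}=\operatorname{col}(C_\Phi A^j)_{j\ge0}$, $P_j=\sum_{\nu\ge0}A^\nu B_jB_j^*(A^* )^\nu$, $Q_\Phi=\sum_{\nu\ge0}(A^* )^\nu C_\Phi^*C_\Phi A^\nu$. An outer spectral factor of $R$ is $\Phi\in\mathfrak{R}H^\infty_{r\times m}$ with $R=\Phi^*\Phi$ and $T_\Phi$ of dense range. $E_{\mathcal{X}_\Phi}:\mathcal{X}_\Phi\to\mathbb{C}^n$ is the canonical embedding. (Such $\Phi$, $C_\Phi$ exist under (i), and $\Delta$ does not depend on the choices made.) *)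

theory Defs
  imports "HOL-Analysis.Analysis"
    "Jordan_Normal_Form.Schur_Decomposition"
    "Jordan_Normal_Form.Gauss_Jordan_Elimination"
begin

definition cmat_inv :: "complex mat \<Rightarrow> complex mat" where
  "cmat_inv M = (case mat_inverse M of Some N \<Rightarrow> N | None \<Rightarrow> 0\<^sub>m (dim_row M) (dim_col M))"

definition stable_mat :: "nat \<Rightarrow> complex mat \<Rightarrow> bool" where
  "stable_mat n A \<longleftrightarrow> A \<in> carrier_mat n n \<and> (\<forall>k. eigenvalue A k \<longrightarrow> cmod k < 1)"

definition realiz :: "complex mat \<Rightarrow> complex mat \<Rightarrow> complex mat \<Rightarrow> complex mat \<Rightarrow> complex \<Rightarrow> complex mat" where
  "realiz D C A B z = D + z \<cdot>\<^sub>m (C * cmat_inv (1\<^sub>m (dim_row A) - z \<cdot>\<^sub>m A) * B)"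

definition observable :: "nat \<Rightarrow> complex mat \<Rightarrow> complex mat \<Rightarrow> bool" where
  "observable n C A \<longleftrightarrow> (\<forall>x \<in> carrier_vec n. (\<forall>j. (C * A ^\<^sub>m j) *\<^sub>v x = 0\<^sub>v (dim_row C)) \<longrightarrow> x = 0\<^sub>v n)"

definition controllable :: "nat \<Rightarrow> complex mat \<Rightarrow> complex mat \<Rightarrow> bool" where
  "controllable n A B \<longleftrightarrow> (\<forall>y \<in> carrier_vec n. (\<forall>j. mat_adjoint (A ^\<^sub>m j * B) *\<^sub>v y = 0\<^sub>v (dim_col B)) \<longrightarrow> y = 0\<^sub>v n)"

definition mat_suminf :: "nat \<Rightarrow> nat \<Rightarrow> (nat \<Rightarrow> complex mat) \<Rightarrow> complex mat" where
  "mat_suminf r c F = mat r c (\<lambda>(a,b). (\<Sum>\<nu>. F \<nu> $$ (a,b)))"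

definition ctrl_gram :: "complex mat \<Rightarrow> complex mat \<Rightarrow> complex mat" where
  "ctrl_gram A B = mat_suminf (dim_row A) (dim_row A)
     (\<lambda>\<nu>. A ^\<^sub>m \<nu> * B * mat_adjoint B * (mat_adjoint A) ^\<^sub>m \<nu>)"

definition obs_gram :: "complex mat \<Rightarrow> complex mat \<Rightarrow> complex mat" where
  "obs_gram C A = mat_suminf (dim_row A) (dim_row A)
     (\<lambda>\<nu>. (mat_adjoint A) ^\<^sub>m \<nu> * mat_adjoint C * C * A ^\<^sub>m \<nu>)"

definition nonneg_complex :: "complex \<Rightarrow> bool" where
  "nonneg_complex w \<longleftrightarrow> Im w = 0 \<and> 0 \<le> Re w"

definition psd_mat :: "nat \<Rightarrow> complex mat \<Rightarrow> bool" where
  "psd_mat n M \<longleftrightarrow> M \<in> carrier_mat n n \<and> (\<forall>v \<in> carrier_vec n. nonneg_complex ((M *\<^sub>v v) \<bullet>c v))"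

definition fourier_coeff :: "nat \<Rightarrow> nat \<Rightarrow> (complex \<Rightarrow> complex mat) \<Rightarrow> int \<Rightarrow> complex mat" where
  "fourier_coeff r c \<Omega> j = mat r c (\<lambda>(a,b).
      integral {0..2*pi} (\<lambda>t. (\<Omega> (cis t)) $$ (a,b) * cis (- (of_int j * t))) / (2 * pi))"

definition vnorm2 :: "complex vec \<Rightarrow> real" where
  "vnorm2 v = (\<Sum>i<dim_vec v. (cmod (v $ i))\<^sup>2)"

definition ell2 :: "nat \<Rightarrow> (nat \<Rightarrow> complex vec) \<Rightarrow> bool" where
  "ell2 k x \<longleftrightarrow> (\<forall>j. x j \<in> carrier_vec k) \<and> summable (\<lambda>j. vnorm2 (x j))"

definition ell2_inner :: "(nat \<Rightarrow> complex vec) \<Rightarrow> (nat \<Rightarrow> complex vec) \<Rightarrow> complex" where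
  "ell2_inner x y = (\<Sum>i. x i \<bullet>c y i)"

definition ell2_dist2 :: "(nat \<Rightarrow> complex vec) \<Rightarrow> (nat \<Rightarrow> complex vec) \<Rightarrow> real" where
  "ell2_dist2 x y = (\<Sum>i. vnorm2 (x i - y i))"

definition vec_suminf :: "nat \<Rightarrow> (nat \<Rightarrow> complex vec) \<Rightarrow> complex vec" where
  "vec_suminf k f = Matrix.vec k (\<lambda>l. (\<Sum>j. f j $ l))"

definition toeplitz :: "nat \<Rightarrow> nat \<Rightarrow> (complex \<Rightarrow> complex mat) \<Rightarrow> (nat \<Rightarrow> complex vec) \<Rightarrow> (nat \<Rightarrow> complex vec)" where
  "toeplitz r c \<Omega> x = (\<lambda>i. vec_suminf r (\<lambda>j. fourier_coeff r c \<Omega> (int i - int j) *\<^sub>v x j))"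

definition toeplitz_adj :: "nat \<Rightarrow> nat \<Rightarrow> (complex \<Rightarrow> complex mat) \<Rightarrow> (nat \<Rightarrow> complex vec) \<Rightarrow> (nat \<Rightarrow> complex vec)" where
  "toeplitz_adj r c \<Omega> y = (\<lambda>j. vec_suminf c (\<lambda>i. mat_adjoint (fourier_coeff r c \<Omega> (int i - int j)) *\<^sub>v y i))"

definition toeplitz_dense_range :: "nat \<Rightarrow> nat \<Rightarrow> (complex \<Rightarrow> complex mat) \<Rightarrow> bool" where
  "toeplitz_dense_range r c \<Omega> \<longleftrightarrow>
     (\<forall>y. ell2 r y \<longrightarrow> (\<forall>\<epsilon>>0. \<exists>x. ell2 c x \<and> ell2_dist2 (toeplitz r c \<Omega> x) y < \<epsilon>))"

definition W_obs :: "complex mat \<Rightarrow> complex mat \<Rightarrow> complex vec \<Rightarrow> (nat \<Rightarrow> complex vec)" where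
  "W_obs C A x = (\<lambda>j. (C * A ^\<^sub>m j) *\<^sub>v x)"

end

theory Submission
  imports Defs "Jordan_Normal_Form.Spectral_Radius"
begin

text \<open>
  Put \<open>s\<^sub>j = \<Sum>\<^sub>i (A\<^sup>*)\<^sup>i C\<^sup>* y\<^sub>i\<^sub>+\<^sub>j\<close>, so that \<open>s\<^sub>0 = W\<^sub>o\<^sub>b\<^sub>s\<^sup>* y\<close> and \<open>s\<^sub>j = C\<^sup>* y\<^sub>j + A\<^sup>* s\<^sub>j\<^sub>+\<^sub>1\<close>. By the Lyapunov equations
  of the Gramians, the energy of \<open>T\<^sub>G\<^sup>* y\<close> minus that of \<open>T\<^sub>K\<^sup>* y\<close> telescopes to
  \<open>q(y) - \<langle>(P1 - P2) s\<^sub>0, s\<^sub>0\<rangle>\<close>, where \<open>q(y) = \<Sum>\<^sub>j \<langle>R\<^sub>0 y\<^sub>j, y\<^sub>j\<rangle> + 2 Re \<langle>\<Gamma> y\<^sub>j, s\<^sub>j\<^sub>+\<^sub>1\<rangle>\<close> is the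
  quadratic form of \<open>T\<^sub>R\<close>. The matrix \<open>\<Delta>\<close> of the theorem is the form
  \<open>\<theta>(x) = inf {q(y) | s\<^sub>0 = x}\<close>, so nonnegativity means \<open>\<Delta> \<ge> P1 - P2\<close>.

  The spectral factor is read off from \<open>\<theta>\<close>. The infimum obeys the parallelogram law, hence by Jordan and
  von Neumann \<open>\<theta>(x) = |L x|\<^sup>2\<close> for a matrix \<open>L\<close> of full row rank, and it satisfies a Bellman equation whose
  completion of squares is a coisometry \<open>[Y A2]\<close>; its adjoint provides \<open>C\<^sub>\<Phi>\<close> on the range of
  \<open>L\<^sup>*\<close>, which is \<open>X\<^sub>\<Phi>\<close>. Near-optimal inputs show that \<open>T\<^sub>\<Phi>\<close> has dense range. Conversely, given
  \<open>\<Phi>\<close>, the energy of the output of \<open>\<Phi>\<close> started in the state \<open>-x\<close>, \<open>x \<in> X\<^sub>\<Phi>\<close>, is nonnegative, and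
  the best choice of \<open>x\<close> gives \<open>q(y) \<ge> \<langle>\<Delta> s\<^sub>0, s\<^sub>0\<rangle>\<close>.
\<close>

section \<open>Matrices, vectors and the inner product\<close>

unbundle no vec_syntax

text \<open>The obstacle is degeneracy: neither \<open>R0\<close> nor the values of \<open>R\<close>
  on the circle need be invertible, so the factor is not sought from a Riccati equation. The value
  function \<theta> asks only for infima. They need not be attained, hence the epsilon forms of the
  Bellman equation and of the range statement, and \<open>|L x|^2\<close> may have a kernel; the
  subspace of the factor is the orthogonal complement of that kernel. Nonnegativity of the
  \<open>T_R\<close> form is not given directly. It comes from delaying an input: the cost stays the
  same while \<open>s_0\<close> tends to 0. A factorization of \<open>R\<close> determines only
  \<open>R0\<close> and the products \<open>C A^j \<Gamma>\<close>. The output matrix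
  \<open>C'\<close> computed from a factor therefore agrees with \<open>C\<close> only on certain
  \<open>A\<close>-invariant subspaces containing the range of \<Gamma>, and every trajectory used
  has to be kept inside such a subspace. For the factor built here \<Delta> equals
  \<open>L^* L\<close>: the identity \<open>L Q L^* = 1\<close> makes it the inverse of the
  compression of \<open>Q\<close> to the range of \<open>L^*\<close>. The converse has to work with
  an arbitrary factor, so it uses no minimality of \<theta>, only the energy balance of that
  factor.\<close>

definition inn :: "complex vec \<Rightarrow> complex vec \<Rightarrow> complex" where
  "inn x y = x \<bullet>c y"

lemma inn_sum: "dim_vec x = dim_vec y \<Longrightarrow> inn x y = (\<Sum>i<dim_vec x. x $ i * cnj (y $ i))"
  by (auto simp: inn_def scalar_prod_def lessThan_atLeast0 intro!: sum.cong)

lemma mv_index: "i < dim_row M \<Longrightarrow> dim_col M = dim_vec x \<Longrightarrow>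
    (M *\<^sub>v x) $ i = (\<Sum>j<dim_vec x. M $$ (i,j) * x $ j)"
  by (auto simp: mult_mat_vec_def scalar_prod_def lessThan_atLeast0 intro!: sum.cong)

lemma dim_adjoint [simp]:
  "dim_row (mat_adjoint M) = dim_col M" "dim_col (mat_adjoint M) = dim_row M"
  for M :: "complex mat"
  by (auto simp: mat_adjoint_def)

lemma adjoint_carrier [intro, simp]:
  "M \<in> carrier_mat r c \<Longrightarrow> mat_adjoint M \<in> carrier_mat c r" for M :: "complex mat"
  by (intro carrier_matI) auto

lemma adjoint_index [simp]:
  "i < dim_col M \<Longrightarrow> j < dim_row M \<Longrightarrow> mat_adjoint M $$ (i,j) = cnj (M $$ (j,i))"
  for M :: "complex mat"
  by (simp add: mat_adjoint_def mat_of_rows_index)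

lemma adjoint_adjoint [simp]: "mat_adjoint (mat_adjoint M) = M" for M :: "complex mat"
  by (intro eq_matI) auto

lemma adjoint_add: "dim_row M = dim_row N \<Longrightarrow> dim_col M = dim_col N \<Longrightarrow>
    mat_adjoint (M + N) = mat_adjoint M + mat_adjoint N" for M N :: "complex mat"
  by (intro eq_matI) auto

lemma adjoint_diff: "dim_row M = dim_row N \<Longrightarrow> dim_col M = dim_col N \<Longrightarrow>
    mat_adjoint (M - N) = mat_adjoint M - mat_adjoint N" for M N :: "complex mat"
  by (intro eq_matI) auto

lemma adjoint_smult: "mat_adjoint (c \<cdot>\<^sub>m M) = cnj c \<cdot>\<^sub>m mat_adjoint M" for M :: "complex mat"
  by (intro eq_matI) auto

lemma adjoint_one [simp]: "mat_adjoint (1\<^sub>m k) = (1\<^sub>m k :: complex mat)"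
  by (intro eq_matI) auto

lemma adjoint_mult: "dim_col M = dim_row N \<Longrightarrow>
    mat_adjoint (M * N) = mat_adjoint N * mat_adjoint M" for M N :: "complex mat"
  by (intro eq_matI) (auto simp: scalar_prod_def intro!: sum.cong)

lemma mv_assoc: "dim_col M = dim_row N \<Longrightarrow> dim_col N = dim_vec x \<Longrightarrow>
    (M * N) *\<^sub>v x = M *\<^sub>v (N *\<^sub>v x)" for M N :: "complex mat"
  using assoc_mult_mat_vec[of M "dim_row M" "dim_col M" N "dim_col N" x] by (metis carrier_mat_triv carrier_vec_dim_vec)

lemma mv_add: "dim_vec x = dim_vec y \<Longrightarrow> dim_col M = dim_vec y \<Longrightarrow>
    M *\<^sub>v (x + y) = M *\<^sub>v x + M *\<^sub>v y" for M :: "complex mat"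
  by (intro eq_vecI) (auto simp: mv_index sum.distrib algebra_simps simp del: index_mult_mat_vec)

lemma mv_diff: "dim_vec x = dim_vec y \<Longrightarrow> dim_col M = dim_vec y \<Longrightarrow>
    M *\<^sub>v (x - y) = M *\<^sub>v x - M *\<^sub>v y" for M :: "complex mat"
  by (intro eq_vecI) (auto simp: mv_index sum_subtractf algebra_simps simp del: index_mult_mat_vec)

lemma mv_smult: "dim_col M = dim_vec x \<Longrightarrow>
    M *\<^sub>v (c \<cdot>\<^sub>v x) = c \<cdot>\<^sub>v (M *\<^sub>v x)" for M :: "complex mat"
  by (intro eq_vecI) (auto simp: mv_index sum_distrib_left algebra_simps simp del: index_mult_mat_vec)

lemma mv_zero [simp]: "dim_col M = k \<Longrightarrow> M *\<^sub>v 0\<^sub>v k = 0\<^sub>v (dim_row M)" for M :: "complex mat"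
  by (intro eq_vecI) (auto simp: mv_index simp del: index_mult_mat_vec)

lemma mv_add_mat: "dim_row M = dim_row N \<Longrightarrow> dim_col M = dim_col N \<Longrightarrow> dim_col N = dim_vec x \<Longrightarrow>
    (M + N) *\<^sub>v x = M *\<^sub>v x + N *\<^sub>v x" for M N :: "complex mat"
  by (intro eq_vecI) (auto simp: mv_index sum.distrib algebra_simps simp del: index_mult_mat_vec)

lemma mv_diff_mat: "dim_row M = dim_row N \<Longrightarrow> dim_col M = dim_col N \<Longrightarrow> dim_col N = dim_vec x \<Longrightarrow>
    (M - N) *\<^sub>v x = M *\<^sub>v x - N *\<^sub>v x" for M N :: "complex mat"
  by (intro eq_vecI) (auto simp: mv_index sum_subtractf algebra_simps simp del: index_mult_mat_vec)

lemma mv_smult_mat: "dim_col M = dim_vec x \<Longrightarrow>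
    (c \<cdot>\<^sub>m M) *\<^sub>v x = c \<cdot>\<^sub>v (M *\<^sub>v x)" for M :: "complex mat"
  by (intro eq_vecI) (auto simp: mv_index sum_distrib_left algebra_simps simp del: index_mult_mat_vec)

lemma mv_one [simp]: "dim_vec x = k \<Longrightarrow> 1\<^sub>m k *\<^sub>v x = x" for x :: "complex vec"
  by (metis carrier_vec_dim_vec one_mult_mat_vec)

lemma mv_zero_mat [simp]: "dim_vec x = c \<Longrightarrow> 0\<^sub>m r c *\<^sub>v x = 0\<^sub>v r" for x :: "complex vec"
  by (intro eq_vecI) (auto simp: mv_index simp del: index_mult_mat_vec)

lemma dim_mv [simp]: "dim_vec (M *\<^sub>v x) = dim_row M"
  by simp

lemma smult_zero_vec [simp]: "c \<cdot>\<^sub>v 0\<^sub>v k = (0\<^sub>v k :: complex vec)"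
  by (intro eq_vecI) auto

lemmas mvs = mv_assoc mv_add mv_diff mv_smult mv_add_mat mv_diff_mat mv_smult_mat

lemma mult_one_mv: "M * N = 1\<^sub>m k \<Longrightarrow> dim_col M = dim_row N \<Longrightarrow> dim_col N = k \<Longrightarrow>
    dim_vec a = k \<Longrightarrow> M *\<^sub>v (N *\<^sub>v a) = a" for M N :: "complex mat"
  by (simp add: mv_assoc[symmetric])

lemma mult_one_adjoint_mv: "M * N = 1\<^sub>m k \<Longrightarrow> dim_col M = dim_row N \<Longrightarrow> dim_row M = k \<Longrightarrow>
    dim_vec a = k \<Longrightarrow> mat_adjoint N *\<^sub>v (mat_adjoint M *\<^sub>v a) = a" for M N :: "complex mat"
  by (simp add: mv_assoc[symmetric] adjoint_mult[symmetric])

lemma mat_eqI_vec: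
  fixes M N :: "complex mat"
  assumes "M \<in> carrier_mat r c" "N \<in> carrier_mat r c"
    and "\<And>x. x \<in> carrier_vec c \<Longrightarrow> M *\<^sub>v x = N *\<^sub>v x"
  shows "M = N"
proof (rule eq_matI)
  fix i j assume ij: "i < dim_row N" "j < dim_col N"
  have "M *\<^sub>v unit_vec c j = N *\<^sub>v unit_vec c j" using assms by auto
  hence "(M *\<^sub>v unit_vec c j) $ i = (N *\<^sub>v unit_vec c j) $ i" by simp
  thus "M $$ (i,j) = N $$ (i,j)" using ij assms(1,2) by simp
qed (use assms in auto)

lemma inn_add_left: "dim_vec x = dim_vec y \<Longrightarrow> dim_vec y = dim_vec z \<Longrightarrow>
    inn (x + y) z = inn x z + inn y z"
  by (simp add: inn_sum sum.distrib algebra_simps)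

lemma inn_add_right: "dim_vec y = dim_vec z \<Longrightarrow> dim_vec x = dim_vec z \<Longrightarrow>
    inn x (y + z) = inn x y + inn x z"
  by (simp add: inn_sum sum.distrib algebra_simps)

lemma inn_diff_left: "dim_vec x = dim_vec y \<Longrightarrow> dim_vec y = dim_vec z \<Longrightarrow>
    inn (x - y) z = inn x z - inn y z"
  by (simp add: inn_sum sum_subtractf algebra_simps)

lemma inn_diff_right: "dim_vec y = dim_vec z \<Longrightarrow> dim_vec x = dim_vec z \<Longrightarrow>
    inn x (y - z) = inn x y - inn x z"
  by (simp add: inn_sum sum_subtractf algebra_simps)

lemma inn_smult_left: "dim_vec x = dim_vec y \<Longrightarrow> inn (c \<cdot>\<^sub>v x) y = c * inn x y"
  by (simp add: inn_sum sum_distrib_left algebra_simps)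

lemma inn_smult_right: "dim_vec x = dim_vec y \<Longrightarrow> inn x (c \<cdot>\<^sub>v y) = cnj c * inn x y"
  by (simp add: inn_sum sum_distrib_left algebra_simps)

lemma inn_zero_left [simp]: "dim_vec x = k \<Longrightarrow> inn (0\<^sub>v k) x = 0"
  by (simp add: inn_sum)

lemma inn_zero_right [simp]: "dim_vec x = k \<Longrightarrow> inn x (0\<^sub>v k) = 0"
  by (simp add: inn_sum)

lemmas inns = inn_add_left inn_add_right inn_diff_left inn_diff_right inn_smult_left inn_smult_right

lemma cnj_inn: "dim_vec x = dim_vec y \<Longrightarrow> cnj (inn x y) = inn y x"
  by (simp add: inn_sum mult.commute)

lemma Re_inn_commute: "dim_vec x = dim_vec y \<Longrightarrow> Re (inn x y) = Re (inn y x)"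
  by (metis cnj_inn cnj.simps(1))

lemma inn_self: "inn x x = of_real (vnorm2 x)"
  by (simp only: inn_sum[OF refl] vnorm2_def of_real_sum complex_norm_square)

lemma vnorm2_Re: "vnorm2 x = Re (inn x x)"
  by (simp add: inn_self)

lemma vnorm2_nonneg [simp]: "0 \<le> vnorm2 x"
  by (simp add: vnorm2_def sum_nonneg)

lemma vnorm2_eq_0: "vnorm2 x = 0 \<longleftrightarrow> x = 0\<^sub>v (dim_vec x)"
  by (auto simp: vnorm2_def sum_nonneg_eq_0_iff vec_eq_iff)

lemma vnorm2_zero [simp]: "vnorm2 (0\<^sub>v k) = 0"
  by (simp add: vnorm2_def)

lemma inn_mv: "dim_col M = dim_vec x \<Longrightarrow> dim_row M = dim_vec y \<Longrightarrow>
    inn (M *\<^sub>v x) y = inn x (mat_adjoint M *\<^sub>v y)"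
  by (simp add: inn_sum mv_index sum_distrib_left sum_distrib_right del: index_mult_mat_vec,
      subst sum.swap, simp add: mult_ac)

lemma inn_mv': "dim_col M = dim_vec x \<Longrightarrow> dim_row M = dim_vec y \<Longrightarrow>
    inn y (M *\<^sub>v x) = inn (mat_adjoint M *\<^sub>v y) x"
  by (simp add: inn_mv)

lemma vec_eqI_inn:
  assumes "dim_vec x = k" "dim_vec y = k" "\<And>u. u \<in> carrier_vec k \<Longrightarrow> inn x u = inn y u"
  shows "x = y"
proof -
  have d: "dim_vec (x - y) = k" by (simp add: assms(2))
  have "inn (x - y) (x - y) = inn x (x - y) - inn y (x - y)"
    by (rule inn_diff_left) (simp_all only: assms d)
  also have "inn x (x - y) = inn y (x - y)" by (rule assms(3), rule carrier_vecI, rule d)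
  also have "inn y (x - y) - inn y (x - y) = 0" by (rule diff_self)
  finally have "inn (x - y) (x - y) = 0" .
  hence "x - y = 0\<^sub>v k" using assms by (simp add: inn_self vnorm2_eq_0)
  hence "x $ i - y $ i = 0" if "i < k" for i
    using that assms by (metis index_minus_vec(1) index_zero_vec(1))
  thus ?thesis using assms by (intro eq_vecI) auto
qed

text \<open>Polarization over the complex field: testing at \<open>x + u\<close> and at
  \<open>x + \<i> u\<close> shows that \<open><M x, u>\<close> and \<open><M u, x>\<close> have
  vanishing sum and vanishing difference. No symmetry of \<open>M\<close> enters, so identities
  between matrices can later be checked on quadratic forms alone.\<close>

lemma form_zero_imp_zero_mat:
  assumes M: "M \<in> carrier_mat k k"
    and z: "\<And>v. v \<in> carrier_vec k \<Longrightarrow> inn (M *\<^sub>v v) v = 0"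
  shows "M = 0\<^sub>m k k"
proof (rule mat_eqI_vec[OF M])
  fix x :: "complex vec" assume x: "x \<in> carrier_vec k"
  show "M *\<^sub>v x = 0\<^sub>m k k *\<^sub>v x"
  proof (rule vec_eqI_inn[of _ k])
    fix u :: "complex vec" assume u: "u \<in> carrier_vec k"
    note d = carrier_matD[OF M] carrier_vecD[OF x] carrier_vecD[OF u]
    have "inn (M *\<^sub>v (x + u)) (x + u) = 0" "inn (M *\<^sub>v (x + \<i> \<cdot>\<^sub>v u)) (x + \<i> \<cdot>\<^sub>v u) = 0"
      using x u by (auto intro!: z)
    hence "inn (M *\<^sub>v x) u + inn (M *\<^sub>v u) x = 0" "- \<i> * inn (M *\<^sub>v x) u + \<i> * inn (M *\<^sub>v u) x = 0"
      using z[OF x] z[OF u] by (auto simp: mvs inns d algebra_simps)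
    hence 1: "inn (M *\<^sub>v u) x = - inn (M *\<^sub>v x) u"
      and 2: "- \<i> * inn (M *\<^sub>v x) u + \<i> * inn (M *\<^sub>v u) x = 0"
      by (simp_all add: add_eq_0_iff)
    have "inn (M *\<^sub>v x) u = 0" using 2 unfolding 1 by simp
    thus "inn (M *\<^sub>v x) u = inn (0\<^sub>m k k *\<^sub>v x) u" by (simp add: d)
  qed (use M x in auto)
qed auto

lemma mat_eqI_form:
  assumes M: "M \<in> carrier_mat k k" and N: "N \<in> carrier_mat k k"
    and z: "\<And>v. v \<in> carrier_vec k \<Longrightarrow> inn (M *\<^sub>v v) v = inn (N *\<^sub>v v) v"
  shows "M = N"
proof -
  have "M - N = 0\<^sub>m k k"
    by (rule form_zero_imp_zero_mat) (use M N z in \<open>auto simp: mvs inns\<close>)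
  thus ?thesis using M N
    by (intro eq_matI) (auto simp: mat_eq_iff)
qed

definition herm :: "complex mat \<Rightarrow> bool" where "herm M \<longleftrightarrow> mat_adjoint M = M"

lemma herm_form_real: "herm M \<Longrightarrow> M \<in> carrier_mat k k \<Longrightarrow> v \<in> carrier_vec k \<Longrightarrow>
    inn (M *\<^sub>v v) v = of_real (Re (inn (M *\<^sub>v v) v))"
  using cnj_inn[of "M *\<^sub>v v" v] inn_mv[of M v v]
  by (auto simp: herm_def complex_eq_iff)

lemma herm_swap: "herm M \<Longrightarrow> M \<in> carrier_mat k k \<Longrightarrow> dim_vec u = k \<Longrightarrow> dim_vec v = k \<Longrightarrow>
    inn (M *\<^sub>v u) v = cnj (inn (M *\<^sub>v v) u)"
  by (subst cnj_inn) (auto simp: herm_def inn_mv)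

text \<open>The form of the adjoint is the complex conjugate of the form of \<open>M\<close>; when
  it is real, both matrices have the same form and so coincide.\<close>

lemma herm_iff_form_real:
  assumes M: "M \<in> carrier_mat k k" and r: "\<And>v. v \<in> carrier_vec k \<Longrightarrow> Im (inn (M *\<^sub>v v) v) = 0"
  shows "herm M"
  unfolding herm_def
proof (rule mat_eqI_form)
  fix v :: "complex vec" assume v: "v \<in> carrier_vec k"
  have "inn (mat_adjoint M *\<^sub>v v) v = cnj (inn (M *\<^sub>v v) v)"
    using M v by (subst cnj_inn) (auto simp: inn_mv)
  also have "\<dots> = inn (M *\<^sub>v v) v" using r[OF v] by (simp add: complex_eq_iff)
  finally show "inn (mat_adjoint M *\<^sub>v v) v = inn (M *\<^sub>v v) v" .
qed (use M in auto)

definition nrm :: "complex vec \<Rightarrow> real" where "nrm v = sqrt (vnorm2 v)"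

lemma nrm_L2: "nrm v = L2_set (\<lambda>i. cmod (v $ i)) {..<dim_vec v}"
  by (simp add: nrm_def L2_set_def vnorm2_def)

lemma nrm_nonneg [simp]: "0 \<le> nrm v"
  by (simp add: nrm_def)

lemma nrm_sq: "(nrm v)\<^sup>2 = vnorm2 v"
  by (simp add: nrm_def)

lemma nrm_add: "dim_vec u = dim_vec v \<Longrightarrow> nrm (u + v) \<le> nrm u + nrm v"
proof -
  assume d: "dim_vec u = dim_vec v"
  have "nrm (u + v) \<le> L2_set (\<lambda>i. cmod (u $ i) + cmod (v $ i)) {..<dim_vec v}"
    unfolding nrm_L2 using d by (auto intro!: L2_set_mono norm_triangle_ineq)
  also have "\<dots> \<le> nrm u + nrm v" unfolding nrm_L2 d by (rule L2_set_triangle_ineq)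
  finally show ?thesis .
qed

lemma cmod_inn_le: "dim_vec u = dim_vec v \<Longrightarrow> cmod (inn u v) \<le> nrm u * nrm v"
proof -
  assume d: "dim_vec u = dim_vec v"
  have "cmod (inn u v) \<le> (\<Sum>i<dim_vec u. cmod (u $ i) * cmod (v $ i))"
    unfolding inn_sum[OF d] by (rule order_trans[OF norm_sum]) (simp add: norm_mult)
  also have "\<dots> \<le> nrm u * nrm v" unfolding nrm_L2 d
    using L2_set_mult_ineq[of "\<lambda>i. cmod (u $ i)" "\<lambda>i. cmod (v $ i)" "{..<dim_vec v}"] by simp
  finally show ?thesis .
qed

lemma cmod_index_le_nrm: "i < dim_vec v \<Longrightarrow> cmod (v $ i) \<le> nrm v"
  unfolding nrm_L2 by (rule member_le_L2_set) auto

lemma nrm_le_bound: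
  assumes "\<And>i. i < dim_vec v \<Longrightarrow> cmod (v $ i) \<le> b"
  shows "nrm v \<le> real (dim_vec v) * b"
proof -
  have "nrm v \<le> (\<Sum>i<dim_vec v. cmod (v $ i))" unfolding nrm_L2 by (rule L2_set_le_sum) auto
  also have "\<dots> \<le> (\<Sum>i<dim_vec v. b)" by (rule sum_mono) (use assms in auto)
  finally show ?thesis by simp
qed

lemma nrm_mv_le:
  assumes "\<And>i j. i < dim_row M \<Longrightarrow> j < dim_col M \<Longrightarrow> cmod (M $$ (i,j)) \<le> b" "dim_col M = dim_vec x"
  shows "nrm (M *\<^sub>v x) \<le> real (dim_row M) * real (dim_col M) * b * nrm x"
proof -
  have "nrm (M *\<^sub>v x) \<le> real (dim_vec (M *\<^sub>v x)) * (real (dim_col M) * b * nrm x)"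
  proof (rule nrm_le_bound)
    fix i assume "i < dim_vec (M *\<^sub>v x)"
    hence i: "i < dim_row M" by simp
    have "cmod ((M *\<^sub>v x) $ i) \<le> (\<Sum>j<dim_vec x. cmod (M $$ (i,j)) * cmod (x $ j))"
      unfolding mv_index[OF i assms(2)] by (rule order_trans[OF norm_sum]) (simp add: norm_mult)
    also have "\<dots> \<le> (\<Sum>j<dim_vec x. b * nrm x)"
      using assms i by (intro sum_mono mult_mono cmod_index_le_nrm) (auto intro: order_trans[OF norm_ge_zero])
    finally show "cmod ((M *\<^sub>v x) $ i) \<le> real (dim_col M) * b * nrm x" using assms by simp
  qed
  thus ?thesis by (simp add: mult_ac)
qed

lemma mat_bounded: "\<exists>K\<ge>0. \<forall>x. dim_vec x = dim_col M \<longrightarrow> nrm (M *\<^sub>v x) \<le> K * nrm x"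
proof -
  define b where "b = (\<Sum>i<dim_row M. \<Sum>j<dim_col M. cmod (M $$ (i,j)))"
  have b: "cmod (M $$ (i,j)) \<le> b" if "i < dim_row M" "j < dim_col M" for i j
  proof -
    have "cmod (M $$ (i,j)) \<le> (\<Sum>j<dim_col M. cmod (M $$ (i,j)))"
      by (rule member_le_sum) (use that in auto)
    also have "\<dots> \<le> b" unfolding b_def
      by (rule member_le_sum[of i _ "\<lambda>i. \<Sum>j<dim_col M. cmod (M $$ (i,j))"]) (use that in \<open>auto intro: sum_nonneg\<close>)
    finally show ?thesis .
  qed
  have "0 \<le> b" by (auto simp: b_def intro!: sum_nonneg)
  moreover have "nrm (M *\<^sub>v x) \<le> real (dim_row M) * real (dim_col M) * b * nrm x"
    if "dim_vec x = dim_col M" for x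
    by (rule nrm_mv_le[OF b]) (use that in auto)
  ultimately show ?thesis
    by (intro exI[of _ "real (dim_row M) * real (dim_col M) * b"]) (metis mult_nonneg_nonneg of_nat_0_le_iff)
qed

text \<open>A rank bound obtained without ranks. If \<open>n < k\<close>, padding both factors with
  zeros to size \<open>k\<close> keeps the product; a one-sided inverse of a square matrix is
  two-sided, but the reversed product has a zero at position \<open>(n,n)\<close>.\<close>

lemma left_inverse_dim_le:
  fixes M N :: "complex mat"
  assumes M: "M \<in> carrier_mat k n" and N: "N \<in> carrier_mat n k" and e: "M * N = 1\<^sub>m k"
  shows "k \<le> n"
proof (rule ccontr)
  assume "\<not> k \<le> n"
  hence nk: "n < k" by simp
  define M' where "M' = mat k k (\<lambda>(i,j). if j < n then M $$ (i,j) else 0)"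
  define N' where "N' = mat k k (\<lambda>(i,j). if i < n then N $$ (i,j) else 0)"
  have "M' * N' = M * N"
  proof (rule eq_matI)
    fix i j assume ij: "i < dim_row (M * N)" "j < dim_col (M * N)"
    have "(M' * N') $$ (i,j) = (\<Sum>l<k. if l < n then M $$ (i,l) * N $$ (l,j) else 0)"
      using ij M N by (auto simp: M'_def N'_def scalar_prod_def lessThan_atLeast0 intro!: sum.cong)
    also have "\<dots> = (\<Sum>l<n. M $$ (i,l) * N $$ (l,j))"
      using nk by (intro sum.mono_neutral_cong_right) auto
    also have "\<dots> = (M * N) $$ (i,j)"
      using ij M N by (auto simp: scalar_prod_def lessThan_atLeast0)
    finally show "(M' * N') $$ (i,j) = (M * N) $$ (i,j)" .
  qed (use M N in \<open>auto simp: M'_def N'_def\<close>)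
  hence "N' * M' = 1\<^sub>m k"
    using e mat_mult_left_right_inverse[of M' k N'] by (simp add: M'_def N'_def)
  hence "(N' * M') $$ (n,n) = 1" using nk by simp
  moreover have "(N' * M') $$ (n,n) = 0" using nk by (auto simp: M'_def N'_def scalar_prod_def)
  ultimately show False by simp
qed

lemma cmat_inv_eq:
  assumes M: "M \<in> carrier_mat k k" and N: "N \<in> carrier_mat k k" and e: "M * N = 1\<^sub>m k"
  shows "cmat_inv M = N"
proof -
  have e': "N * M = 1\<^sub>m k" by (rule mat_mult_left_right_inverse[OF M N e])
  have u: "M \<in> Units (ring_mat TYPE(complex) k ())"
    unfolding Units_def by (auto simp: ring_mat_simps M intro!: bexI[OF _ N] e e')
  obtain B where B: "mat_inverse M = Some B"
    using mat_inverse(1)[OF M, of "()"] u by (cases "mat_inverse M") auto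
  from mat_inverse(2)[OF M B] have b: "M * B = 1\<^sub>m k" "B * M = 1\<^sub>m k" "B \<in> carrier_mat k k" by auto
  have "B = B * (M * N)" using b e by simp
  also have "\<dots> = (B * M) * N" using b M N by (metis assoc_mult_mat)
  also have "\<dots> = N" using b N by simp
  finally show ?thesis by (simp add: cmat_inv_def B)
qed

section \<open>Stable matrices, state sequences and Gramians\<close>

lemma pow_mat_Suc_left: "A \<in> carrier_mat n n \<Longrightarrow> A * A ^\<^sub>m j = A ^\<^sub>m Suc j" for A :: "complex mat"
proof (induction j)
  case (Suc j)
  have "A * (A ^\<^sub>m j * A) = A * A ^\<^sub>m j * A"
    using Suc.prems by (intro assoc_mult_mat[symmetric, of _ n n _ n _ n]) auto
  thus ?case using Suc by simp
qed auto

lemma dim_pow [simp]: "A \<in> carrier_mat n n \<Longrightarrow> dim_row (A ^\<^sub>m j) = n"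
  "A \<in> carrier_mat n n \<Longrightarrow> dim_col (A ^\<^sub>m j) = n" for A :: "complex mat"
  by (auto dest: pow_carrier_mat[of _ _ j])

lemma pow_mv_Suc:
  fixes A :: "complex mat"
  assumes "A \<in> carrier_mat n n" "dim_vec x = n"
  shows "A ^\<^sub>m Suc j *\<^sub>v x = A ^\<^sub>m j *\<^sub>v (A *\<^sub>v x)" "A ^\<^sub>m Suc j *\<^sub>v x = A *\<^sub>v (A ^\<^sub>m j *\<^sub>v x)"
  subgoal using assms by (simp add: mv_assoc)
  subgoal unfolding pow_mat_Suc_left[OF assms(1), symmetric] using assms by (simp add: mv_assoc)
  done

lemma adjoint_pow: "A \<in> carrier_mat n n \<Longrightarrow> mat_adjoint (A ^\<^sub>m j) = mat_adjoint A ^\<^sub>m j"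
  for A :: "complex mat"
proof (induction j)
  case (Suc j)
  have "mat_adjoint (A ^\<^sub>m Suc j) = mat_adjoint A * mat_adjoint (A ^\<^sub>m j)"
    using Suc.prems by (simp add: adjoint_mult)
  also have "\<dots> = mat_adjoint A ^\<^sub>m Suc j"
    using Suc by (simp only: Suc.IH pow_mat_Suc_left[OF adjoint_carrier])
  finally show ?case .
qed auto

text \<open>Stability in the quantitative form that the estimates use. Entrywise geometric decay
  passes directly to the adjoint and to \<open>z A\<close> with \<open>|z| \<le> 1\<close>.\<close>

definition geo_stable :: "nat \<Rightarrow> complex mat \<Rightarrow> bool" where
  "geo_stable n A \<longleftrightarrow> A \<in> carrier_mat n n \<and> (\<exists>c \<rho>. 0 \<le> c \<and> 0 < \<rho> \<and> \<rho> < 1 \<and>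
     (\<forall>j. \<forall>i<n. \<forall>l<n. cmod ((A ^\<^sub>m j) $$ (i,l)) \<le> c * \<rho> ^ j))"

lemma geo_stable_adjoint: "geo_stable n A \<Longrightarrow> geo_stable n (mat_adjoint A)"
proof -
  assume "geo_stable n A"
  then obtain c \<rho> where A: "A \<in> carrier_mat n n" and c: "0 \<le> c" "0 < \<rho>" "\<rho> < 1"
    and b: "\<And>j i l. i < n \<Longrightarrow> l < n \<Longrightarrow> cmod ((A ^\<^sub>m j) $$ (i,l)) \<le> c * \<rho> ^ j"
    unfolding geo_stable_def by blast
  have "cmod ((mat_adjoint A ^\<^sub>m j) $$ (i,l)) \<le> c * \<rho> ^ j" if "i < n" "l < n" for i j l
    using b[OF that(2,1), of j] that A by (simp add: adjoint_pow[OF A, symmetric])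
  thus ?thesis using A c unfolding geo_stable_def by blast
qed

lemma geo_stable_carrier: "geo_stable n A \<Longrightarrow> A \<in> carrier_mat n n"
  by (simp add: geo_stable_def)

lemma geo_stable_nrm:
  assumes "geo_stable n A"
  obtains c \<rho> where "0 \<le> c" "0 < \<rho>" "\<rho> < 1"
    "\<And>j x. dim_vec x = n \<Longrightarrow> nrm (A ^\<^sub>m j *\<^sub>v x) \<le> c * \<rho> ^ j * nrm x"
proof -
  from assms obtain c \<rho> where A: "A \<in> carrier_mat n n" and c: "0 \<le> c" "0 < \<rho>" "\<rho> < 1"
    and b: "\<And>j i l. i < n \<Longrightarrow> l < n \<Longrightarrow> cmod ((A ^\<^sub>m j) $$ (i,l)) \<le> c * \<rho> ^ j"
    unfolding geo_stable_def by blast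
  have "nrm (A ^\<^sub>m j *\<^sub>v x) \<le> (real n * real n * c) * \<rho> ^ j * nrm x" if "dim_vec x = n" for j x
    using nrm_mv_le[of "A ^\<^sub>m j" "c * \<rho> ^ j" x] b A that by (simp add: mult_ac)
  thus thesis using c by (intro that[of "real n * real n * c" \<rho>]) auto
qed

lemma smult_pow: "A \<in> carrier_mat n n \<Longrightarrow> (a \<cdot>\<^sub>m A) ^\<^sub>m j = a ^ j \<cdot>\<^sub>m (A ^\<^sub>m j)" for A :: "complex mat"
proof (induction j)
  case (Suc j)
  have "(a ^ j \<cdot>\<^sub>m (A ^\<^sub>m j)) * (a \<cdot>\<^sub>m A) = a ^ Suc j \<cdot>\<^sub>m (A ^\<^sub>m j * A)"
    using Suc.prems pow_carrier_mat[OF Suc.prems, of j]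
    by (intro mat_eqI_vec[of _ n n]) (auto simp: mvs smult_smult_assoc mult_ac)
  thus ?case using Suc by simp
qed auto

text \<open>Scaling reduces the claim to bounded powers: for \<rho> strictly between the spectral
  radius and 1, \<open>B = A / \<rho>\<close> has spectral radius below 1, so its powers are bounded
  entrywise, and \<open>A^j = \<rho>^j B^j\<close>.\<close>

lemma stable_imp_geo_stable:
  assumes "stable_mat n A"
  shows "geo_stable n A"
proof -
  from assms have A: "A \<in> carrier_mat n n" and ev: "\<And>k. eigenvalue A k \<Longrightarrow> cmod k < 1"
    by (auto simp: stable_mat_def)
  show ?thesis
  proof (cases "n = 0")
    case True
    thus ?thesis using A by (auto simp: geo_stable_def intro!: exI[of _ 0] exI[of _ "1/2"])
  next
    case False
    hence n: "0 < n" by simp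
    define r where "r = spectral_radius A"
    have r: "r \<in> norm ` spectrum A" unfolding r_def by (rule spectral_radius_mem_max(1)[OF A n])
    have r0: "0 \<le> r" "r < 1" using r ev by (auto simp: spectrum_def)
    \<comment> \<open>The midpoint of \<open>r\<close> and 1 is positive even when
      \<open>r = 0\<close>, so a nilpotent \<open>A\<close> can be divided by it too.\<close>
    define \<rho> where "\<rho> = (1 + r) / 2"
    have \<rho>: "0 < \<rho>" "\<rho> < 1" "r < \<rho>" using r0 by (auto simp: \<rho>_def)
    define B where "B = (1 / complex_of_real \<rho>) \<cdot>\<^sub>m A"
    have B: "B \<in> carrier_mat n n" using A by (simp add: B_def)
    have "spectral_radius B \<in> norm ` spectrum B" by (rule spectral_radius_mem_max(1)[OF B n])
    then obtain k where k: "eigenvalue B k" "spectral_radius B = cmod k" by (auto simp: spectrum_def)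
    from k(1) obtain v where v: "v \<in> carrier_vec n" "v \<noteq> 0\<^sub>v n" "B *\<^sub>v v = k \<cdot>\<^sub>v v"
      using B by (auto simp: eigenvalue_def eigenvector_def)
    have AB: "A = complex_of_real \<rho> \<cdot>\<^sub>m B"
      using \<rho> A by (intro eq_matI) (auto simp: B_def)
    have "A *\<^sub>v v = (\<rho> * k) \<cdot>\<^sub>v v"
      unfolding AB using B v by (simp add: mvs smult_smult_assoc)
    hence "eigenvalue A (\<rho> * k)" using v A by (auto simp: eigenvalue_def eigenvector_def)
    hence "cmod (\<rho> * k) \<le> r"
      unfolding r_def using spectral_radius_mem_max(2)[OF A n, of "cmod (\<rho> * k)"] by (auto simp: spectrum_def)
    hence "\<rho> * cmod k \<le> r" using \<rho> by (simp add: norm_mult)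
    hence "\<rho> * cmod k < \<rho> * 1" using \<rho> by linarith
    hence "spectral_radius B < 1" using \<rho> k by (simp only: mult_less_cancel_left_pos)
    from spectral_radius_jnf_norm_bound_less_1_upper_triangular[OF B this]
    obtain c where c: "\<And>j. norm_bound (B ^\<^sub>m j) c" by blast
    have "cmod ((A ^\<^sub>m j) $$ (i,l)) \<le> \<bar>c\<bar> * \<rho> ^ j" if "i < n" "l < n" for i j l
    proof -
      have "cmod ((B ^\<^sub>m j) $$ (i,l)) \<le> c" using c[of j] that B by (auto simp: norm_bound_def)
      hence "\<rho> ^ j * cmod ((B ^\<^sub>m j) $$ (i,l)) \<le> \<rho> ^ j * \<bar>c\<bar>"
        using \<rho> by (intro mult_left_mono) auto
      moreover have "(A ^\<^sub>m j) $$ (i,l) = \<rho> ^ j * (B ^\<^sub>m j) $$ (i,l)"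
        unfolding AB smult_pow[OF B] using that B by simp
      ultimately show ?thesis using \<rho> by (simp add: norm_mult norm_power mult_ac)
    qed
    thus ?thesis using A \<rho> unfolding geo_stable_def by (intro conjI exI[of _ "\<bar>c\<bar>"] exI[of _ \<rho>]) auto
  qed
qed

section \<open>Series of vectors and states driven by sequences\<close>

definition vsummable :: "nat \<Rightarrow> (nat \<Rightarrow> complex vec) \<Rightarrow> bool" where
  "vsummable n f \<longleftrightarrow> (\<forall>j. dim_vec (f j) = n) \<and> (\<forall>l<n. summable (\<lambda>j. f j $ l))"

lemma dim_vec_suminf [simp]: "dim_vec (vec_suminf n f) = n"
  by (simp add: vec_suminf_def)

lemma vec_suminf_index [simp]: "l < n \<Longrightarrow> vec_suminf n f $ l = (\<Sum>j. f j $ l)"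
  by (simp add: vec_suminf_def)

lemma vsummable_mv:
  assumes f: "vsummable n f" and M: "dim_col M = n" "dim_row M = r"
  shows "vsummable r (\<lambda>j. M *\<^sub>v f j)" "M *\<^sub>v vec_suminf n f = vec_suminf r (\<lambda>j. M *\<^sub>v f j)"
proof -
  have s: "summable (\<lambda>j. f j $ l)" if "l < n" for l using f that by (simp add: vsummable_def)
  have d: "dim_vec (f j) = n" for j using f by (simp add: vsummable_def)
  have e: "(M *\<^sub>v f j) $ l = (\<Sum>i<n. M $$ (l,i) * f j $ i)" if "l < r" for j l
    using that M d by (simp add: mv_index del: index_mult_mat_vec)
  have sm: "(\<lambda>j. (M *\<^sub>v f j) $ l) sums (\<Sum>i<n. M $$ (l,i) * (\<Sum>j. f j $ i))" if "l < r" for l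
    unfolding e[OF that] by (intro sums_sum sums_mult summable_sums s) auto
  show "vsummable r (\<lambda>j. M *\<^sub>v f j)" using sm M by (auto simp: vsummable_def sums_iff)
  show "M *\<^sub>v vec_suminf n f = vec_suminf r (\<lambda>j. M *\<^sub>v f j)"
  proof (rule eq_vecI)
    fix l assume "l < dim_vec (vec_suminf r (\<lambda>j. M *\<^sub>v f j))"
    hence l: "l < r" by simp
    have "(M *\<^sub>v vec_suminf n f) $ l = (\<Sum>i<n. M $$ (l,i) * (\<Sum>j. f j $ i))"
      using l M by (simp add: mv_index del: index_mult_mat_vec)
    also have "\<dots> = vec_suminf r (\<lambda>j. M *\<^sub>v f j) $ l" using sm[OF l] l by (simp add: sums_iff)
    finally show "(M *\<^sub>v vec_suminf n f) $ l = vec_suminf r (\<lambda>j. M *\<^sub>v f j) $ l" .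
  qed (use M in simp)
qed

lemma vsummable_head:
  assumes "vsummable n f"
  shows "vec_suminf n f = f 0 + vec_suminf n (\<lambda>j. f (Suc j))"
proof (rule eq_vecI)
  fix l assume "l < dim_vec (f 0 + vec_suminf n (\<lambda>j. f (Suc j)))"
  hence l: "l < n" by simp
  hence "summable (\<lambda>j. f j $ l)" using assms by (simp add: vsummable_def)
  from suminf_split_head[OF this] show "vec_suminf n f $ l = (f 0 + vec_suminf n (\<lambda>j. f (Suc j))) $ l"
    using l assms by (simp add: vsummable_def)
qed simp

lemma vsummable_inn:
  assumes f: "vsummable n f" and u: "dim_vec u = n"
  shows "(\<lambda>j. inn (f j) u) sums inn (vec_suminf n f) u"
proof -
  have s: "summable (\<lambda>j. f j $ l)" if "l < n" for l using f that by (simp add: vsummable_def)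
  have d: "dim_vec (f j) = n" for j using f by (simp add: vsummable_def)
  have "(\<lambda>j. \<Sum>l<n. f j $ l * cnj (u $ l)) sums (\<Sum>l<n. (\<Sum>j. f j $ l) * cnj (u $ l))"
    by (intro sums_sum sums_mult2 summable_sums s) auto
  thus ?thesis using u d by (simp add: inn_sum)
qed

lemma vsummable_bound:
  assumes d: "\<And>j. dim_vec (f j) = n" and b: "\<And>j. nrm (f j) \<le> b j" and s: "summable b"
  shows "vsummable n f" "nrm (vec_suminf n f) \<le> real n * (\<Sum>j. b j)"
proof -
  have c: "cmod (f j $ l) \<le> b j" if "l < n" for j l
    using cmod_index_le_nrm[of l "f j"] b[of j] that d by simp
  show "vsummable n f" unfolding vsummable_def using d c s
    by (auto intro!: summable_comparison_test'[of b 0])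
  have "nrm (vec_suminf n f) \<le> real (dim_vec (vec_suminf n f)) * (\<Sum>j. b j)"
  proof (rule nrm_le_bound)
    fix l assume "l < dim_vec (vec_suminf n f)"
    hence l: "l < n" by simp
    have sn: "summable (\<lambda>j. cmod (f j $ l))"
      using c[OF l] s by (auto intro!: summable_comparison_test'[of b 0])
    have "cmod (\<Sum>j. f j $ l) \<le> (\<Sum>j. cmod (f j $ l))" by (rule summable_norm[OF sn])
    also have "\<dots> \<le> (\<Sum>j. b j)" by (rule suminf_le[OF c[OF l] sn s])
    finally show "cmod (vec_suminf n f $ l) \<le> (\<Sum>j. b j)" using l by simp
  qed
  thus "nrm (vec_suminf n f) \<le> real n * (\<Sum>j. b j)" by simp
qed

lemma summable_geo_bounded:
  fixes a :: "nat \<Rightarrow> real"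
  assumes "0 < \<rho>" "\<rho> < 1" "\<And>i. 0 \<le> a i" "\<And>i. a i \<le> b"
  shows "summable (\<lambda>i. \<rho> ^ i * a i)"
proof (rule summable_comparison_test'[of "\<lambda>i. b * \<rho> ^ i" 0])
  show "summable (\<lambda>i. b * \<rho> ^ i)" using assms by (intro summable_mult summable_geometric) auto
  show "norm (\<rho> ^ i * a i) \<le> b * \<rho> ^ i" for i
    using assms by (simp add: abs_mult mult.commute mult_right_mono)
qed

text \<open>The convolution \<open>t\<close> obeys \<open>t_j = a_j + \<rho> t_{j+1}\<close>, so
  each square is bounded by a multiple of \<open>a_j^2\<close> plus \<rho> times the next square;
  since \<open>\<rho> < 1\<close>, the shifted sum can be absorbed on the left.\<close>

lemma square_summable_geo_conv:
  fixes a :: "nat \<Rightarrow> real"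
  assumes \<rho>: "0 < \<rho>" "\<rho> < 1" and a: "\<And>i. 0 \<le> a i" and s: "summable (\<lambda>i. (a i)\<^sup>2)"
  shows "summable (\<lambda>j. (\<Sum>i. \<rho> ^ i * a (i + j))\<^sup>2)"
proof -
  define t where "t j = (\<Sum>i. \<rho> ^ i * a (i + j))" for j
  define Y where "Y = (\<Sum>i. (a i)\<^sup>2)"
  have aY: "a i \<le> sqrt Y" for i
    using sum_le_suminf[OF s, of "{i}"] a[of i] unfolding Y_def by (intro real_le_rsqrt) auto
  have sm: "summable (\<lambda>i. \<rho> ^ i * a (i + j))" for j
    using \<rho> a aY by (intro summable_geo_bounded) auto
  have t0: "0 \<le> t j" for j unfolding t_def using \<rho> a by (intro suminf_nonneg sm) auto
  have rec: "t j = a j + \<rho> * t (Suc j)" for j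
  proof -
    have "t j = a j + (\<Sum>i. \<rho> ^ Suc i * a (Suc i + j))"
      unfolding t_def using suminf_split_head[OF sm[of j]] by simp
    also have "(\<Sum>i. \<rho> ^ Suc i * a (Suc i + j)) = (\<Sum>i. \<rho> * (\<rho> ^ i * a (i + Suc j)))"
      by (simp add: mult_ac)
    also have "\<dots> = \<rho> * t (Suc j)" unfolding t_def by (rule suminf_mult[OF sm])
    finally show ?thesis .
  qed
  have tb: "t j \<le> sqrt Y / (1 - \<rho>)" for j
  proof -
    have "t j \<le> (\<Sum>i. \<rho> ^ i * sqrt Y)" unfolding t_def
      using \<rho> aY by (intro suminf_le sm mult_left_mono summable_mult2 summable_geometric) auto
    also have "\<dots> = sqrt Y / (1 - \<rho>)"
      using \<rho> by (subst suminf_mult2[symmetric]) (auto simp: suminf_geometric intro: summable_geometric)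
    finally show ?thesis .
  qed
  \<comment> \<open>Convexity of the square with weights \<open>1 - \<rho>\<close> and \<rho>,
    applied to \<open>a_j / (1 - \<rho>)\<close> and \<open>t_{j+1}\<close>.\<close>
  have step: "(t j)\<^sup>2 \<le> (a j)\<^sup>2 / (1 - \<rho>) + \<rho> * (t (Suc j))\<^sup>2" for j
  proof -
    have "(1 - \<rho>) * ((a j)\<^sup>2 / (1 - \<rho>) + \<rho> * (t (Suc j))\<^sup>2 - (a j + \<rho> * t (Suc j))\<^sup>2)
        = \<rho> * (a j - (1 - \<rho>) * t (Suc j))\<^sup>2"
      using \<rho> by (simp add: field_simps power2_eq_square)
    moreover have "0 \<le> \<rho> * (a j - (1 - \<rho>) * t (Suc j))\<^sup>2" using \<rho> by simp
    ultimately have "0 \<le> (1 - \<rho>) * ((a j)\<^sup>2 / (1 - \<rho>) + \<rho> * (t (Suc j))\<^sup>2 - (a j + \<rho> * t (Suc j))\<^sup>2)"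
      by simp
    thus ?thesis using \<rho> unfolding rec[of j] by (simp add: zero_le_mult_iff)
  qed
  have "(\<Sum>j<N. (t j)\<^sup>2) \<le> (Y / (1 - \<rho>) + \<rho> * (sqrt Y / (1 - \<rho>))\<^sup>2) / (1 - \<rho>)" for N
  proof -
    have "(\<Sum>j<N. (t j)\<^sup>2) \<le> (\<Sum>j<N. (a j)\<^sup>2 / (1 - \<rho>) + \<rho> * (t (Suc j))\<^sup>2)" by (intro sum_mono step)
    also have "\<dots> = (\<Sum>j<N. (a j)\<^sup>2) / (1 - \<rho>) + \<rho> * (\<Sum>j<N. (t (Suc j))\<^sup>2)"
      by (simp add: sum.distrib sum_divide_distrib sum_distrib_left)
    \<comment> \<open>The shift leaves the boundary term \<open>(t N)^2\<close>; the uniform bound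
      \<open>tb\<close> controls it before summability is known.\<close>
    also have "(\<Sum>j<N. (t (Suc j))\<^sup>2) = (\<Sum>j<N. (t j)\<^sup>2) + (t N)\<^sup>2 - (t 0)\<^sup>2"
      using sum.lessThan_Suc_shift[of "\<lambda>j. (t j)\<^sup>2" N] by simp
    finally have "(1 - \<rho>) * (\<Sum>j<N. (t j)\<^sup>2) \<le> (\<Sum>j<N. (a j)\<^sup>2) / (1 - \<rho>) + \<rho> * ((t N)\<^sup>2 - (t 0)\<^sup>2)"
      by (simp add: algebra_simps)
    also have "\<dots> \<le> Y / (1 - \<rho>) + \<rho> * (sqrt Y / (1 - \<rho>))\<^sup>2"
    proof (rule add_mono)
      show "(\<Sum>j<N. (a j)\<^sup>2) / (1 - \<rho>) \<le> Y / (1 - \<rho>)"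
        unfolding Y_def using \<rho> by (intro divide_right_mono sum_le_suminf s) auto
      have "(t N)\<^sup>2 \<le> (sqrt Y / (1 - \<rho>))\<^sup>2" by (intro power_mono tb t0)
      thus "\<rho> * ((t N)\<^sup>2 - (t 0)\<^sup>2) \<le> \<rho> * (sqrt Y / (1 - \<rho>))\<^sup>2"
        using \<rho> zero_le_power2[of "t 0"] by (intro mult_left_mono) (linarith, simp)
    qed
    finally show ?thesis using \<rho> by (simp add: pos_le_divide_eq mult.commute)
  qed
  hence "(\<Sum>j\<le>N. (t j)\<^sup>2) \<le> (Y / (1 - \<rho>) + \<rho> * (sqrt Y / (1 - \<rho>))\<^sup>2) / (1 - \<rho>)" for N
    unfolding lessThan_Suc_atMost[symmetric] .
  hence "summable (\<lambda>j. (t j)\<^sup>2)" by (intro bounded_imp_summable) auto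
  thus ?thesis by (simp add: t_def)
qed

text \<open>The solution of \<open>s_j = B y_j + M s_{j+1}\<close> that depends only on
  \<open>y\<close> from time \<open>j\<close> on. With \<open>M = A^*\<close> and
  \<open>B = C^*\<close> it is the sequence \<open>s_j\<close> of the overview; with the output
  matrix of a factor in place of \<open>C\<close> it is the state of the adjoint operator of that
  factor.\<close>

definition bwd_state :: "complex mat \<Rightarrow> complex mat \<Rightarrow> (nat \<Rightarrow> complex vec) \<Rightarrow> nat \<Rightarrow> complex vec" where
  "bwd_state M B y j = vec_suminf (dim_row M) (\<lambda>i. M ^\<^sub>m i *\<^sub>v (B *\<^sub>v y (i + j)))"

definition vbounded :: "nat \<Rightarrow> (nat \<Rightarrow> complex vec) \<Rightarrow> bool" where
  "vbounded m y \<longleftrightarrow> (\<forall>i. y i \<in> carrier_vec m) \<and> (\<exists>b. \<forall>i. nrm (y i) \<le> b)"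

lemma ell2_summable_nrm: "ell2 m y \<Longrightarrow> summable (\<lambda>i. (nrm (y i))\<^sup>2)"
  by (simp add: ell2_def nrm_sq)

lemma ell2_imp_vbounded: "ell2 m y \<Longrightarrow> vbounded m y"
proof -
  assume y: "ell2 m y"
  have "nrm (y i) \<le> sqrt (\<Sum>i. vnorm2 (y i))" for i
    using sum_le_suminf[of "\<lambda>i. vnorm2 (y i)" "{i}"] y unfolding nrm_def
    by (intro real_sqrt_le_mono) (auto simp: ell2_def)
  thus ?thesis using y by (auto simp: ell2_def vbounded_def)
qed

lemma geo_stable_bound:
  assumes M: "geo_stable n M" and B: "B \<in> carrier_mat n m"
  obtains K \<rho> where "0 \<le> K" "0 < \<rho>" "\<rho> < 1"
    "\<And>j u. dim_vec u = m \<Longrightarrow> nrm (M ^\<^sub>m j *\<^sub>v (B *\<^sub>v u)) \<le> K * \<rho> ^ j * nrm u"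
proof -
  from geo_stable_nrm[OF M] obtain c \<rho> where c: "0 \<le> c" "0 < \<rho>" "\<rho> < 1"
    "\<And>j x. dim_vec x = n \<Longrightarrow> nrm (M ^\<^sub>m j *\<^sub>v x) \<le> c * \<rho> ^ j * nrm x" by blast
  from mat_bounded[of B] obtain k where k: "0 \<le> k" "\<And>x. dim_vec x = m \<Longrightarrow> nrm (B *\<^sub>v x) \<le> k * nrm x"
    using B by auto
  have "nrm (M ^\<^sub>m j *\<^sub>v (B *\<^sub>v u)) \<le> c * k * \<rho> ^ j * nrm u" if u: "dim_vec u = m" for j u
  proof -
    have "nrm (M ^\<^sub>m j *\<^sub>v (B *\<^sub>v u)) \<le> c * \<rho> ^ j * nrm (B *\<^sub>v u)" using c(4) B by simp
    also have "\<dots> \<le> c * \<rho> ^ j * (k * nrm u)" using c k u by (intro mult_left_mono) auto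
    finally show ?thesis by (simp add: mult_ac)
  qed
  thus thesis using c k by (intro that[of "c * k" \<rho>]) auto
qed

lemma bwd_state_summable:
  assumes M: "geo_stable n M" and B: "B \<in> carrier_mat n m" and y: "vbounded m y"
  shows "vsummable n (\<lambda>i. M ^\<^sub>m i *\<^sub>v (B *\<^sub>v y (i + j)))"
proof -
  from geo_stable_bound[OF M B] obtain K \<rho> where K: "0 \<le> K" "0 < \<rho>" "\<rho> < 1"
    "\<And>j u. dim_vec u = m \<Longrightarrow> nrm (M ^\<^sub>m j *\<^sub>v (B *\<^sub>v u)) \<le> K * \<rho> ^ j * nrm u" by blast
  from y obtain b where b: "\<And>i. nrm (y i) \<le> b" "\<And>i. dim_vec (y i) = m" by (auto simp: vbounded_def)
  show ?thesis
  proof (rule vsummable_bound(1))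
    show "nrm (M ^\<^sub>m i *\<^sub>v (B *\<^sub>v y (i + j))) \<le> K * b * \<rho> ^ i" for i
    proof -
      have "nrm (M ^\<^sub>m i *\<^sub>v (B *\<^sub>v y (i + j))) \<le> K * \<rho> ^ i * nrm (y (i + j))" using K(4) b by simp
      also have "\<dots> \<le> K * \<rho> ^ i * b" using K b by (intro mult_left_mono) auto
      finally show ?thesis by (simp add: mult_ac)
    qed
    show "summable (\<lambda>i. K * b * \<rho> ^ i)" using K by (intro summable_mult summable_geometric) auto
  qed (use geo_stable_carrier[OF M] in simp)
qed

lemma dim_bwd_state [simp]: "dim_vec (bwd_state M B y j) = dim_row M"
  by (simp add: bwd_state_def)

lemma bwd_state_step:
  assumes M: "geo_stable n M" and B: "B \<in> carrier_mat n m" and y: "vbounded m y"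
  shows "bwd_state M B y j = B *\<^sub>v y j + M *\<^sub>v bwd_state M B y (Suc j)"
proof -
  note A = geo_stable_carrier[OF M]
  have dy: "dim_vec (y i) = m" for i using y by (auto simp: vbounded_def)
  have "bwd_state M B y j = M ^\<^sub>m 0 *\<^sub>v (B *\<^sub>v y (0 + j)) + vec_suminf n (\<lambda>i. M ^\<^sub>m Suc i *\<^sub>v (B *\<^sub>v y (Suc i + j)))"
    unfolding bwd_state_def using vsummable_head[OF bwd_state_summable[OF M B y, of j]] A by simp
  also have "vec_suminf n (\<lambda>i. M ^\<^sub>m Suc i *\<^sub>v (B *\<^sub>v y (Suc i + j)))
     = vec_suminf n (\<lambda>i. M *\<^sub>v (M ^\<^sub>m i *\<^sub>v (B *\<^sub>v y (i + Suc j))))"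
    using A B dy by (simp only: pow_mv_Suc(2)[OF A] dim_mv carrier_matD[OF B] add_Suc_right add_Suc)
  also have "\<dots> = M *\<^sub>v bwd_state M B y (Suc j)"
    unfolding bwd_state_def using vsummable_mv(2)[OF bwd_state_summable[OF M B y, of "Suc j"], of M n] A by simp
  finally show ?thesis using A B dy by simp
qed

text \<open>Up to a constant, the norm of the state is dominated by the geometric convolution of the
  norms of \<open>y\<close>, so the scalar lemma applies.\<close>

lemma bwd_state_ell2:
  assumes M: "geo_stable n M" and B: "B \<in> carrier_mat n m" and y: "ell2 m y"
  shows "ell2 n (bwd_state M B y)"
proof -
  note A = geo_stable_carrier[OF M]
  from geo_stable_bound[OF M B] obtain K \<rho> where K: "0 \<le> K" "0 < \<rho>" "\<rho> < 1"
    "\<And>j u. dim_vec u = m \<Longrightarrow> nrm (M ^\<^sub>m j *\<^sub>v (B *\<^sub>v u)) \<le> K * \<rho> ^ j * nrm u" by blast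
  from ell2_imp_vbounded[OF y] obtain b where b: "\<And>i. nrm (y i) \<le> b" "\<And>i. dim_vec (y i) = m"
    by (auto simp: vbounded_def)
  have sm: "summable (\<lambda>i. \<rho> ^ i * nrm (y (i + j)))" for j
    using K b by (intro summable_geo_bounded) auto
  have le: "nrm (bwd_state M B y j) \<le> real n * K * (\<Sum>i. \<rho> ^ i * nrm (y (i + j)))" for j
  proof -
    have "nrm (vec_suminf n (\<lambda>i. M ^\<^sub>m i *\<^sub>v (B *\<^sub>v y (i + j)))) \<le> real n * (\<Sum>i. K * (\<rho> ^ i * nrm (y (i + j))))"
    proof (rule vsummable_bound(2))
      show "nrm (M ^\<^sub>m i *\<^sub>v (B *\<^sub>v y (i + j))) \<le> K * (\<rho> ^ i * nrm (y (i + j)))" for i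
        using K(4)[of "y (i + j)" i] b by (simp add: mult_ac)
      show "summable (\<lambda>i. K * (\<rho> ^ i * nrm (y (i + j))))" by (intro summable_mult sm)
    qed (use A in simp)
    thus ?thesis using A by (simp add: bwd_state_def suminf_mult[OF sm] mult_ac)
  qed
  have "summable (\<lambda>j. (\<Sum>i. \<rho> ^ i * nrm (y (i + j)))\<^sup>2)"
    using K ell2_summable_nrm[OF y] by (intro square_summable_geo_conv) auto
  hence s: "summable (\<lambda>j. (real n * K)\<^sup>2 * (\<Sum>i. \<rho> ^ i * nrm (y (i + j)))\<^sup>2)" by (rule summable_mult)
  have "vnorm2 (bwd_state M B y j) \<le> (real n * K)\<^sup>2 * (\<Sum>i. \<rho> ^ i * nrm (y (i + j)))\<^sup>2" for j
    using power_mono[OF le[of j] nrm_nonneg, of 2] by (simp add: nrm_sq power_mult_distrib)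
  hence "summable (\<lambda>j. vnorm2 (bwd_state M B y j))"
    by (intro summable_comparison_test'[OF s]) auto
  thus ?thesis using A by (auto simp: ell2_def intro!: carrier_vecI)
qed

lemma ell2_tendsto_0: "ell2 m y \<Longrightarrow> (\<lambda>i. nrm (y i)) \<longlonglongrightarrow> 0"
proof -
  assume "ell2 m y"
  hence "(\<lambda>i. vnorm2 (y i)) \<longlonglongrightarrow> 0" by (intro summable_LIMSEQ_zero) (simp add: ell2_def)
  from tendsto_real_sqrt[OF this] show ?thesis by (simp add: nrm_def)
qed

lemma ell2_mv:
  assumes y: "ell2 m y" and M: "M \<in> carrier_mat r m"
  shows "ell2 r (\<lambda>i. M *\<^sub>v y i)"
proof -
  have d: "dim_vec (y i) = m" for i using y by (auto simp: ell2_def)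
  from mat_bounded[of M] M obtain K where K: "0 \<le> K" "\<And>x. dim_vec x = m \<Longrightarrow> nrm (M *\<^sub>v x) \<le> K * nrm x"
    by auto
  have "vnorm2 (M *\<^sub>v y i) \<le> K\<^sup>2 * (nrm (y i))\<^sup>2" for i
    using power_mono[OF K(2)[OF d[of i]] nrm_nonneg, of 2] by (simp add: nrm_sq power_mult_distrib)
  hence "summable (\<lambda>i. vnorm2 (M *\<^sub>v y i))"
    by (intro summable_comparison_test'[OF summable_mult[OF ell2_summable_nrm[OF y], of "K\<^sup>2"]]) auto
  thus ?thesis using M d by (auto simp: ell2_def intro!: carrier_vecI)
qed

lemma vnorm2_add_le: "dim_vec u = dim_vec v \<Longrightarrow> vnorm2 (u + v) \<le> 2 * vnorm2 u + 2 * vnorm2 v"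
proof -
  assume d: "dim_vec u = dim_vec v"
  have "vnorm2 (u + v) + vnorm2 (u - v) = 2 * vnorm2 u + 2 * vnorm2 v"
    using d by (simp add: vnorm2_Re inns)
  thus ?thesis using vnorm2_nonneg[of "u - v"] by linarith
qed

lemma ell2_add:
  assumes y: "ell2 m y" and z: "ell2 m z"
  shows "ell2 m (\<lambda>i. y i + z i)"
proof -
  have d: "dim_vec (y i) = m" "dim_vec (z i) = m" for i using y z by (auto simp: ell2_def)
  have "summable (\<lambda>i. 2 * vnorm2 (y i) + 2 * vnorm2 (z i))"
    using y z by (intro summable_add summable_mult) (auto simp: ell2_def)
  hence "summable (\<lambda>i. vnorm2 (y i + z i))"
    by (rule summable_comparison_test'[of _ 0]) (use d in \<open>auto intro!: vnorm2_add_le\<close>)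
  thus ?thesis using y z by (auto simp: ell2_def)
qed

lemma ell2_shift: "ell2 m y \<Longrightarrow> ell2 m (\<lambda>i. y (Suc i))"
  unfolding ell2_def by (subst summable_Suc_iff) auto

text \<open>The initial state is a parameter because three choices occur: zero for Toeplitz
  operators, \<open>-x\<close> in the lower bound for the form, and \<open>x\<close> with zero
  input, which traces \<open>A^i x\<close>.\<close>

primrec fwd_state :: "complex mat \<Rightarrow> complex mat \<Rightarrow> complex vec \<Rightarrow> (nat \<Rightarrow> complex vec) \<Rightarrow> nat \<Rightarrow> complex vec" where
  "fwd_state A B x0 y 0 = x0"
| "fwd_state A B x0 y (Suc i) = A *\<^sub>v fwd_state A B x0 y i + B *\<^sub>v y i"

lemma dim_fwd_state: "A \<in> carrier_mat n n \<Longrightarrow> B \<in> carrier_mat n m \<Longrightarrow> dim_vec x0 = n \<Longrightarrow> dim_vec (fwd_state A B x0 y i) = n"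
  by (cases i) auto

text \<open>A single application of \<open>A\<close> may increase the norm. The induction therefore
  bounds \<open>A^l\<close> applied to the state by \<open>c \<rho>^l S\<close> for all
  \<open>l\<close> at once; a time step raises \<open>l\<close> by one and so gains a factor
  \<rho>.\<close>

lemma fwd_state_bounded:
  assumes A: "geo_stable n A" and B: "B \<in> carrier_mat n m" and y: "vbounded m y" and x0: "dim_vec x0 = n"
  shows "\<exists>X. \<forall>i. nrm (fwd_state A B x0 y i) \<le> X"
proof -
  note Ac = geo_stable_carrier[OF A]
  note dx = dim_fwd_state[OF Ac B x0, of y]
  from geo_stable_nrm[OF A] obtain c \<rho> where c: "0 \<le> c" "0 < \<rho>" "\<rho> < 1"
    "\<And>j x. dim_vec x = n \<Longrightarrow> nrm (A ^\<^sub>m j *\<^sub>v x) \<le> c * \<rho> ^ j * nrm x" by blast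
  from mat_bounded[of B] obtain k where k: "0 \<le> k" "\<And>x. dim_vec x = m \<Longrightarrow> nrm (B *\<^sub>v x) \<le> k * nrm x"
    using B by auto
  from y obtain b where b: "\<And>i. nrm (y i) \<le> b" "\<And>i. dim_vec (y i) = m" by (auto simp: vbounded_def)
  have b0: "0 \<le> b" using b(1)[of 0] nrm_nonneg[of "y 0"] by linarith
  \<comment> \<open>\<open>S\<close> dominates the norm of \<open>x0\<close> and is not increased by
    the map \<open>S \<mapsto> \<rho> S + k b\<close>, whose fixed point is
    \<open>k b / (1 - \<rho>)\<close>.\<close>
  define S where "S = nrm x0 + k * b / (1 - \<rho>)"
  have S: "\<rho> * S + k * b \<le> S"
  proof -
    have "(1 - \<rho>) * (k * b / (1 - \<rho>)) = k * b" using c by simp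
    hence "S - (\<rho> * S + k * b) = (1 - \<rho>) * nrm x0"
      unfolding S_def by (simp only: algebra_simps)
    moreover have "0 \<le> (1 - \<rho>) * nrm x0" using c by simp
    ultimately show ?thesis by simp
  qed
  have "nrm (A ^\<^sub>m l *\<^sub>v fwd_state A B x0 y i) \<le> c * \<rho> ^ l * S" for i l
  proof (induction i arbitrary: l)
    case 0
    have "nrm x0 \<le> S" using k b0 c by (simp add: S_def)
    hence "c * \<rho> ^ l * nrm x0 \<le> c * \<rho> ^ l * S" using c by (intro mult_left_mono) auto
    thus ?case using c(4)[OF x0, of l] by simp
  next
    case (Suc i)
    have "A ^\<^sub>m l *\<^sub>v fwd_state A B x0 y (Suc i) = A ^\<^sub>m Suc l *\<^sub>v fwd_state A B x0 y i + A ^\<^sub>m l *\<^sub>v (B *\<^sub>v y i)"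
      using Ac B dx by (simp only: pow_mv_Suc(1)[OF Ac dx] fwd_state.simps) (simp add: mv_add)
    hence "nrm (A ^\<^sub>m l *\<^sub>v fwd_state A B x0 y (Suc i))
       \<le> nrm (A ^\<^sub>m Suc l *\<^sub>v fwd_state A B x0 y i) + nrm (A ^\<^sub>m l *\<^sub>v (B *\<^sub>v y i))"
      using Ac by (simp only:) (rule nrm_add, simp)
    also have "\<dots> \<le> c * \<rho> ^ Suc l * S + c * \<rho> ^ l * (k * b)"
    proof (rule add_mono[OF Suc.IH])
      have "nrm (A ^\<^sub>m l *\<^sub>v (B *\<^sub>v y i)) \<le> c * \<rho> ^ l * nrm (B *\<^sub>v y i)" using c(4) B by simp
      also have "nrm (B *\<^sub>v y i) \<le> k * b"
        using k(2)[OF b(2), of i] mult_left_mono[OF b(1) k(1), of i] by linarith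
      finally show "nrm (A ^\<^sub>m l *\<^sub>v (B *\<^sub>v y i)) \<le> c * \<rho> ^ l * (k * b)"
        using c by (auto simp: mult_left_mono)
    qed
    also have "\<dots> = c * \<rho> ^ l * (\<rho> * S + k * b)" by (simp add: algebra_simps)
    also have "\<dots> \<le> c * \<rho> ^ l * S" using c S by (intro mult_left_mono) auto
    finally show ?case .
  qed
  from this[of 0] have "nrm (fwd_state A B x0 y i) \<le> c * S" for i
    using Ac dx by simp
  thus ?thesis by blast
qed

section \<open>Gramians and their Lyapunov equations\<close>

lemma ctrl_gram_mv:
  assumes A: "geo_stable n A" and B: "B \<in> carrier_mat n m" and x: "dim_vec x = n"
  defines "F \<equiv> \<lambda>\<nu>. A ^\<^sub>m \<nu> *\<^sub>v (B *\<^sub>v (mat_adjoint B *\<^sub>v (mat_adjoint A ^\<^sub>m \<nu> *\<^sub>v x)))"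
  shows "vsummable n F" "ctrl_gram A B *\<^sub>v x = vec_suminf n F"
proof -
  note Ac = geo_stable_carrier[OF A]
  note Aa = adjoint_carrier[OF Ac]
  from geo_stable_bound[OF A B] obtain K \<rho> where K: "0 \<le> K" "0 < \<rho>" "\<rho> < 1"
    "\<And>j u. dim_vec u = m \<Longrightarrow> nrm (A ^\<^sub>m j *\<^sub>v (B *\<^sub>v u)) \<le> K * \<rho> ^ j * nrm u" by blast
  from geo_stable_nrm[OF geo_stable_adjoint[OF A]] obtain c \<sigma> where c: "0 \<le> c" "0 < \<sigma>" "\<sigma> < 1"
    "\<And>j x. dim_vec x = n \<Longrightarrow> nrm (mat_adjoint A ^\<^sub>m j *\<^sub>v x) \<le> c * \<sigma> ^ j * nrm x" by blast
  from mat_bounded[of "mat_adjoint B"] obtain k where k: "0 \<le> k"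
    "\<And>x. dim_vec x = n \<Longrightarrow> nrm (mat_adjoint B *\<^sub>v x) \<le> k * nrm x"
    using B by auto
  have vs: "vsummable n (\<lambda>\<nu>. A ^\<^sub>m \<nu> *\<^sub>v (B *\<^sub>v (mat_adjoint B *\<^sub>v (mat_adjoint A ^\<^sub>m \<nu> *\<^sub>v u))))"
    if u: "dim_vec u = n" for u
  proof (rule vsummable_bound(1))
    fix \<nu>
    have "nrm (A ^\<^sub>m \<nu> *\<^sub>v (B *\<^sub>v (mat_adjoint B *\<^sub>v (mat_adjoint A ^\<^sub>m \<nu> *\<^sub>v u))))
        \<le> K * \<rho> ^ \<nu> * nrm (mat_adjoint B *\<^sub>v (mat_adjoint A ^\<^sub>m \<nu> *\<^sub>v u))"
      using K(4) B by simp
    also have "\<dots> \<le> K * \<rho> ^ \<nu> * (k * (c * nrm u))"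
    proof (intro mult_left_mono)
      have "nrm (mat_adjoint A ^\<^sub>m \<nu> *\<^sub>v u) \<le> c * \<sigma> ^ \<nu> * nrm u" by (rule c(4)[OF u])
      \<comment> \<open>One of the two geometric factors already yields convergence; the other is
        bounded by 1.\<close>
      also have "\<dots> \<le> c * 1 * nrm u" using c by (intro mult_right_mono mult_left_mono power_le_one) auto
      finally have "k * nrm (mat_adjoint A ^\<^sub>m \<nu> *\<^sub>v u) \<le> k * (c * nrm u)"
        using k by (intro mult_left_mono) auto
      thus "nrm (mat_adjoint B *\<^sub>v (mat_adjoint A ^\<^sub>m \<nu> *\<^sub>v u)) \<le> k * (c * nrm u)"
        using k(2)[of "mat_adjoint A ^\<^sub>m \<nu> *\<^sub>v u"] Aa Ac by simp
    qed (use K in auto)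
    finally show "nrm (A ^\<^sub>m \<nu> *\<^sub>v (B *\<^sub>v (mat_adjoint B *\<^sub>v (mat_adjoint A ^\<^sub>m \<nu> *\<^sub>v u))))
        \<le> K * (k * (c * nrm u)) * \<rho> ^ \<nu>" by (simp add: mult_ac)
    show "dim_vec (A ^\<^sub>m \<nu> *\<^sub>v (B *\<^sub>v (mat_adjoint B *\<^sub>v (mat_adjoint A ^\<^sub>m \<nu> *\<^sub>v u)))) = n"
      using Ac by simp
  next
    show "summable (\<lambda>\<nu>. K * (k * (c * nrm u)) * \<rho> ^ \<nu>)"
      using K by (intro summable_mult summable_geometric) auto
  qed
  show "vsummable n F" unfolding F_def by (rule vs[OF x])
  define H where "H \<nu> = A ^\<^sub>m \<nu> * B * mat_adjoint B * (mat_adjoint A) ^\<^sub>m \<nu>" for \<nu>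
  have H: "H \<nu> \<in> carrier_mat n n" for \<nu> using Ac B Aa by (auto simp: H_def)
  have Hv: "H \<nu> *\<^sub>v u = A ^\<^sub>m \<nu> *\<^sub>v (B *\<^sub>v (mat_adjoint B *\<^sub>v (mat_adjoint A ^\<^sub>m \<nu> *\<^sub>v u)))"
    if "dim_vec u = n" for u \<nu>
    using that Ac B Aa by (simp add: H_def mv_assoc)
  have Hs: "summable (\<lambda>\<nu>. H \<nu> $$ (a,b))" if "a < n" "b < n" for a b
  proof -
    have "(H \<nu> *\<^sub>v unit_vec n b) $ a = H \<nu> $$ (a,b)" for \<nu> using that H[of \<nu>] by simp
    moreover have "summable (\<lambda>\<nu>. (H \<nu> *\<^sub>v unit_vec n b) $ a)"
      using vs[of "unit_vec n b"] that by (simp add: Hv vsummable_def del: index_mult_mat_vec)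
    ultimately show ?thesis by simp
  qed
  show "ctrl_gram A B *\<^sub>v x = vec_suminf n F"
  proof (rule eq_vecI)
    fix a assume "a < dim_vec (vec_suminf n F)"
    hence a: "a < n" by simp
    have "(ctrl_gram A B *\<^sub>v x) $ a = (\<Sum>b<n. (\<Sum>\<nu>. H \<nu> $$ (a,b)) * x $ b)"
      using a x Ac by (simp add: ctrl_gram_def mat_suminf_def mv_index H_def del: index_mult_mat_vec)
    also have "\<dots> = (\<Sum>\<nu>. \<Sum>b<n. H \<nu> $$ (a,b) * x $ b)"
      by (rule sums_unique, intro sums_sum sums_mult2 summable_sums Hs) (use a in auto)
    also have "(\<lambda>\<nu>. \<Sum>b<n. H \<nu> $$ (a,b) * x $ b) = (\<lambda>\<nu>. F \<nu> $ a)"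
    proof
      fix \<nu>
      have "(\<Sum>b<n. H \<nu> $$ (a,b) * x $ b) = (H \<nu> *\<^sub>v x) $ a"
        using H[of \<nu>] a x by (simp add: mv_index del: index_mult_mat_vec)
      thus "(\<Sum>b<n. H \<nu> $$ (a,b) * x $ b) = F \<nu> $ a" unfolding Hv[OF x] F_def .
    qed
    finally show "(ctrl_gram A B *\<^sub>v x) $ a = vec_suminf n F $ a" using a by simp
  qed (use Ac in \<open>simp add: ctrl_gram_def mat_suminf_def\<close>)
qed

lemma ctrl_gram_carrier: "A \<in> carrier_mat n n \<Longrightarrow> ctrl_gram A B \<in> carrier_mat n n"
  by (simp add: ctrl_gram_def mat_suminf_def)

lemma ctrl_gram_lyapunov:
  assumes A: "geo_stable n A" and B: "B \<in> carrier_mat n m"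
  shows "ctrl_gram A B = B * mat_adjoint B + A * ctrl_gram A B * mat_adjoint A"
proof (rule mat_eqI_vec[of _ n n])
  note Ac = geo_stable_carrier[OF A]
  note Aa = adjoint_carrier[OF Ac]
  note P = ctrl_gram_carrier[OF Ac, of B]
  show "ctrl_gram A B \<in> carrier_mat n n" by (rule P)
  show "B * mat_adjoint B + A * ctrl_gram A B * mat_adjoint A \<in> carrier_mat n n" using Ac B P by auto
  fix x :: "complex vec" assume "x \<in> carrier_vec n"
  hence x: "dim_vec x = n" by simp
  have "ctrl_gram A B *\<^sub>v x = A ^\<^sub>m 0 *\<^sub>v (B *\<^sub>v (mat_adjoint B *\<^sub>v (mat_adjoint A ^\<^sub>m 0 *\<^sub>v x)))
     + vec_suminf n (\<lambda>\<nu>. A ^\<^sub>m Suc \<nu> *\<^sub>v (B *\<^sub>v (mat_adjoint B *\<^sub>v (mat_adjoint A ^\<^sub>m Suc \<nu> *\<^sub>v x))))"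
    unfolding ctrl_gram_mv(2)[OF A B x] by (rule vsummable_head[OF ctrl_gram_mv(1)[OF A B x]])
  also have "A ^\<^sub>m 0 *\<^sub>v (B *\<^sub>v (mat_adjoint B *\<^sub>v (mat_adjoint A ^\<^sub>m 0 *\<^sub>v x))) = B *\<^sub>v (mat_adjoint B *\<^sub>v x)"
    using Ac B x by simp
  also have "(\<lambda>\<nu>. A ^\<^sub>m Suc \<nu> *\<^sub>v (B *\<^sub>v (mat_adjoint B *\<^sub>v (mat_adjoint A ^\<^sub>m Suc \<nu> *\<^sub>v x))))
    = (\<lambda>\<nu>. A *\<^sub>v (A ^\<^sub>m \<nu> *\<^sub>v (B *\<^sub>v (mat_adjoint B *\<^sub>v (mat_adjoint A ^\<^sub>m \<nu> *\<^sub>v (mat_adjoint A *\<^sub>v x))))))"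
    using B by (simp only: pow_mv_Suc(2)[OF Ac] pow_mv_Suc(1)[OF Aa x] dim_mv carrier_matD[OF B])
  also have "vec_suminf n \<dots> = A *\<^sub>v (ctrl_gram A B *\<^sub>v (mat_adjoint A *\<^sub>v x))"
    using ctrl_gram_mv[OF A B, of "mat_adjoint A *\<^sub>v x"] vsummable_mv(2)[of n _ A n] Ac by simp
  finally show "ctrl_gram A B *\<^sub>v x = (B * mat_adjoint B + A * ctrl_gram A B * mat_adjoint A) *\<^sub>v x"
    using Ac B P x by (simp add: mvs)
qed

lemma ctrl_gram_form:
  assumes A: "geo_stable n A" and B: "B \<in> carrier_mat n m" and x: "dim_vec x = n"
  shows "(\<lambda>\<nu>. complex_of_real (vnorm2 (mat_adjoint B *\<^sub>v (mat_adjoint A ^\<^sub>m \<nu> *\<^sub>v x)))) sums inn (ctrl_gram A B *\<^sub>v x) x"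
proof -
  note Ac = geo_stable_carrier[OF A]
  have "inn (A ^\<^sub>m \<nu> *\<^sub>v (B *\<^sub>v (mat_adjoint B *\<^sub>v (mat_adjoint A ^\<^sub>m \<nu> *\<^sub>v x)))) x
     = of_real (vnorm2 (mat_adjoint B *\<^sub>v (mat_adjoint A ^\<^sub>m \<nu> *\<^sub>v x)))" for \<nu>
    using Ac B x adjoint_carrier[OF Ac] by (simp add: inn_mv adjoint_pow[OF Ac] inn_self)
  thus ?thesis using vsummable_inn[OF ctrl_gram_mv(1)[OF A B x] x] ctrl_gram_mv(2)[OF A B x] by simp
qed

lemma ctrl_gram_psd:
  assumes A: "geo_stable n A" and B: "B \<in> carrier_mat n m"
  shows "herm (ctrl_gram A B)" "dim_vec x = n \<Longrightarrow> 0 \<le> Re (inn (ctrl_gram A B *\<^sub>v x) x)"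
proof -
  have *: "Im (inn (ctrl_gram A B *\<^sub>v x) x) = 0 \<and> 0 \<le> Re (inn (ctrl_gram A B *\<^sub>v x) x)" if "dim_vec x = n" for x
  proof -
    note s = ctrl_gram_form[OF A B that]
    from sums_Im[OF s] have "Im (inn (ctrl_gram A B *\<^sub>v x) x) = 0" by (simp add: sums_iff)
    moreover from sums_Re[OF s] have "(\<lambda>\<nu>. vnorm2 (mat_adjoint B *\<^sub>v (mat_adjoint A ^\<^sub>m \<nu> *\<^sub>v x))) sums Re (inn (ctrl_gram A B *\<^sub>v x) x)"
      by simp
    hence "0 \<le> Re (inn (ctrl_gram A B *\<^sub>v x) x)" by (rule sums_le[OF _ sums_zero, rotated]) simp
    ultimately show ?thesis by simp
  qed
  show "herm (ctrl_gram A B)"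
    by (rule herm_iff_form_real[OF ctrl_gram_carrier[OF geo_stable_carrier[OF A]]]) (use * in auto)
  show "dim_vec x = n \<Longrightarrow> 0 \<le> Re (inn (ctrl_gram A B *\<^sub>v x) x)" using * by auto
qed

lemma obs_gram_eq: "A \<in> carrier_mat n n \<Longrightarrow> obs_gram C A = ctrl_gram (mat_adjoint A) (mat_adjoint C)"
  by (simp add: obs_gram_def ctrl_gram_def)

section \<open>Hermitian forms\<close>

definition append_col :: "complex mat \<Rightarrow> complex vec \<Rightarrow> complex mat" where
  "append_col W z = mat (dim_row W) (Suc (dim_col W)) (\<lambda>(i,j). if j < dim_col W then W $$ (i,j) else z $ i)"

lemma append_col_mv:
  assumes W: "W \<in> carrier_mat n k" and z: "dim_vec z = n" and a: "dim_vec a = Suc k"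
  shows "append_col W z *\<^sub>v a = W *\<^sub>v Matrix.vec k (\<lambda>i. a $ i) + a $ k \<cdot>\<^sub>v z"
  using assms
  by (intro eq_vecI) (auto simp: append_col_def mv_index mult.commute simp del: index_mult_mat_vec)

text \<open>Gram-Schmidt replaced by maximality. Among the families in \<open>U\<close> that are
  orthonormal for the semi-inner product of \<open>M\<close>, whose size is at most
  \<open>n\<close>, take a largest one; if the residue \<open>z\<close> had positive
  \<open>M\<close>-norm, it could be normalized and appended. Used for rank factorizations, for
  reachability, and for an orthonormal basis of the subspace of the factor.\<close>

lemma maximal_orthonormal:
  fixes M :: "complex mat"
  assumes M: "M \<in> carrier_mat n n" and h: "herm M"
    and pos: "\<And>x. x \<in> carrier_vec n \<Longrightarrow> 0 \<le> Re (inn (M *\<^sub>v x) x)"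
    and U0: "0\<^sub>v n \<in> U" and Uc: "U \<subseteq> carrier_vec n"
    and Ua: "\<And>x y. x \<in> U \<Longrightarrow> y \<in> U \<Longrightarrow> x + y \<in> U" and Us: "\<And>c x. x \<in> U \<Longrightarrow> c \<cdot>\<^sub>v x \<in> U"
  obtains k W where "k \<le> n" "W \<in> carrier_mat n k" "mat_adjoint W * M * W = 1\<^sub>m k"
    "\<And>a. a \<in> carrier_vec k \<Longrightarrow> W *\<^sub>v a \<in> U"
    "\<And>x z. x \<in> U \<Longrightarrow> z = x - W *\<^sub>v (mat_adjoint W *\<^sub>v (M *\<^sub>v x)) \<Longrightarrow> inn (M *\<^sub>v z) z = 0"
proof -
  define good where "good k W \<longleftrightarrow> W \<in> carrier_mat n k \<and> (\<forall>a\<in>carrier_vec k. W *\<^sub>v a \<in> U) \<and>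
     (\<forall>a\<in>carrier_vec k. inn (M *\<^sub>v (W *\<^sub>v a)) (W *\<^sub>v a) = inn a a)" for k W
  have one: "mat_adjoint W * M * W = 1\<^sub>m k" if "good k W" for k W
  proof (rule mat_eqI_form[of _ k])
    have W: "W \<in> carrier_mat n k" using that by (simp add: good_def)
    show "mat_adjoint W * M * W \<in> carrier_mat k k" using W M by auto
    fix v :: "complex vec" assume v: "v \<in> carrier_vec k"
    have "inn (mat_adjoint W * M * W *\<^sub>v v) v = inn (M *\<^sub>v (W *\<^sub>v v)) (W *\<^sub>v v)"
      using W M v by (simp add: mvs inn_mv')
    thus "inn (mat_adjoint W * M * W *\<^sub>v v) v = inn (1\<^sub>m k *\<^sub>v v) v"
      using that v by (simp add: good_def)
  qed auto
  have le: "k \<le> n" if "good k W" for k W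
  proof (rule left_inverse_dim_le[OF _ _ one[OF that]])
    have W: "W \<in> carrier_mat n k" using that by (simp add: good_def)
    thus "mat_adjoint W * M \<in> carrier_mat k n" "W \<in> carrier_mat n k" using M by auto
  qed
  have "good 0 (0\<^sub>m n 0)" unfolding good_def using U0 M by (auto simp: inn_sum)
  hence ex: "\<exists>W. good 0 W" by blast
  define K where "K = {k. \<exists>W. good k W}"
  have fin: "finite K" using le by (auto simp: K_def intro!: finite_subset[of _ "{..n}"])
  have ne: "K \<noteq> {}" using ex by (auto simp: K_def)
  define k where "k = Max K"
  from Max_in[OF fin ne] obtain W where gW: "good k W" by (auto simp: K_def k_def)
  hence W: "W \<in> carrier_mat n k" and WU: "\<And>a. a \<in> carrier_vec k \<Longrightarrow> W *\<^sub>v a \<in> U"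
    and Wi: "\<And>a. a \<in> carrier_vec k \<Longrightarrow> inn (M *\<^sub>v (W *\<^sub>v a)) (W *\<^sub>v a) = inn a a" by (auto simp: good_def)
  have zero: "inn (M *\<^sub>v z) z = 0"
    if x: "x \<in> U" and z: "z = x - W *\<^sub>v (mat_adjoint W *\<^sub>v (M *\<^sub>v x))" for x z
  proof (rule ccontr)
    assume nz: "inn (M *\<^sub>v z) z \<noteq> 0"
    have xc: "x \<in> carrier_vec n" using x Uc by auto
    have zc: "z \<in> carrier_vec n" unfolding z using xc W by (intro carrier_vecI) simp
    have zU: "z \<in> U"
    proof -
      have "z = x + (-1) \<cdot>\<^sub>v (W *\<^sub>v (mat_adjoint W *\<^sub>v (M *\<^sub>v x)))"
        unfolding z using xc W by (intro eq_vecI) auto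
      also have "\<dots> \<in> U" using W M xc by (intro Ua x Us WU) (auto intro!: carrier_vecI)
      finally show ?thesis .
    qed
    note d = carrier_matD[OF W] carrier_matD[OF M] carrier_vecD[OF xc] carrier_vecD[OF zc]
    have "mat_adjoint W *\<^sub>v (M *\<^sub>v z) = mat_adjoint W *\<^sub>v (M *\<^sub>v x)
       - (mat_adjoint W * M * W) *\<^sub>v (mat_adjoint W *\<^sub>v (M *\<^sub>v x))"
      unfolding z by (simp add: mvs d)
    hence orth: "mat_adjoint W *\<^sub>v (M *\<^sub>v z) = 0\<^sub>v k"
      unfolding one[OF gW] by (simp add: d minus_cancel_vec[OF carrier_vecI[of _ k]])
    define t where "t = Re (inn (M *\<^sub>v z) z)"
    have tz: "inn (M *\<^sub>v z) z = of_real t" unfolding t_def by (rule herm_form_real[OF h M zc])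
    have t: "0 < t" using pos[OF zc] nz tz unfolding t_def by (metis less_eq_real_def of_real_0)
    define \<epsilon> where "\<epsilon> = 1 / sqrt t"
    have \<epsilon>: "\<epsilon> * \<epsilon> * t = 1" using t by (simp add: \<epsilon>_def)
    define w where "w = complex_of_real \<epsilon> \<cdot>\<^sub>v z"
    have wd: "dim_vec w = n" by (simp add: w_def d)
    have wU: "w \<in> U" unfolding w_def by (rule Us[OF zU])
    have ww: "inn (M *\<^sub>v w) w = 1"
    proof -
      have "inn (M *\<^sub>v w) w = complex_of_real \<epsilon> * (complex_of_real \<epsilon> * inn (M *\<^sub>v z) z)"
        by (simp add: w_def mvs inns d)
      also have "\<dots> = of_real (\<epsilon> * \<epsilon> * t)" unfolding tz by (simp only: of_real_mult mult.assoc)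
      also have "\<epsilon> * \<epsilon> * t = 1" by (rule \<epsilon>)
      finally show ?thesis by simp
    qed
    have orthw: "mat_adjoint W *\<^sub>v (M *\<^sub>v w) = 0\<^sub>v k"
      using orth by (simp add: w_def mvs d)
    have "good (Suc k) (append_col W w)" unfolding good_def
    proof (intro conjI ballI)
      show "append_col W w \<in> carrier_mat n (Suc k)" using W by (auto simp: append_col_def)
      fix a :: "complex vec" assume a: "a \<in> carrier_vec (Suc k)"
      define b where "b = Matrix.vec k (\<lambda>i. a $ i)"
      have b: "b \<in> carrier_vec k" "dim_vec b = k" by (auto simp: b_def)
      have e: "append_col W w *\<^sub>v a = W *\<^sub>v b + a $ k \<cdot>\<^sub>v w"
        unfolding b_def by (rule append_col_mv[OF W wd]) (use a in simp)
      show "append_col W w *\<^sub>v a \<in> U" unfolding e by (intro Ua WU b Us wU)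
      have c1: "inn (M *\<^sub>v w) (W *\<^sub>v b) = 0" using orthw by (simp add: inn_mv' d wd b)
      have c2: "inn (M *\<^sub>v (W *\<^sub>v b)) w = 0"
        using herm_swap[OF h M, of "W *\<^sub>v b" w] c1 by (simp add: d wd)
      have "inn (M *\<^sub>v (append_col W w *\<^sub>v a)) (append_col W w *\<^sub>v a)
         = inn b b + a $ k * cnj (a $ k)"
        unfolding e by (simp add: mvs inns d wd b c1 c2 ww Wi mult.commute)
      also have "\<dots> = inn a a" using a by (simp add: inn_sum b_def)
      finally show "inn (M *\<^sub>v (append_col W w *\<^sub>v a)) (append_col W w *\<^sub>v a) = inn a a" .
    qed
    hence "Suc k \<in> K" by (auto simp: K_def)
    hence "Suc k \<le> k" unfolding k_def by (rule Max_ge[OF fin])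
    thus False by simp
  qed
  show thesis by (rule that[OF le[OF gW] W one[OF gW] WU zero])
qed

text \<open>Take \<open>L = W^* M\<close> and \<open>L' = W\<close> for a maximal
  \<open>M\<close>-orthonormal \<open>W\<close>. The residue has \<open>M\<close>-norm zero, so the
  form is carried entirely by the coefficients \<open>W^* M x\<close>. The right inverse
  \<open>L'\<close> records that \<open>L\<close> has full row rank.\<close>

lemma psd_rank_factorization:
  fixes M :: "complex mat"
  assumes M: "M \<in> carrier_mat n n" and h: "herm M"
    and pos: "\<And>x. x \<in> carrier_vec n \<Longrightarrow> 0 \<le> Re (inn (M *\<^sub>v x) x)"
  obtains k L L' where "k \<le> n" "L \<in> carrier_mat k n" "L' \<in> carrier_mat n k" "L * L' = 1\<^sub>m k"
    "\<And>x. x \<in> carrier_vec n \<Longrightarrow> inn (M *\<^sub>v x) x = inn (L *\<^sub>v x) (L *\<^sub>v x)"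
proof -
  obtain k W where k: "k \<le> n" and W: "W \<in> carrier_mat n k" and one: "mat_adjoint W * M * W = 1\<^sub>m k"
    and z: "\<And>x z. x \<in> carrier_vec n \<Longrightarrow> z = x - W *\<^sub>v (mat_adjoint W *\<^sub>v (M *\<^sub>v x)) \<Longrightarrow> inn (M *\<^sub>v z) z = 0"
    by (rule maximal_orthonormal[OF M h pos, of "carrier_vec n"]) auto
  show thesis
  proof (rule that[OF k _ W one])
    show "mat_adjoint W * M \<in> carrier_mat k n" using W M by auto
    fix x :: "complex vec" assume x: "x \<in> carrier_vec n"
    note d = carrier_matD[OF W] carrier_matD[OF M] carrier_vecD[OF x]
    define a where "a = mat_adjoint W *\<^sub>v (M *\<^sub>v x)"
    have da: "dim_vec a = k" by (simp add: a_def d)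
    have "mat_adjoint W *\<^sub>v (M *\<^sub>v (W *\<^sub>v a)) = (mat_adjoint W * M * W) *\<^sub>v a"
      by (simp add: mvs d da)
    hence wa: "mat_adjoint W *\<^sub>v (M *\<^sub>v (W *\<^sub>v a)) = a" using da by (simp add: one)
    have 1: "inn (M *\<^sub>v x) (W *\<^sub>v a) = inn a a" by (simp add: inn_mv' d da a_def)
    have 2: "inn (M *\<^sub>v (W *\<^sub>v a)) x = inn a a"
      using herm_swap[OF h M, of "W *\<^sub>v a" x] 1 by (simp add: d cnj_inn)
    have 3: "inn (M *\<^sub>v (W *\<^sub>v a)) (W *\<^sub>v a) = inn a a" using wa by (simp add: inn_mv' d da)
    have "0 = inn (M *\<^sub>v (x - W *\<^sub>v a)) (x - W *\<^sub>v a)" using z[OF x] by (simp add: a_def)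
    also have "\<dots> = inn (M *\<^sub>v x) x - inn a a"
      by (simp add: mvs inns d da 1 2 3)
    finally show "inn (M *\<^sub>v x) x = inn (mat_adjoint W * M *\<^sub>v x) (mat_adjoint W * M *\<^sub>v x)"
      by (simp add: mvs d a_def)
  qed
qed

lemma linear_functional_expansion:
  fixes \<phi> :: "complex vec \<Rightarrow> complex"
  assumes add: "\<And>x y. x \<in> carrier_vec n \<Longrightarrow> y \<in> carrier_vec n \<Longrightarrow> \<phi> (x + y) = \<phi> x + \<phi> y"
    and sm: "\<And>c x. x \<in> carrier_vec n \<Longrightarrow> \<phi> (c \<cdot>\<^sub>v x) = c * \<phi> x" and x: "x \<in> carrier_vec n"
  shows "\<phi> x = (\<Sum>j<n. x $ j * \<phi> (unit_vec n j))"
proof -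
  have "\<phi> (Matrix.vec n (\<lambda>i. if i < m then x $ i else 0)) = (\<Sum>j<m. x $ j * \<phi> (unit_vec n j))" if "m \<le> n" for m
    using that
  proof (induction m)
    case 0
    have "Matrix.vec n (\<lambda>i. if i < 0 then x $ i else 0) = 0 \<cdot>\<^sub>v 0\<^sub>v n" by (intro eq_vecI) auto
    thus ?case using sm[of "0\<^sub>v n" 0] by simp
  next
    case (Suc m)
    have "Matrix.vec n (\<lambda>i. if i < Suc m then x $ i else 0)
       = Matrix.vec n (\<lambda>i. if i < m then x $ i else 0) + x $ m \<cdot>\<^sub>v unit_vec n m"
      using Suc.prems by (intro eq_vecI) (auto simp: unit_vec_def less_Suc_eq)
    thus ?case using Suc by (simp add: add sm)
  qed
  from this[of n] have "\<phi> (Matrix.vec n (\<lambda>i. if i < n then x $ i else 0)) = (\<Sum>j<n. x $ j * \<phi> (unit_vec n j))" by simp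
  moreover have "Matrix.vec n (\<lambda>i. if i < n then x $ i else 0) = x" using x by (intro eq_vecI) auto
  ultimately show ?thesis by simp
qed

text \<open>The deviation \<open>d\<close> from linearity is additive and vanishes at the integers,
  so it has period 1 and is bounded everywhere; an additive function that is bounded everywhere is
  zero.\<close>

lemma additive_bounded_imp_linear:
  fixes f :: "real \<Rightarrow> real"
  assumes add: "\<And>s t. f (s + t) = f s + f t" and b: "\<And>t. 0 \<le> t \<Longrightarrow> t \<le> 1 \<Longrightarrow> \<bar>f t\<bar> \<le> K"
  shows "f t = t * f 1"
proof -
  define d where "d s = f s - s * f 1" for s
  have dadd: "d (s + t) = d s + d t" for s t by (simp add: d_def add algebra_simps)
  have d0: "d 0 = 0" using dadd[of 0 0] by simp
  have dm: "d (- s) = - d s" for s using dadd[of s "- s"] d0 by simp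
  have dn: "d (real N * s) = real N * d s" for N s
    by (induction N) (simp_all add: d0 dadd algebra_simps)
  have d1: "d 1 = 0" by (simp add: d_def)
  have dN: "d (real N) = 0" for N using dn[of N 1] d1 by simp
  have di: "d (of_int z) = 0" for z :: int
    by (cases z rule: int_cases2) (simp_all add: dN dm)
  have bd: "\<bar>d s\<bar> \<le> K + \<bar>f 1\<bar>" for s
  proof -
    have "s = frac s + of_int \<lfloor>s\<rfloor>" unfolding frac_def by (rule diff_add_cancel[symmetric])
    hence "d s = d (frac s + of_int \<lfloor>s\<rfloor>)" by (rule arg_cong)
    also have "\<dots> = d (frac s) + d (of_int \<lfloor>s\<rfloor>)" by (rule dadd)
    finally have "d s = d (frac s) + d (of_int \<lfloor>s\<rfloor>)" .
    hence "d s = d (frac s)" by (simp add: di)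
    moreover have "\<bar>d (frac s)\<bar> \<le> K + \<bar>f 1\<bar>"
    proof -
      have "\<bar>f (frac s)\<bar> \<le> K" using frac_ge_0[of s] frac_lt_1[of s] by (intro b) auto
      moreover have "\<bar>frac s * f 1\<bar> \<le> 1 * \<bar>f 1\<bar>"
        unfolding abs_mult using frac_ge_0[of s] frac_lt_1[of s] by (intro mult_right_mono) auto
      ultimately show ?thesis unfolding d_def by linarith
    qed
    ultimately show ?thesis by simp
  qed
  have "d t = 0"
  proof (rule ccontr)
    assume "d t \<noteq> 0"
    then obtain N where N: "real N * \<bar>d t\<bar> > K + \<bar>f 1\<bar>"
      using reals_Archimedean3[of "\<bar>d t\<bar>"] by auto
    have "\<bar>d (real N * t)\<bar> = real N * \<bar>d t\<bar>" by (simp add: dn abs_mult)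
    thus False using N bd[of "real N * t"] by simp
  qed
  thus ?thesis by (simp add: d_def)
qed

lemma parallelogram_imp_form:
  fixes \<theta> :: "complex vec \<Rightarrow> real"
  assumes par: "\<And>x y. x \<in> carrier_vec n \<Longrightarrow> y \<in> carrier_vec n \<Longrightarrow> \<theta> (x + y) + \<theta> (x - y) = 2 * \<theta> x + 2 * \<theta> y"
    and hom: "\<And>c x. x \<in> carrier_vec n \<Longrightarrow> \<theta> (c \<cdot>\<^sub>v x) = (cmod c)\<^sup>2 * \<theta> x"
    and nn: "\<And>x. x \<in> carrier_vec n \<Longrightarrow> 0 \<le> \<theta> x"
  obtains M where "M \<in> carrier_mat n n" "herm M"
    "\<And>x. x \<in> carrier_vec n \<Longrightarrow> inn (M *\<^sub>v x) x = of_real (\<theta> x)"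
proof -
  define V where "V = (carrier_vec n :: complex vec set)"
  have Vs[simp]: "x + y \<in> V" "x - y \<in> V" "c \<cdot>\<^sub>v x \<in> V" if "x \<in> V" "y \<in> V" for x y c
    using that by (auto simp: V_def)
  have Vs2[simp]: "c \<cdot>\<^sub>v x \<in> V" if "x \<in> V" for x c using that by (auto simp: V_def)
  note par' = par[folded V_def] and hom' = hom[folded V_def]
  define B where "B x y = \<theta> (x + y) - \<theta> (x - y)" for x y
  have Bsym: "B x y = B y x" if "x \<in> V" "y \<in> V" for x y
  proof -
    have "x + y = y + x" "x - y = (-1) \<cdot>\<^sub>v (y - x)" using that by (auto simp: V_def)
    moreover have "\<theta> ((-1) \<cdot>\<^sub>v (y - x)) = \<theta> (y - x)" using hom'[of "y - x" "-1"] that by simp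
    ultimately show ?thesis by (simp add: B_def)
  qed
  have Bhom: "B (c \<cdot>\<^sub>v x) (c \<cdot>\<^sub>v y) = (cmod c)\<^sup>2 * B x y" if "x \<in> V" "y \<in> V" for c x y
  proof -
    have "c \<cdot>\<^sub>v x + c \<cdot>\<^sub>v y = c \<cdot>\<^sub>v (x + y)" "c \<cdot>\<^sub>v x - c \<cdot>\<^sub>v y = c \<cdot>\<^sub>v (x - y)"
      using that by (auto simp: V_def algebra_simps)
    thus ?thesis using that by (simp add: B_def hom' algebra_simps)
  qed
  have Bneg: "B ((-1) \<cdot>\<^sub>v x) z = - B x z" if "x \<in> V" "z \<in> V" for x z
  proof -
    have "(-1) \<cdot>\<^sub>v x + z = (-1) \<cdot>\<^sub>v (x - z)" "(-1) \<cdot>\<^sub>v x - z = (-1) \<cdot>\<^sub>v (x + z)"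
      using that by (auto simp: V_def)
    thus ?thesis using that by (simp add: B_def hom')
  qed
  have Badd: "B (x + y) z = B x z + B y z" if x: "x \<in> V" and y: "y \<in> V" and z: "z \<in> V" for x y z
  proof -
    \<comment> \<open>The parallelogram laws for the pairs \<open>x + z\<close>, \<open>y\<close>
      and \<open>x - z\<close>, \<open>y\<close>, subtracted from each other.\<close>
    have *: "B (x + y) z + B (x - y) z = 2 * B x z" if x: "x \<in> V" and y: "y \<in> V" for x y
    proof -
      have "x + z + y = x + y + z" "x + z - y = x - y + z" "x - z + y = x + y - z" "x - z - y = x - y - z"
        using x y z by (auto simp: V_def)
      thus ?thesis using par'[of "x + z" y] par'[of "x - z" y] x y z by (simp add: B_def)
    qed
    have "y + x = x + y" "y - x = (-1) \<cdot>\<^sub>v (x - y)" using x y by (auto simp: V_def)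
    hence "B (x + y) z - B (x - y) z = 2 * B y z"
      using *[OF y x] Bneg[of "x - y" z] x y z by simp
    thus ?thesis using *[OF x y] by simp
  qed
  have Breal: "B (complex_of_real t \<cdot>\<^sub>v x) z = t * B x z" if x: "x \<in> V" and z: "z \<in> V" for t x z
  proof -
    define f where "f t = B (complex_of_real t \<cdot>\<^sub>v x) z" for t
    have "f t = t * f 1"
    proof (rule additive_bounded_imp_linear)
      show "f (s + t) = f s + f t" for s t
      proof -
        have "complex_of_real (s + t) \<cdot>\<^sub>v x = complex_of_real s \<cdot>\<^sub>v x + complex_of_real t \<cdot>\<^sub>v x"
          using x by (auto simp: V_def algebra_simps)
        thus ?thesis using x z by (simp add: f_def Badd)
      qed
      fix t :: real assume t: "0 \<le> t" "t \<le> 1"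
      \<comment> \<open>\<open>f t\<close> is a difference of two nonnegative values, hence bounded
        by their sum, which the parallelogram law evaluates.\<close>
      have "\<bar>f t\<bar> \<le> \<theta> (complex_of_real t \<cdot>\<^sub>v x + z) + \<theta> (complex_of_real t \<cdot>\<^sub>v x - z)"
        using nn[folded V_def, of "complex_of_real t \<cdot>\<^sub>v x + z"] nn[folded V_def, of "complex_of_real t \<cdot>\<^sub>v x - z"] x z
        by (simp add: f_def B_def)
      also have "\<dots> = 2 * (t\<^sup>2 * \<theta> x) + 2 * \<theta> z" using x z by (simp add: par' hom')
      also have "t\<^sup>2 * \<theta> x \<le> 1 * \<theta> x"
        using t nn[folded V_def, OF x] by (intro mult_right_mono) (auto simp: power_le_one)
      finally show "\<bar>f t\<bar> \<le> 2 * \<theta> x + 2 * \<theta> z" by simp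
    qed
    thus ?thesis using x by (simp add: f_def V_def)
  qed
  \<comment> \<open>\<open>B x y\<close> is four times the real part of the sesquilinear form
    sought, and \<open>B x (\<i> y)\<close> four times its imaginary part, because the second
    argument is conjugate linear.\<close>
  define H where "H x y = (complex_of_real (B x y) + \<i> * complex_of_real (B x (\<i> \<cdot>\<^sub>v y))) / 4" for x y
  have B_i: "B (\<i> \<cdot>\<^sub>v x) z = - B x (\<i> \<cdot>\<^sub>v z)" if x: "x \<in> V" and z: "z \<in> V" for x z
  proof -
    have "B (\<i> \<cdot>\<^sub>v x) z = B (\<i> \<cdot>\<^sub>v (\<i> \<cdot>\<^sub>v x)) (\<i> \<cdot>\<^sub>v z)" using Bhom[of "\<i> \<cdot>\<^sub>v x" z \<i>] x z by simp
    also have "\<i> \<cdot>\<^sub>v (\<i> \<cdot>\<^sub>v x) = (-1) \<cdot>\<^sub>v x" by (simp add: smult_smult_assoc)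
    finally show ?thesis using Bneg[of x "\<i> \<cdot>\<^sub>v z"] x z by simp
  qed
  have Hadd: "H (x + y) z = H x z + H y z" if "x \<in> V" "y \<in> V" "z \<in> V" for x y z
    using that by (simp add: H_def Badd algebra_simps add_divide_distrib)
  have Hreal: "H (complex_of_real t \<cdot>\<^sub>v x) z = t * H x z" if "x \<in> V" "z \<in> V" for t x z
    using that by (simp add: H_def Breal algebra_simps)
  have Hi: "H (\<i> \<cdot>\<^sub>v x) z = \<i> * H x z" if x: "x \<in> V" and z: "z \<in> V" for x z
  proof -
    have "B (\<i> \<cdot>\<^sub>v x) (\<i> \<cdot>\<^sub>v z) = B x z" using Bhom[OF x z, of \<i>] by simp
    thus ?thesis using B_i[OF x z] by (simp add: H_def algebra_simps)
  qed
  have Hsm: "H (c \<cdot>\<^sub>v x) z = c * H x z" if x: "x \<in> V" and z: "z \<in> V" for c x z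
  proof -
    have "c \<cdot>\<^sub>v x = complex_of_real (Re c) \<cdot>\<^sub>v x + complex_of_real (Im c) \<cdot>\<^sub>v (\<i> \<cdot>\<^sub>v x)"
      using x by (intro eq_vecI) (auto simp: V_def complex_eq_iff)
    hence "H (c \<cdot>\<^sub>v x) z = Re c * H x z + Im c * (\<i> * H x z)"
      using x z by (simp add: Hadd Hreal Hi)
    also have "\<dots> = c * H x z" by (subst (3) complex_eq[of c]) (simp add: algebra_simps)
    finally show ?thesis .
  qed
  have Hcnj: "H y x = cnj (H x y)" if x: "x \<in> V" and y: "y \<in> V" for x y
    using Bsym[OF x y] B_i[OF x y] Bsym[of "\<i> \<cdot>\<^sub>v x" y] x y by (simp add: H_def)
  have Hself: "H x x = of_real (\<theta> x)" if x: "x \<in> V" for x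
  proof -
    have e: "x + x = 2 \<cdot>\<^sub>v x" "x - x = 0 \<cdot>\<^sub>v x" using x by (auto simp: V_def)
    have "B x x = 4 * \<theta> x" using x by (simp only: B_def e hom') simp
    moreover have "B x (\<i> \<cdot>\<^sub>v x) = 0"
      using B_i[OF x x] Bsym[of "\<i> \<cdot>\<^sub>v x" x] x by simp
    ultimately show ?thesis by (simp add: H_def)
  qed
  define M where "M = mat n n (\<lambda>(i,j). H (unit_vec n j) (unit_vec n i))"
  have M: "M \<in> carrier_mat n n" by (simp add: M_def)
  have eV: "unit_vec n j \<in> V" for j by (simp add: V_def)
  have HM: "inn (M *\<^sub>v x) x = of_real (\<theta> x)" if x: "x \<in> V" for x
  proof -
    have xc: "x \<in> carrier_vec n" using x by (simp add: V_def)
    have exp: "H u z = (\<Sum>j<n. u $ j * H (unit_vec n j) z)" if "u \<in> V" "z \<in> V" for u z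
      using that by (intro linear_functional_expansion) (auto simp: V_def[symmetric] Hadd Hsm)
    have "H x x = (\<Sum>j<n. x $ j * cnj (H x (unit_vec n j)))"
      using exp[OF x x] by (simp add: Hcnj[OF x eV])
    also have "\<dots> = (\<Sum>j<n. \<Sum>i<n. x $ j * cnj (x $ i) * H (unit_vec n j) (unit_vec n i))"
      by (simp add: exp[OF x eV] sum_distrib_left mult.assoc Hcnj[OF eV eV, symmetric])
    also have "\<dots> = (\<Sum>i<n. \<Sum>j<n. x $ j * cnj (x $ i) * H (unit_vec n j) (unit_vec n i))"
      by (rule sum.swap)
    also have "\<dots> = inn (M *\<^sub>v x) x"
      using xc by (simp add: inn_sum M_def mv_index sum_distrib_left sum_distrib_right mult_ac del: index_mult_mat_vec)
    finally show ?thesis by (simp add: Hself[OF x])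
  qed
  show thesis
  proof (rule that[OF M])
    show "herm M" by (rule herm_iff_form_real[OF M]) (use HM in \<open>auto simp: V_def\<close>)
  qed (use HM in \<open>auto simp: V_def\<close>)
qed

section \<open>Fourier coefficients and Toeplitz operators of realizations\<close>

lemma has_integral_cis_int:
  fixes k :: int
  shows "((\<lambda>t. cis (of_int k * t)) has_integral (if k = 0 then 2 * pi else 0)) {0..2*pi}"
proof (cases "k = 0")
  case True
  thus ?thesis using has_integral_const_real[of "1::complex" 0 "2*pi"] by (simp add: scaleR_conv_of_real)
next
  case False
  define F where "F t = cis (of_int k * t) / (\<i> * of_int k)" for t :: real
  have "((\<lambda>t. cis (of_int k * t)) has_integral (F (2*pi) - F 0)) {0..2*pi}"
  proof (rule fundamental_theorem_of_calculus)
    fix t :: real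
    have "((\<lambda>z. exp (\<i> * of_int k * z) / (\<i> * of_int k)) has_field_derivative
        exp (\<i> * of_int k * of_real t) * (\<i> * of_int k) / (\<i> * of_int k)) (at (of_real t))"
      by (auto intro!: derivative_eq_intros)
    from has_vector_derivative_real_field[OF this, of "{0..2*pi}"]
    have "(F has_vector_derivative cis (of_int k * t) * (\<i> * of_int k) / (\<i> * of_int k)) (at t within {0..2*pi})"
      unfolding F_def cis_conv_exp by (simp add: mult.assoc)
    thus "(F has_vector_derivative cis (of_int k * t)) (at t within {0..2*pi})" using False by simp
  qed simp
  moreover have "F (2*pi) - F 0 = 0"
  proof -
    have "cis (of_int k * (2*pi)) = 1" using cis_multiple_2pi[of "of_int k"] by (simp add: mult_ac)
    thus ?thesis by (simp add: F_def)
  qed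
  ultimately show ?thesis using False by simp
qed

text \<open>Absolute summability gives uniform convergence on the circle, so the series may be
  integrated term by term; only the term with exponent \<open>k\<close> survives, and none does for
  negative \<open>k\<close>.\<close>

lemma fourier_power_series:
  fixes g :: "nat \<Rightarrow> complex" and k :: int
  assumes g: "summable (\<lambda>j. cmod (g j))"
  shows "((\<lambda>t. (\<Sum>j. g j * cis t ^ j) * cis (- (of_int k * t))) has_integral
     (2 * pi * (if 0 \<le> k then g (nat k) else 0))) {0..2*pi}"
proof -
  define f where "f N t = (\<Sum>j<N. g j * cis t ^ j * cis (- (of_int k * t)))" for N t
  have sm: "summable (\<lambda>j. g j * cis t ^ j)" for t
    by (rule summable_norm_cancel) (use g in \<open>simp add: norm_mult norm_power\<close>)
  have u: "uniform_limit {0..2*pi} f (\<lambda>t. \<Sum>j. g j * cis t ^ j * cis (- (of_int k * t))) sequentially"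
    unfolding f_def by (rule Weierstrass_m_test[OF _ g]) (simp add: norm_mult norm_power)
  have s: "(\<Sum>j. g j * cis t ^ j * cis (- (of_int k * t))) = (\<Sum>j. g j * cis t ^ j) * cis (- (of_int k * t))" for t
    by (rule suminf_mult2[OF sm, symmetric])
  have trm: "((\<lambda>t. g j * cis t ^ j * cis (- (of_int k * t))) has_integral (if int j = k then 2 * pi * g j else 0)) {0..2*pi}" for j
  proof -
    have "((\<lambda>t. g j * cis (of_int (int j - k) * t)) has_integral g j * (if int j - k = 0 then 2 * pi else 0)) {0..2*pi}"
      by (intro has_integral_mult_right has_integral_cis_int)
    moreover have "g j * cis (of_int (int j - k) * t) = g j * cis t ^ j * cis (- (of_int k * t))" for t
      by (simp add: Complex.DeMoivre cis_mult mult.assoc algebra_simps)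
    ultimately have "((\<lambda>t. g j * cis t ^ j * cis (- (of_int k * t))) has_integral
        g j * (if int j - k = 0 then 2 * pi else 0)) {0..2*pi}" by (simp only:)
    moreover have "g j * (if int j - k = 0 then 2 * pi else 0) = (if int j = k then 2 * pi * g j else 0)" by simp
    ultimately show ?thesis by (simp only:)
  qed
  have fN: "(f N has_integral (\<Sum>j<N. if int j = k then 2 * pi * g j else 0)) {0..2*pi}" for N
    unfolding f_def by (intro has_integral_sum trm) auto
  have cont: "continuous_on {0..2*pi} (f N)" for N
    unfolding f_def by (intro continuous_intros continuous_on_cis)
  obtain I J where I: "\<And>N. (f N has_integral I N) {0..2*pi}"
    and J: "((\<lambda>t. \<Sum>j. g j * cis t ^ j * cis (- (of_int k * t))) has_integral J) {0..2*pi}"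
    and lim: "(I \<longlongrightarrow> J) sequentially"
    by (rule uniform_limit_integral[OF u cont]) auto
  have IN: "I N = (\<Sum>j<N. if int j = k then 2 * pi * g j else 0)" for N
    by (rule has_integral_unique[OF I fN])
  have "J = 2 * pi * (if 0 \<le> k then g (nat k) else 0)"
  proof (rule LIMSEQ_unique[OF lim])
    have "(\<Sum>j<N. if int j = k then 2 * pi * g j else 0) = 2 * pi * (if 0 \<le> k then g (nat k) else 0)"
      if "N \<ge> Suc (nat k)" for N
    proof (cases "0 \<le> k")
      case True
      have "(\<Sum>j<N. if int j = k then 2 * pi * g j else 0) = (\<Sum>j<N. if j = nat k then 2 * pi * g j else 0)"
        using True by (intro sum.cong) auto
      also have "\<dots> = 2 * pi * g (nat k)" using that by (subst sum.delta) auto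
      finally show ?thesis using True by simp
    next
      case False
      thus ?thesis by (auto intro!: sum.neutral)
    qed
    hence "eventually (\<lambda>N. I N = 2 * pi * (if 0 \<le> k then g (nat k) else 0)) sequentially"
      unfolding IN eventually_sequentially by blast
    thus "I \<longlonglongrightarrow> 2 * pi * (if 0 \<le> k then g (nat k) else 0)" by (rule tendsto_eventually)
  qed
  thus ?thesis using J unfolding s by simp
qed

text \<open>The sum of the series and its conjugate cancel on the circle. The conjugate has no
  Fourier coefficients of positive index, so the coefficients with \<open>j > 0\<close> must vanish
  by themselves, and at index 0 only the real part is determined. This is the uniqueness statement
  behind comparing coefficients of spectral factorizations.\<close>

lemma power_series_Re_zero_on_circle:
  fixes g :: "nat \<Rightarrow> complex"
  assumes g: "summable (\<lambda>j. cmod (g j))" and z: "\<And>t. Re (\<Sum>j. g j * cis t ^ j) = 0"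
  shows "Re (g 0) = 0" "0 < j \<Longrightarrow> g j = 0"
proof -
  define S where "S t = (\<Sum>j. g j * cis t ^ j)" for t
  have sc: "S t + cnj (S t) = 0" for t using z[of t] by (simp add: S_def complex_eq_iff)
  have key: "g j + cnj (if j = 0 then g 0 else 0) = 0" for j
  proof -
    have 1: "((\<lambda>t. S t * cis (- (of_int (int j) * t))) has_integral (2 * pi * g j)) {0..2*pi}"
      unfolding S_def using fourier_power_series[OF g, of "int j"] by simp
    have "((\<lambda>t. S t * cis (- (of_int (- int j) * t))) has_integral (2 * pi * (if j = 0 then g 0 else 0))) {0..2*pi}"
      unfolding S_def using fourier_power_series[OF g, of "- int j"] by (simp split: if_splits)
    hence "(cnj \<circ> (\<lambda>t. S t * cis (- (of_int (- int j) * t))) has_integral cnj (2 * pi * (if j = 0 then g 0 else 0))) {0..2*pi}"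
      by (simp only: has_integral_cnj)
    moreover have "(cnj \<circ> (\<lambda>t. S t * cis (- (of_int (- int j) * t)))) = (\<lambda>t. cnj (S t) * cis (- (of_int (int j) * t)))"
      by (rule ext) (simp add: cis_cnj)
    ultimately have 2: "((\<lambda>t. cnj (S t) * cis (- (of_int (int j) * t))) has_integral cnj (2 * pi * (if j = 0 then g 0 else 0))) {0..2*pi}"
      by simp
    from has_integral_add[OF 1 2]
    have "((\<lambda>t. 0) has_integral 2 * pi * g j + cnj (2 * pi * (if j = 0 then g 0 else 0))) {0..2*pi}"
      by (simp add: distrib_right[symmetric] sc del: of_int_of_nat_eq)
    hence "2 * pi * g j + cnj (2 * pi * (if j = 0 then g 0 else 0)) = 0"
      by (metis has_integral_unique has_integral_0)
    hence "2 * pi * (g j + cnj (if j = 0 then g 0 else 0)) = 0" by (simp add: algebra_simps)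
    thus ?thesis by simp
  qed
  show "Re (g 0) = 0" using arg_cong[OF key[of 0], of Re] by simp
  show "0 < j \<Longrightarrow> g j = 0" using key[of j] by simp
qed

section \<open>Neumann series and the resolvent on the closed disc\<close>

definition mat_neumann :: "nat \<Rightarrow> complex mat \<Rightarrow> complex mat" where
  "mat_neumann n M = mat n n (\<lambda>(i,l). \<Sum>j. (M ^\<^sub>m j) $$ (i,l))"

lemma vbounded_const: "u \<in> carrier_vec m \<Longrightarrow> vbounded m (\<lambda>_. u)"
  by (auto simp: vbounded_def)

lemma mat_neumann_mv:
  assumes M: "geo_stable n M" and u: "dim_vec u = n"
  shows "mat_neumann n M *\<^sub>v u = vec_suminf n (\<lambda>j. M ^\<^sub>m j *\<^sub>v u)" "vsummable n (\<lambda>j. M ^\<^sub>m j *\<^sub>v u)"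
proof -
  note Mc = geo_stable_carrier[OF M]
  have vs: "vsummable n (\<lambda>j. M ^\<^sub>m j *\<^sub>v u)" if "dim_vec u = n" for u
    using bwd_state_summable[OF M one_carrier_mat vbounded_const[OF carrier_vecI[OF that]]] that by simp
  show "vsummable n (\<lambda>j. M ^\<^sub>m j *\<^sub>v u)" by (rule vs[OF u])
  have s: "summable (\<lambda>j. (M ^\<^sub>m j) $$ (a,b))" if "a < n" "b < n" for a b
  proof -
    have "summable (\<lambda>j. (M ^\<^sub>m j *\<^sub>v unit_vec n b) $ a)" using vs[of "unit_vec n b"] that
      by (simp add: vsummable_def del: index_mult_mat_vec)
    moreover have "(M ^\<^sub>m j *\<^sub>v unit_vec n b) $ a = (M ^\<^sub>m j) $$ (a,b)" for j using that Mc by simp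
    ultimately show ?thesis by simp
  qed
  show "mat_neumann n M *\<^sub>v u = vec_suminf n (\<lambda>j. M ^\<^sub>m j *\<^sub>v u)"
  proof (rule eq_vecI)
    fix a assume "a < dim_vec (vec_suminf n (\<lambda>j. M ^\<^sub>m j *\<^sub>v u))"
    hence a: "a < n" by simp
    have "(mat_neumann n M *\<^sub>v u) $ a = (\<Sum>b<n. (\<Sum>j. (M ^\<^sub>m j) $$ (a,b)) * u $ b)"
      using a u by (simp add: mat_neumann_def mv_index del: index_mult_mat_vec)
    also have "\<dots> = (\<Sum>j. \<Sum>b<n. (M ^\<^sub>m j) $$ (a,b) * u $ b)"
      by (rule sums_unique, intro sums_sum sums_mult2 summable_sums s) (use a in auto)
    also have "\<dots> = vec_suminf n (\<lambda>j. M ^\<^sub>m j *\<^sub>v u) $ a"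
      using a u Mc by (simp add: mv_index del: index_mult_mat_vec)
    finally show "(mat_neumann n M *\<^sub>v u) $ a = vec_suminf n (\<lambda>j. M ^\<^sub>m j *\<^sub>v u) $ a" .
  qed (simp add: mat_neumann_def)
qed

lemma mat_neumann_inverse:
  assumes M: "geo_stable n M"
  shows "(1\<^sub>m n - M) * mat_neumann n M = 1\<^sub>m n"
proof (rule mat_eqI_vec[of _ n n])
  note Mc = geo_stable_carrier[OF M]
  have Nc: "mat_neumann n M \<in> carrier_mat n n" by (simp add: mat_neumann_def)
  show "(1\<^sub>m n - M) * mat_neumann n M \<in> carrier_mat n n" using Mc Nc by auto
  fix u :: "complex vec" assume "u \<in> carrier_vec n"
  hence u: "dim_vec u = n" by simp
  have "mat_neumann n M *\<^sub>v u = M ^\<^sub>m 0 *\<^sub>v u + vec_suminf n (\<lambda>j. M ^\<^sub>m Suc j *\<^sub>v u)"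
    unfolding mat_neumann_mv(1)[OF M u] by (rule vsummable_head[OF mat_neumann_mv(2)[OF M u]])
  also have "vec_suminf n (\<lambda>j. M ^\<^sub>m Suc j *\<^sub>v u) = M *\<^sub>v (mat_neumann n M *\<^sub>v u)"
    unfolding pow_mv_Suc(2)[OF Mc u] mat_neumann_mv(1)[OF M u]
    by (rule vsummable_mv(2)[OF mat_neumann_mv(2)[OF M u], symmetric]) (use Mc in auto)
  finally have e: "mat_neumann n M *\<^sub>v u = u + M *\<^sub>v (mat_neumann n M *\<^sub>v u)" using Mc u by simp
  have "mat_neumann n M *\<^sub>v u - M *\<^sub>v (mat_neumann n M *\<^sub>v u) = u"
    by (subst e) (use Mc u in \<open>intro eq_vecI; simp\<close>)
  thus "(1\<^sub>m n - M) * mat_neumann n M *\<^sub>v u = 1\<^sub>m n *\<^sub>v u" using Mc Nc u by (simp add: mvs)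
qed auto

lemma geo_stable_smult:
  assumes A: "geo_stable n A" and z: "cmod z \<le> 1"
  shows "geo_stable n (z \<cdot>\<^sub>m A)"
proof -
  from A obtain c \<rho> where Ac: "A \<in> carrier_mat n n" and c: "0 \<le> c" "0 < \<rho>" "\<rho> < 1"
    and b: "\<And>j i l. i < n \<Longrightarrow> l < n \<Longrightarrow> cmod ((A ^\<^sub>m j) $$ (i,l)) \<le> c * \<rho> ^ j"
    unfolding geo_stable_def by blast
  have "cmod (((z \<cdot>\<^sub>m A) ^\<^sub>m j) $$ (i,l)) \<le> c * \<rho> ^ j" if "i < n" "l < n" for i j l
  proof -
    have "cmod (((z \<cdot>\<^sub>m A) ^\<^sub>m j) $$ (i,l)) = cmod z ^ j * cmod ((A ^\<^sub>m j) $$ (i,l))"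
      unfolding smult_pow[OF Ac] using that Ac by (simp add: norm_mult norm_power)
    also have "\<dots> \<le> 1 * cmod ((A ^\<^sub>m j) $$ (i,l))" using z by (intro mult_right_mono power_le_one) auto
    finally show ?thesis using b[OF that, of j] by simp
  qed
  thus ?thesis using Ac c unfolding geo_stable_def by (intro conjI exI[of _ c] exI[of _ \<rho>]) auto
qed

definition resolv :: "nat \<Rightarrow> complex mat \<Rightarrow> complex \<Rightarrow> complex mat" where
  "resolv n A z = cmat_inv (1\<^sub>m n - z \<cdot>\<^sub>m A)"

text \<open>For \<open>|z| \<le> 1\<close> the matrix \<open>z A\<close> is still stable, so the
  Neumann series converges and is a right inverse of the square matrix \<open>1 - z A\<close>; this
  identifies the value of \<open>cmat_inv\<close>.\<close>

lemma resolv: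
  assumes A: "geo_stable n A" and z: "cmod z \<le> 1"
  shows "resolv n A z \<in> carrier_mat n n"
    "dim_vec u = n \<Longrightarrow> resolv n A z *\<^sub>v u = u + z \<cdot>\<^sub>v (A *\<^sub>v (resolv n A z *\<^sub>v u))"
    "dim_vec u = n \<Longrightarrow> resolv n A z *\<^sub>v u = vec_suminf n (\<lambda>j. z ^ j \<cdot>\<^sub>v (A ^\<^sub>m j *\<^sub>v u))"
    "dim_vec u = n \<Longrightarrow> vsummable n (\<lambda>j. z ^ j \<cdot>\<^sub>v (A ^\<^sub>m j *\<^sub>v u))"
proof -
  note Ac = geo_stable_carrier[OF A]
  note S = geo_stable_smult[OF A z]
  have Nc: "mat_neumann n (z \<cdot>\<^sub>m A) \<in> carrier_mat n n" by (simp add: mat_neumann_def)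
  have e: "resolv n A z = mat_neumann n (z \<cdot>\<^sub>m A)" unfolding resolv_def
    by (rule cmat_inv_eq[OF _ Nc mat_neumann_inverse[OF S]]) (use Ac in auto)
  show "resolv n A z \<in> carrier_mat n n" using Nc e by simp
  assume u: "dim_vec u = n"
  show "resolv n A z *\<^sub>v u = vec_suminf n (\<lambda>j. z ^ j \<cdot>\<^sub>v (A ^\<^sub>m j *\<^sub>v u))"
    "vsummable n (\<lambda>j. z ^ j \<cdot>\<^sub>v (A ^\<^sub>m j *\<^sub>v u))"
    using mat_neumann_mv[OF S u] u Ac unfolding e by (simp_all add: smult_pow[OF Ac] mv_smult_mat)
  have "((1\<^sub>m n - z \<cdot>\<^sub>m A) * resolv n A z) *\<^sub>v u = u" unfolding e mat_neumann_inverse[OF S] using u by simp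
  hence "resolv n A z *\<^sub>v u - z \<cdot>\<^sub>v (A *\<^sub>v (resolv n A z *\<^sub>v u)) = u"
    using u Ac Nc unfolding e by (simp add: mvs)
  hence "u + z \<cdot>\<^sub>v (A *\<^sub>v (resolv n A z *\<^sub>v u)) = (resolv n A z *\<^sub>v u - z \<cdot>\<^sub>v (A *\<^sub>v (resolv n A z *\<^sub>v u))) + z \<cdot>\<^sub>v (A *\<^sub>v (resolv n A z *\<^sub>v u))"
    by simp
  also have "\<dots> = resolv n A z *\<^sub>v u" using Ac Nc unfolding e by (intro eq_vecI) auto
  finally show "resolv n A z *\<^sub>v u = u + z \<cdot>\<^sub>v (A *\<^sub>v (resolv n A z *\<^sub>v u))" by simp
qed

text \<open>Markov parameters, the power series coefficients of \<open>realiz\<close>. The exponent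
  \<open>k - 1\<close> reflects the factor \<open>z\<close> in front of the resolvent.\<close>

definition markov :: "complex mat \<Rightarrow> complex mat \<Rightarrow> complex mat \<Rightarrow> complex mat \<Rightarrow> nat \<Rightarrow> complex mat" where
  "markov D C A B k = (if k = 0 then D else C * A ^\<^sub>m (k - 1) * B)"

lemma realiz_mv:
  assumes A: "geo_stable n A" and z: "cmod z \<le> 1" and B: "B \<in> carrier_mat n c"
    and C: "C \<in> carrier_mat r n" and D: "D \<in> carrier_mat r c" and u: "dim_vec u = c"
  shows "realiz D C A B z *\<^sub>v u = D *\<^sub>v u + z \<cdot>\<^sub>v (C *\<^sub>v (resolv n A z *\<^sub>v (B *\<^sub>v u)))"
    "realiz D C A B z \<in> carrier_mat r c"
proof -
  note Ac = geo_stable_carrier[OF A]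
  note X = resolv(1)[OF A z]
  have e: "realiz D C A B z = D + z \<cdot>\<^sub>m (C * resolv n A z * B)" using Ac by (simp add: realiz_def resolv_def)
  show "realiz D C A B z *\<^sub>v u = D *\<^sub>v u + z \<cdot>\<^sub>v (C *\<^sub>v (resolv n A z *\<^sub>v (B *\<^sub>v u)))"
    unfolding e using X B C D u by (simp add: mvs)
  show "realiz D C A B z \<in> carrier_mat r c" unfolding e using X B C D by auto
qed

lemma realiz_series:
  assumes A: "geo_stable n A" and B: "B \<in> carrier_mat n c"
    and C: "C \<in> carrier_mat r n" and D: "D \<in> carrier_mat r c" and ab: "a < r" "b < c"
  shows "summable (\<lambda>j. cmod (markov D C A B j $$ (a,b)))"
    "cmod z \<le> 1 \<Longrightarrow> (\<Sum>j. markov D C A B j $$ (a,b) * z ^ j) = realiz D C A B z $$ (a,b)"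
proof -
  note Ac = geo_stable_carrier[OF A]
  from geo_stable_bound[OF A B] obtain K \<rho> where K: "0 \<le> K" "0 < \<rho>" "\<rho> < 1"
    "\<And>j u. dim_vec u = c \<Longrightarrow> nrm (A ^\<^sub>m j *\<^sub>v (B *\<^sub>v u)) \<le> K * \<rho> ^ j * nrm u" by blast
  from mat_bounded[of C] obtain k where k: "0 \<le> k" "\<And>x. dim_vec x = n \<Longrightarrow> nrm (C *\<^sub>v x) \<le> k * nrm x"
    using C by auto
  define e where "e = (unit_vec c b :: complex vec)"
  have e: "dim_vec e = c" by (simp add: e_def)
  have me: "markov D C A B (Suc j) $$ (a,b) = (C *\<^sub>v (A ^\<^sub>m j *\<^sub>v (B *\<^sub>v e))) $ a" for j
  proof -
    have "(C * A ^\<^sub>m j * B) *\<^sub>v e = C *\<^sub>v (A ^\<^sub>m j *\<^sub>v (B *\<^sub>v e))"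
      using Ac B C e by (simp add: mv_assoc)
    moreover have "((C * A ^\<^sub>m j * B) *\<^sub>v e) $ a = (C * A ^\<^sub>m j * B) $$ (a,b)"
    proof -
      have "C * A ^\<^sub>m j * B \<in> carrier_mat r c" using Ac B C by auto
      thus ?thesis using ab unfolding e_def by (simp del: index_mult_mat)
    qed
    ultimately show ?thesis by (simp add: markov_def)
  qed
  have bd: "cmod (markov D C A B (Suc j) $$ (a,b)) \<le> k * K * nrm e * \<rho> ^ j" for j
  proof -
    have "cmod (markov D C A B (Suc j) $$ (a,b)) \<le> nrm (C *\<^sub>v (A ^\<^sub>m j *\<^sub>v (B *\<^sub>v e)))"
      unfolding me by (rule cmod_index_le_nrm) (use ab C in simp)
    also have "\<dots> \<le> k * nrm (A ^\<^sub>m j *\<^sub>v (B *\<^sub>v e))" using k(2) Ac by simp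
    also have "\<dots> \<le> k * (K * \<rho> ^ j * nrm e)" using K(4)[OF e] k by (intro mult_left_mono) auto
    finally show ?thesis by (simp add: mult_ac)
  qed
  have "summable (\<lambda>j. cmod (markov D C A B (Suc j) $$ (a,b)))"
    by (rule summable_comparison_test'[of "\<lambda>j. k * K * nrm e * \<rho> ^ j" 0])
      (use bd K in \<open>auto intro!: summable_mult summable_geometric\<close>)
  thus s: "summable (\<lambda>j. cmod (markov D C A B j $$ (a,b)))"
    by (subst (asm) summable_Suc_iff)
  assume z: "cmod z \<le> 1"
  have sz: "summable (\<lambda>j. markov D C A B j $$ (a,b) * z ^ j)"
  proof (rule summable_comparison_test'[OF s, of 0])
    fix j
    have "cmod (markov D C A B j $$ (a,b)) * cmod z ^ j \<le> cmod (markov D C A B j $$ (a,b)) * 1"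
      using z by (intro mult_left_mono power_le_one) auto
    thus "norm (markov D C A B j $$ (a,b) * z ^ j) \<le> cmod (markov D C A B j $$ (a,b))"
      by (simp add: norm_mult norm_power)
  qed
  have Be: "dim_vec (B *\<^sub>v e) = n" using B by simp
  note X = resolv(3,4)[OF A z Be]
  have "C *\<^sub>v (resolv n A z *\<^sub>v (B *\<^sub>v e)) = vec_suminf r (\<lambda>j. C *\<^sub>v (z ^ j \<cdot>\<^sub>v (A ^\<^sub>m j *\<^sub>v (B *\<^sub>v e))))"
    unfolding X(1) by (rule vsummable_mv(2)[OF X(2)]) (use C in auto)
  also have "(\<lambda>j. C *\<^sub>v (z ^ j \<cdot>\<^sub>v (A ^\<^sub>m j *\<^sub>v (B *\<^sub>v e)))) = (\<lambda>j. z ^ j \<cdot>\<^sub>v (C *\<^sub>v (A ^\<^sub>m j *\<^sub>v (B *\<^sub>v e))))"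
    using C Ac by (simp add: mv_smult)
  finally have "(C *\<^sub>v (resolv n A z *\<^sub>v (B *\<^sub>v e))) $ a = (\<Sum>j. z ^ j * markov D C A B (Suc j) $$ (a,b))"
    using ab C by (simp add: me del: index_mult_mat_vec)
  hence "realiz D C A B z $$ (a,b) = D $$ (a,b) + z * (\<Sum>j. z ^ j * markov D C A B (Suc j) $$ (a,b))"
  proof -
    assume h: "(C *\<^sub>v (resolv n A z *\<^sub>v (B *\<^sub>v e))) $ a = (\<Sum>j. z ^ j * markov D C A B (Suc j) $$ (a,b))"
    note R = realiz_mv[OF A z B C D e]
    have "realiz D C A B z $$ (a,b) = (realiz D C A B z *\<^sub>v e) $ a" using R(2) ab by (simp add: e_def)
    also have "\<dots> = (D *\<^sub>v e) $ a + z * (C *\<^sub>v (resolv n A z *\<^sub>v (B *\<^sub>v e))) $ a"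
      unfolding R(1) using ab C D by (simp del: index_mult_mat_vec)
    also have "(D *\<^sub>v e) $ a = D $$ (a,b)" using D ab by (simp add: e_def)
    finally show ?thesis unfolding h .
  qed
  also have "z * (\<Sum>j. z ^ j * markov D C A B (Suc j) $$ (a,b)) = (\<Sum>j. z * (z ^ j * markov D C A B (Suc j) $$ (a,b)))"
  proof (cases "z = 0")
    case False
    have "summable (\<lambda>j. markov D C A B (Suc j) $$ (a,b) * z ^ Suc j)" using sz by (subst summable_Suc_iff)
    hence "summable (\<lambda>j. (1 / z) * (markov D C A B (Suc j) $$ (a,b) * z ^ Suc j))" by (rule summable_mult)
    moreover have "(1 / z) * (markov D C A B (Suc j) $$ (a,b) * z ^ Suc j) = z ^ j * markov D C A B (Suc j) $$ (a,b)" for j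
      using False by simp
    ultimately have "summable (\<lambda>j. z ^ j * markov D C A B (Suc j) $$ (a,b))" by simp
    thus ?thesis by (rule suminf_mult[symmetric])
  qed simp
  also have "D $$ (a,b) + (\<Sum>j. z * (z ^ j * markov D C A B (Suc j) $$ (a,b))) = (\<Sum>j. markov D C A B j $$ (a,b) * z ^ j)"
    using suminf_split_head[OF sz] by (simp add: markov_def mult_ac)
  finally show "(\<Sum>j. markov D C A B j $$ (a,b) * z ^ j) = realiz D C A B z $$ (a,b)" by simp
qed

text \<open>Fourier coefficients see only the circle, so the symbol is assumed to be a realization
  only there. A spectral factor that is merely a function with the right values can thus be treated
  like \<open>G\<close> and \<open>K\<close>.\<close>

lemma fourier_coeff_realiz:
  assumes A: "geo_stable n A" and B: "B \<in> carrier_mat n c"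
    and C: "C \<in> carrier_mat r n" and D: "D \<in> carrier_mat r c"
    and \<Omega>: "\<And>t. \<Omega> (cis t) = realiz D C A B (cis t)"
  shows "fourier_coeff r c \<Omega> k = (if k < 0 then 0\<^sub>m r c else markov D C A B (nat k))"
proof (rule eq_matI)
  have m: "markov D C A B j \<in> carrier_mat r c" for j
    using D C B geo_stable_carrier[OF A] by (auto simp: markov_def)
  show "dim_row (fourier_coeff r c \<Omega> k) = dim_row (if k < 0 then 0\<^sub>m r c else markov D C A B (nat k))"
    "dim_col (fourier_coeff r c \<Omega> k) = dim_col (if k < 0 then 0\<^sub>m r c else markov D C A B (nat k))"
    using m[of "nat k"] by (auto simp: fourier_coeff_def)
  fix a b assume "a < dim_row (if k < 0 then 0\<^sub>m r c else markov D C A B (nat k))"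
    "b < dim_col (if k < 0 then 0\<^sub>m r c else markov D C A B (nat k))"
  hence ab: "a < r" "b < c" using m[of "nat k"] by (auto split: if_splits)
  note s = realiz_series[OF A B C D ab]
  have "integral {0..2*pi} (\<lambda>t. (\<Omega> (cis t)) $$ (a,b) * cis (- (of_int k * t)))
     = 2 * pi * (if 0 \<le> k then markov D C A B (nat k) $$ (a,b) else 0)"
    unfolding \<Omega> using integral_unique[OF fourier_power_series[OF s(1), of k]] by (simp add: s(2))
  thus "fourier_coeff r c \<Omega> k $$ (a,b) = (if k < 0 then 0\<^sub>m r c else markov D C A B (nat k)) $$ (a,b)"
    using ab by (auto simp: fourier_coeff_def)
qed

text \<open>\<open>M\<close> is left general so that the induction can absorb the factor
  \<open>A\<close> of each time step into it.\<close>

lemma fwd_state_expand: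
  assumes A: "A \<in> carrier_mat n n" and B: "B \<in> carrier_mat n c" and x: "\<And>i. dim_vec (x i) = c"
  shows "dim_col M = n \<Longrightarrow> l < dim_row M \<Longrightarrow>
    (M *\<^sub>v fwd_state A B (0\<^sub>v n) x i) $ l = (\<Sum>j<i. (M *\<^sub>v (A ^\<^sub>m (i - 1 - j) *\<^sub>v (B *\<^sub>v x j))) $ l)"
proof (induction i arbitrary: M)
  case (Suc i)
  note dx = dim_fwd_state[OF A B, of "0\<^sub>v n" x]
  have "M *\<^sub>v fwd_state A B (0\<^sub>v n) x (Suc i) = (M * A) *\<^sub>v fwd_state A B (0\<^sub>v n) x i + M *\<^sub>v (B *\<^sub>v x i)"
    using A B x Suc.prems dx by (simp add: mvs)
  hence "(M *\<^sub>v fwd_state A B (0\<^sub>v n) x (Suc i)) $ l = ((M * A) *\<^sub>v fwd_state A B (0\<^sub>v n) x i) $ l + (M *\<^sub>v (B *\<^sub>v x i)) $ l"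
    using Suc.prems by (simp del: index_mult_mat_vec)
  also have "((M * A) *\<^sub>v fwd_state A B (0\<^sub>v n) x i) $ l
     = (\<Sum>j<i. ((M * A) *\<^sub>v (A ^\<^sub>m (i - 1 - j) *\<^sub>v (B *\<^sub>v x j))) $ l)"
    by (rule Suc.IH) (use A Suc.prems in auto)
  also have "\<dots> = (\<Sum>j<i. (M *\<^sub>v (A ^\<^sub>m (Suc i - 1 - j) *\<^sub>v (B *\<^sub>v x j))) $ l)"
  proof (rule sum.cong[OF refl])
    fix j assume "j \<in> {..<i}"
    hence "Suc i - 1 - j = Suc (i - 1 - j)" by auto
    thus "((M * A) *\<^sub>v (A ^\<^sub>m (i - 1 - j) *\<^sub>v (B *\<^sub>v x j))) $ l = (M *\<^sub>v (A ^\<^sub>m (Suc i - 1 - j) *\<^sub>v (B *\<^sub>v x j))) $ l"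
      using A B x Suc.prems pow_mv_Suc(2)[OF A, of "B *\<^sub>v x j" "i - 1 - j"]
      by (simp add: mv_assoc del: index_mult_mat_vec pow_mat.simps)
  qed
  finally show ?case using A B x by simp
qed (auto simp: mv_zero)

lemma toeplitz_realiz:
  assumes A: "geo_stable n A" and B: "B \<in> carrier_mat n c"
    and C: "C \<in> carrier_mat r n" and D: "D \<in> carrier_mat r c"
    and \<Omega>: "\<And>t. \<Omega> (cis t) = realiz D C A B (cis t)" and x: "\<And>i. dim_vec (x i) = c"
  shows "toeplitz r c \<Omega> x i = D *\<^sub>v x i + C *\<^sub>v fwd_state A B (0\<^sub>v n) x i"
proof (rule eq_vecI)
  note Ac = geo_stable_carrier[OF A]
  note F = fourier_coeff_realiz[OF A B C D \<Omega>]
  fix l assume "l < dim_vec (D *\<^sub>v x i + C *\<^sub>v fwd_state A B (0\<^sub>v n) x i)"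
  hence l: "l < r" using C by simp
  have "toeplitz r c \<Omega> x i $ l = (\<Sum>j. (fourier_coeff r c \<Omega> (int i - int j) *\<^sub>v x j) $ l)"
    using l by (simp add: toeplitz_def)
  also have "\<dots> = (\<Sum>j\<in>{..i}. (fourier_coeff r c \<Omega> (int i - int j) *\<^sub>v x j) $ l)"
    by (rule suminf_finite) (use l x in \<open>auto simp: F mv_zero_mat simp del: index_mult_mat_vec\<close>)
  also have "\<dots> = (\<Sum>j<i. (fourier_coeff r c \<Omega> (int i - int j) *\<^sub>v x j) $ l) + (D *\<^sub>v x i) $ l"
    by (simp add: lessThan_Suc_atMost[symmetric] F markov_def)
  also have "(\<Sum>j<i. (fourier_coeff r c \<Omega> (int i - int j) *\<^sub>v x j) $ l)
     = (\<Sum>j<i. (C *\<^sub>v (A ^\<^sub>m (i - 1 - j) *\<^sub>v (B *\<^sub>v x j))) $ l)"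
  proof (rule sum.cong[OF refl])
    fix j assume "j \<in> {..<i}"
    hence j: "j < i" by simp
    hence "nat (int i - int j) \<noteq> 0" "nat (int i - int j) - 1 = i - 1 - j" "\<not> int i - int j < 0" by auto
    thus "(fourier_coeff r c \<Omega> (int i - int j) *\<^sub>v x j) $ l = (C *\<^sub>v (A ^\<^sub>m (i - 1 - j) *\<^sub>v (B *\<^sub>v x j))) $ l"
      using Ac B C x by (simp add: F markov_def mv_assoc del: index_mult_mat_vec)
  qed
  also have "\<dots> = (C *\<^sub>v fwd_state A B (0\<^sub>v n) x i) $ l"
    by (rule fwd_state_expand[OF Ac B x, symmetric]) (use C l in auto)
  finally show "toeplitz r c \<Omega> x i $ l = (D *\<^sub>v x i + C *\<^sub>v fwd_state A B (0\<^sub>v n) x i) $ l"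
    using l C D by (simp add: add.commute del: index_mult_mat_vec)
qed (use C in \<open>simp add: toeplitz_def\<close>)

text \<open>The adjoint of a lower triangular operator is upper triangular, so its state runs
  backwards. The state enters at \<open>Suc j\<close> because the diagonal block \<open>D\<close> is
  accounted for separately.\<close>

lemma toeplitz_adj_realiz:
  assumes A: "geo_stable n A" and B: "B \<in> carrier_mat n c"
    and C: "C \<in> carrier_mat r n" and D: "D \<in> carrier_mat r c"
    and \<Omega>: "\<And>t. \<Omega> (cis t) = realiz D C A B (cis t)" and y: "vbounded r y"
  shows "toeplitz_adj r c \<Omega> y j = mat_adjoint D *\<^sub>v y j
    + mat_adjoint B *\<^sub>v bwd_state (mat_adjoint A) (mat_adjoint C) y (Suc j)"
proof -
  note Ac = geo_stable_carrier[OF A]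
  note As = geo_stable_adjoint[OF A]
  note F = fourier_coeff_realiz[OF A B C D \<Omega>]
  have dy: "dim_vec (y i) = r" for i using y by (auto simp: vbounded_def)
  have m: "markov D C A B j \<in> carrier_mat r c" for j
    using D C B Ac by (auto simp: markov_def)
  define g where "g i = mat_adjoint (fourier_coeff r c \<Omega> (int i - int j)) *\<^sub>v y i" for i
  define h where "h i = mat_adjoint (markov D C A B i) *\<^sub>v y (i + j)" for i
  have gh: "g (i + j) = h i" for i by (simp add: g_def h_def F)
  \<comment> \<open>The defining series starts at \<open>i = 0\<close>, but blocks of negative index
    vanish, so only the terms from \<open>i = j\<close> on contribute.\<close>
  have g0: "g i $ l = 0" if "i < j" "l < c" for i l
  proof -
    have "mat_adjoint (0\<^sub>m r c) = (0\<^sub>m c r :: complex mat)" by (intro eq_matI) auto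
    thus ?thesis using that dy by (simp add: g_def F mv_zero_mat del: index_mult_mat_vec)
  qed
  have hS: "h (Suc i) = mat_adjoint B *\<^sub>v (mat_adjoint A ^\<^sub>m i *\<^sub>v (mat_adjoint C *\<^sub>v y (i + Suc j)))" for i
    using Ac B C dy by (simp add: h_def markov_def adjoint_mult mv_assoc adjoint_pow[OF Ac])
  have costate: "vsummable n (\<lambda>i. mat_adjoint A ^\<^sub>m i *\<^sub>v (mat_adjoint C *\<^sub>v y (i + Suc j)))"
    by (rule bwd_state_summable[OF As adjoint_carrier[OF C] y])
  have hSs: "vsummable c (\<lambda>i. h (Suc i))" unfolding hS by (rule vsummable_mv(1)[OF costate]) (use B in auto)
  have hs: "vsummable c h"
    using hSs m[of 0] m unfolding vsummable_def
    by (auto simp: h_def summable_Suc_iff[of "\<lambda>i. h i $ l" for l] simp del: index_mult_mat_vec)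
      (subst summable_Suc_iff[symmetric], simp add: h_def del: index_mult_mat_vec)
  have "toeplitz_adj r c \<Omega> y j = vec_suminf c g" by (simp add: toeplitz_adj_def g_def[abs_def])
  also have "\<dots> = vec_suminf c h"
  proof (rule eq_vecI)
    fix l assume "l < dim_vec (vec_suminf c h)"
    hence l: "l < c" by simp
    have "summable (\<lambda>i. h i $ l)" using hs l by (simp add: vsummable_def)
    hence "summable (\<lambda>i. g (i + j) $ l)" by (simp add: gh)
    hence "summable (\<lambda>i. g i $ l)" by (subst (asm) summable_iff_shift[of "\<lambda>i. g i $ l"])
    from suminf_split_initial_segment[OF this, of j]
    have "(\<Sum>i. g i $ l) = (\<Sum>i. h i $ l) + (\<Sum>i<j. g i $ l)" by (simp add: gh)
    also have "(\<Sum>i<j. g i $ l) = 0" by (rule sum.neutral) (use g0 l in auto)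
    finally show "vec_suminf c g $ l = vec_suminf c h $ l" using l by simp
  qed simp
  also have "\<dots> = h 0 + vec_suminf c (\<lambda>i. h (Suc i))" by (rule vsummable_head[OF hs])
  also have "vec_suminf c (\<lambda>i. h (Suc i)) = mat_adjoint B *\<^sub>v bwd_state (mat_adjoint A) (mat_adjoint C) y (Suc j)"
    unfolding hS bwd_state_def using vsummable_mv(2)[OF costate, of "mat_adjoint B" c] B Ac by simp
  also have "h 0 = mat_adjoint D *\<^sub>v y j" by (simp add: h_def markov_def)
  finally show ?thesis .
qed

section \<open>Energy identities\<close>

text \<open>A dissipation identity with storage \<open><P s, s>\<close>. Expanding the storage along
  \<open>s = C^* y + A^* s'\<close> and using the Lyapunov equation at \<open>s'\<close> removes all
  squares in \<open>s'\<close>; what remains besides the change of storage is a square in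
  \<open>y\<close> and one cross term.\<close>

lemma anticausal_energy:
  assumes A: "A \<in> carrier_mat n n" and B: "B \<in> carrier_mat n p" and C: "C \<in> carrier_mat m n"
    and D: "D \<in> carrier_mat m p" and P: "P \<in> carrier_mat n n" and h: "herm P"
    and lyap: "P = B * mat_adjoint B + A * P * mat_adjoint A"
    and y: "dim_vec y = m" and s': "dim_vec s' = n"
    and s: "s = mat_adjoint C *\<^sub>v y + mat_adjoint A *\<^sub>v s'"
  shows "vnorm2 (mat_adjoint D *\<^sub>v y + mat_adjoint B *\<^sub>v s')
    = Re (inn ((D * mat_adjoint D + C * P * mat_adjoint C) *\<^sub>v y) y)
      + 2 * Re (inn ((B * mat_adjoint D + A * P * mat_adjoint C) *\<^sub>v y) s')
      + Re (inn (P *\<^sub>v s') s') - Re (inn (P *\<^sub>v s) s)"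
proof -
  note d = carrier_matD[OF A] carrier_matD[OF B] carrier_matD[OF C] carrier_matD[OF D] carrier_matD[OF P] y s'
  define a where "a = mat_adjoint A *\<^sub>v s'"
  define c where "c = mat_adjoint C *\<^sub>v y"
  define \<delta> where "\<delta> = mat_adjoint D *\<^sub>v y"
  define b where "b = mat_adjoint B *\<^sub>v s'"
  have dd: "dim_vec a = n" "dim_vec c = n" "dim_vec \<delta> = p" "dim_vec b = p"
    by (auto simp: a_def b_def c_def \<delta>_def d)
  have "P *\<^sub>v s' = B *\<^sub>v b + A *\<^sub>v (P *\<^sub>v a)"
    by (subst lyap) (simp add: mvs d a_def b_def)
  hence 1: "inn (P *\<^sub>v s') s' = inn b b + inn (P *\<^sub>v a) a"
    by (simp add: inns inn_mv d dd a_def[symmetric] b_def[symmetric])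
  have 2: "inn ((D * mat_adjoint D + C * P * mat_adjoint C) *\<^sub>v y) y = inn \<delta> \<delta> + inn (P *\<^sub>v c) c"
    by (simp add: mvs inns inn_mv[of D] inn_mv[of C] d c_def \<delta>_def)
  have 3: "inn ((B * mat_adjoint D + A * P * mat_adjoint C) *\<^sub>v y) s' = inn \<delta> b + inn (P *\<^sub>v c) a"
    by (simp add: mvs inns inn_mv[of B] inn_mv[of A] d c_def \<delta>_def a_def b_def)
  have 4: "Re (inn (P *\<^sub>v a) c) = Re (inn (P *\<^sub>v c) a)"
    using herm_swap[OF h P, of a c] by (simp add: dd)
  have 5: "Re (inn b \<delta>) = Re (inn \<delta> b)" by (rule Re_inn_commute) (simp add: dd)
  have "s = c + a" by (simp add: s a_def c_def)
  thus ?thesis unfolding 1 2 3 vnorm2_Re \<delta>_def[symmetric] b_def[symmetric]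
    by (simp add: mvs inns dd d 4 5)
qed

text \<open>The time-reversed counterpart, with the observability Gramian as storage. It gives the
  energy balance of a spectral factor.\<close>

lemma causal_energy:
  assumes A: "A \<in> carrier_mat n n" and B: "B \<in> carrier_mat n m" and C: "C \<in> carrier_mat r n"
    and D: "D \<in> carrier_mat r m" and Q: "Q \<in> carrier_mat n n" and h: "herm Q"
    and lyap: "Q = mat_adjoint C * C + mat_adjoint A * Q * A"
    and y: "dim_vec y = m" and x: "dim_vec x = n" and x': "x' = A *\<^sub>v x + B *\<^sub>v y"
  shows "vnorm2 (D *\<^sub>v y + C *\<^sub>v x)
    = Re (inn ((mat_adjoint D * D + mat_adjoint B * Q * B) *\<^sub>v y) y)
      + 2 * Re (inn ((mat_adjoint D * C + mat_adjoint B * Q * A) *\<^sub>v x) y)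
      + Re (inn (Q *\<^sub>v x) x) - Re (inn (Q *\<^sub>v x') x')"
proof -
  note d = carrier_matD[OF A] carrier_matD[OF B] carrier_matD[OF C] carrier_matD[OF D] carrier_matD[OF Q] y x
  define a where "a = A *\<^sub>v x"
  define c where "c = C *\<^sub>v x"
  define \<delta> where "\<delta> = D *\<^sub>v y"
  define b where "b = B *\<^sub>v y"
  have dd: "dim_vec a = n" "dim_vec c = r" "dim_vec \<delta> = r" "dim_vec b = n"
    by (auto simp: a_def b_def c_def \<delta>_def d)
  have "Q *\<^sub>v x = mat_adjoint C *\<^sub>v c + mat_adjoint A *\<^sub>v (Q *\<^sub>v a)"
    by (subst lyap) (simp add: mvs d a_def c_def)
  hence 1: "inn (Q *\<^sub>v x) x = inn c c + inn (Q *\<^sub>v a) a"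
    by (simp add: inns inn_mv[of "mat_adjoint C"] inn_mv[of "mat_adjoint A"] d dd a_def[symmetric] c_def[symmetric])
  have 2: "inn ((mat_adjoint D * D + mat_adjoint B * Q * B) *\<^sub>v y) y = inn \<delta> \<delta> + inn (Q *\<^sub>v b) b"
    by (simp add: mvs inns inn_mv[of "mat_adjoint D"] inn_mv[of "mat_adjoint B"] d b_def \<delta>_def)
  have 3: "inn ((mat_adjoint D * C + mat_adjoint B * Q * A) *\<^sub>v x) y = inn c \<delta> + inn (Q *\<^sub>v a) b"
    by (simp add: mvs inns inn_mv[of "mat_adjoint D"] inn_mv[of "mat_adjoint B"] d c_def \<delta>_def a_def b_def)
  have 4: "Re (inn (Q *\<^sub>v b) a) = Re (inn (Q *\<^sub>v a) b)"
    using herm_swap[OF h Q, of b a] by (simp add: dd)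
  have 5: "Re (inn c \<delta>) = Re (inn \<delta> c)" by (rule Re_inn_commute) (simp add: dd)
  have "x' = a + b" by (simp add: x' a_def b_def)
  thus ?thesis unfolding 1 2 3 vnorm2_Re \<delta>_def[symmetric] c_def[symmetric]
    by (simp add: mvs inns dd d 4 5)
qed

lemma state_duality:
  assumes A: "A \<in> carrier_mat n n" and B: "B \<in> carrier_mat n p" and C: "C \<in> carrier_mat m n"
    and "dim_vec u = p" "dim_vec x = n" "dim_vec y = m" "dim_vec s' = n"
    and "x' = A *\<^sub>v x + B *\<^sub>v u" "s = mat_adjoint C *\<^sub>v y + mat_adjoint A *\<^sub>v s'"
  shows "inn x' s' - inn x s = inn (B *\<^sub>v u) s' - inn (C *\<^sub>v x) y"
  using assms by (simp add: inns inn_mv[of A] inn_mv[of C])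

text \<open>In one step the two terms with \<open>A\<close> cancel, so \<open><x_i, s_i>\<close>
  telescopes. This exchange of a causal state paired with \<open>y\<close> for the input paired with
  a costate proves adjointness of the Toeplitz operators and both energy estimates for
  factors.\<close>

lemma state_duality_sum:
  assumes A: "geo_stable n A" and B: "B \<in> carrier_mat n p" and C: "C \<in> carrier_mat m n"
    and u: "\<And>i. dim_vec (u i) = p" and y: "vbounded m y" and x0: "dim_vec x0 = n"
  defines "x \<equiv> fwd_state A B x0 u" and "s \<equiv> bwd_state (mat_adjoint A) (mat_adjoint C) y"
  shows "(\<Sum>i<N. inn (C *\<^sub>v x i) (y i)) = (\<Sum>i<N. inn (B *\<^sub>v u i) (s (Suc i))) + inn x0 (s 0) - inn (x N) (s N)"
proof (induction N)
  case (Suc N)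
  note Ac = geo_stable_carrier[OF A]
  have "inn (x (Suc N)) (s (Suc N)) - inn (x N) (s N) = inn (B *\<^sub>v u N) (s (Suc N)) - inn (C *\<^sub>v x N) (y N)"
  proof (rule state_duality[OF Ac B C u])
    show "s N = mat_adjoint C *\<^sub>v y N + mat_adjoint A *\<^sub>v s (Suc N)"
      unfolding s_def by (rule bwd_state_step[OF geo_stable_adjoint[OF A] adjoint_carrier[OF C] y])
    show "dim_vec (x N) = n" unfolding x_def by (rule dim_fwd_state[OF Ac B x0])
    show "dim_vec (s (Suc N)) = n" using Ac by (simp add: s_def)
    show "dim_vec (y N) = m" using y by (auto simp: vbounded_def)
  qed (simp add: x_def)
  hence "inn (C *\<^sub>v x N) (y N)
      = inn (B *\<^sub>v u N) (s (Suc N)) + inn (x N) (s N) - inn (x (Suc N)) (s (Suc N))"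
    by (simp add: algebra_simps)
  thus ?case unfolding sum.lessThan_Suc Suc by simp
qed (simp add: x_def)

lemma tendsto_inn_0:
  assumes "\<And>i. dim_vec (x i) = n" "\<And>i. dim_vec (s i) = n" "\<And>i. nrm (x i) \<le> X" "(\<lambda>i. nrm (s i)) \<longlonglongrightarrow> 0"
  shows "(\<lambda>i. inn (x i) (s i)) \<longlonglongrightarrow> 0"
proof (rule Lim_null_comparison)
  show "eventually (\<lambda>i. norm (inn (x i) (s i)) \<le> X * nrm (s i)) sequentially"
  proof (intro always_eventually allI)
    fix i
    have "cmod (inn (x i) (s i)) \<le> nrm (x i) * nrm (s i)" by (rule cmod_inn_le) (simp add: assms)
    also have "\<dots> \<le> X * nrm (s i)" by (intro mult_right_mono assms) simp
    finally show "norm (inn (x i) (s i)) \<le> X * nrm (s i)" .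
  qed
  show "(\<lambda>i. X * nrm (s i)) \<longlonglongrightarrow> 0" using tendsto_mult_left[OF assms(4), of X] by simp
qed

text \<open>\<open>toeplitz_adj\<close> is defined by coefficients only; here it is shown to be the
  adjoint. The partial sums of both pairings differ by \<open><x_N, s_N>\<close>, which tends to 0
  since \<open>x\<close> is bounded and \<open>s\<close> is square summable.\<close>

lemma sums_toeplitz_adjoint:
  assumes A: "geo_stable n A" and B: "B \<in> carrier_mat n p" and C: "C \<in> carrier_mat m n"
    and D: "D \<in> carrier_mat m p" and \<Omega>: "\<And>t. \<Omega> (cis t) = realiz D C A B (cis t)"
    and u: "ell2 p u" and y: "ell2 m y" and l: "(\<lambda>i. inn (u i) (toeplitz_adj m p \<Omega> y i)) sums L"
  shows "(\<lambda>i. inn (toeplitz m p \<Omega> u i) (y i)) sums L"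
proof -
  note Ac = geo_stable_carrier[OF A] and As = geo_stable_adjoint[OF A]
  have du: "dim_vec (u i) = p" for i using u by (auto simp: ell2_def)
  have dy: "dim_vec (y i) = m" for i using y by (auto simp: ell2_def)
  note yb = ell2_imp_vbounded[OF y]
  define x where "x = fwd_state A B (0\<^sub>v n) u"
  define s where "s = bwd_state (mat_adjoint A) (mat_adjoint C) y"
  have dx: "dim_vec (x i) = n" for i unfolding x_def by (rule dim_fwd_state[OF Ac B]) simp
  have ds: "dim_vec (s i) = n" for i using Ac by (simp add: s_def)
  have T: "toeplitz m p \<Omega> u i = D *\<^sub>v u i + C *\<^sub>v x i" for i
    unfolding x_def by (rule toeplitz_realiz[OF A B C D \<Omega> du])
  have Ta: "toeplitz_adj m p \<Omega> y i = mat_adjoint D *\<^sub>v y i + mat_adjoint B *\<^sub>v s (Suc i)" for i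
    unfolding s_def by (rule toeplitz_adj_realiz[OF A B C D \<Omega> yb])
  have sum: "(\<Sum>i<N. inn (toeplitz m p \<Omega> u i) (y i))
      = (\<Sum>i<N. inn (u i) (toeplitz_adj m p \<Omega> y i)) - inn (x N) (s N)" for N
  proof -
    have 1: "inn (toeplitz m p \<Omega> u i) (y i) = inn (D *\<^sub>v u i) (y i) + inn (C *\<^sub>v x i) (y i)" for i
      unfolding T using B C D du dy dx by (simp add: inns)
    have 2: "inn (u i) (toeplitz_adj m p \<Omega> y i) = inn (D *\<^sub>v u i) (y i) + inn (B *\<^sub>v u i) (s (Suc i))" for i
      unfolding Ta using B C D du dy ds by (simp add: inns inn_mv)
    have "(\<Sum>i<N. inn (C *\<^sub>v x i) (y i)) = (\<Sum>i<N. inn (B *\<^sub>v u i) (s (Suc i))) - inn (x N) (s N)"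
      using state_duality_sum[OF A B C du yb index_zero_vec(2), where N = N] ds[of 0] by (simp add: x_def s_def)
    thus ?thesis unfolding 1 2 sum.distrib by simp
  qed
  obtain X where X: "\<And>i. nrm (x i) \<le> X"
    using fwd_state_bounded[OF A B ell2_imp_vbounded[OF u], of "0\<^sub>v n"] by (auto simp: x_def)
  have "(\<lambda>N. inn (x N) (s N)) \<longlonglongrightarrow> 0"
    by (rule tendsto_inn_0[OF dx ds X])
      (unfold s_def, rule ell2_tendsto_0[OF bwd_state_ell2[OF As adjoint_carrier[OF C] y]])
  from tendsto_diff[OF l[unfolded sums_def] this] show ?thesis unfolding sums_def sum by simp
qed

lemma toeplitz_adj_ell2:
  assumes A: "geo_stable n A" and B: "B \<in> carrier_mat n p" and C: "C \<in> carrier_mat m n"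
    and D: "D \<in> carrier_mat m p" and \<Omega>: "\<And>t. \<Omega> (cis t) = realiz D C A B (cis t)" and y: "ell2 m y"
  shows "ell2 p (toeplitz_adj m p \<Omega> y)"
proof -
  have "ell2 p (\<lambda>j. mat_adjoint D *\<^sub>v y j + mat_adjoint B *\<^sub>v bwd_state (mat_adjoint A) (mat_adjoint C) y (Suc j))"
    by (intro ell2_add ell2_mv[OF y] adjoint_carrier B D
        ell2_mv[OF ell2_shift[OF bwd_state_ell2[OF geo_stable_adjoint[OF A] adjoint_carrier[OF C] y]]])
  moreover have "toeplitz_adj m p \<Omega> y = (\<lambda>j. mat_adjoint D *\<^sub>v y j + mat_adjoint B *\<^sub>v bwd_state (mat_adjoint A) (mat_adjoint C) y (Suc j))"
    by (rule ext) (rule toeplitz_adj_realiz[OF A B C D \<Omega> ell2_imp_vbounded[OF y]])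
  ultimately show ?thesis by simp
qed

lemma sums_toeplitz_square:
  assumes A: "geo_stable n A" and B: "B \<in> carrier_mat n p" and C: "C \<in> carrier_mat m n"
    and D: "D \<in> carrier_mat m p" and \<Omega>: "\<And>t. \<Omega> (cis t) = realiz D C A B (cis t)" and y: "ell2 m y"
  shows "(\<lambda>i. inn (toeplitz m p \<Omega> (toeplitz_adj m p \<Omega> y) i) (y i)) sums of_real (\<Sum>i. vnorm2 (toeplitz_adj m p \<Omega> y i))"
    "summable (\<lambda>i. vnorm2 (toeplitz_adj m p \<Omega> y i))"
proof -
  note e = toeplitz_adj_ell2[OF A B C D \<Omega> y]
  show s: "summable (\<lambda>i. vnorm2 (toeplitz_adj m p \<Omega> y i))" using e by (simp add: ell2_def)
  show "(\<lambda>i. inn (toeplitz m p \<Omega> (toeplitz_adj m p \<Omega> y) i) (y i)) sums of_real (\<Sum>i. vnorm2 (toeplitz_adj m p \<Omega> y i))"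
    by (rule sums_toeplitz_adjoint[OF A B C D \<Omega> e y]) (unfold inn_self, rule sums_of_real[OF summable_sums[OF s]])
qed

text \<open>For \<open>u = C^* v\<close> this is the stationary form of the costate recursion: the
  current state is \<open>s\<close> and the next one is \<open>cnj z\<close> times \<open>s\<close>.
  The energy identity of the time domain can thereby be read at a single point of the
  circle.\<close>

lemma resolv_adjoint:
  assumes A: "geo_stable n A" and z: "cmod z \<le> 1" and u: "dim_vec u = n"
  shows "mat_adjoint (resolv n A z) *\<^sub>v u = u + mat_adjoint A *\<^sub>v (cnj z \<cdot>\<^sub>v (mat_adjoint (resolv n A z) *\<^sub>v u))"
proof -
  note Ac = geo_stable_carrier[OF A] and X = resolv(1)[OF A z]
  have "(1\<^sub>m n - z \<cdot>\<^sub>m A) * resolv n A z = 1\<^sub>m n"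
  proof (rule mat_eqI_vec[of _ n n])
    show "(1\<^sub>m n - z \<cdot>\<^sub>m A) * resolv n A z \<in> carrier_mat n n" using Ac X by auto
    fix v :: "complex vec" assume "v \<in> carrier_vec n"
    hence v: "dim_vec v = n" by simp
    have "((1\<^sub>m n - z \<cdot>\<^sub>m A) * resolv n A z) *\<^sub>v v = resolv n A z *\<^sub>v v - z \<cdot>\<^sub>v (A *\<^sub>v (resolv n A z *\<^sub>v v))"
      using Ac X v by (simp add: mvs)
    also have "\<dots> = (v + z \<cdot>\<^sub>v (A *\<^sub>v (resolv n A z *\<^sub>v v))) - z \<cdot>\<^sub>v (A *\<^sub>v (resolv n A z *\<^sub>v v))"
      by (subst resolv(2)[OF A z v]) simp
    also have "\<dots> = v" using Ac v by (intro eq_vecI) auto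
    finally show "((1\<^sub>m n - z \<cdot>\<^sub>m A) * resolv n A z) *\<^sub>v v = 1\<^sub>m n *\<^sub>v v" using v by simp
  qed auto
  hence "resolv n A z * (1\<^sub>m n - z \<cdot>\<^sub>m A) = 1\<^sub>m n"
    using mat_mult_left_right_inverse[of "1\<^sub>m n - z \<cdot>\<^sub>m A" n "resolv n A z"] minus_carrier_mat[of "z \<cdot>\<^sub>m A" n n "1\<^sub>m n"] Ac X by auto
  hence "mat_adjoint (resolv n A z * (1\<^sub>m n - z \<cdot>\<^sub>m A)) *\<^sub>v u = u" using u by simp
  hence e: "mat_adjoint (resolv n A z) *\<^sub>v u - cnj z \<cdot>\<^sub>v (mat_adjoint A *\<^sub>v (mat_adjoint (resolv n A z) *\<^sub>v u)) = u"
    using Ac X u by (simp add: adjoint_mult adjoint_diff adjoint_smult mvs)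
  have "u + cnj z \<cdot>\<^sub>v (mat_adjoint A *\<^sub>v (mat_adjoint (resolv n A z) *\<^sub>v u)) = mat_adjoint (resolv n A z) *\<^sub>v u"
    by (subst (1) e[symmetric]) (use Ac X in \<open>intro eq_vecI; simp\<close>)
  thus ?thesis using Ac X u by (simp add: mv_smult)
qed

lemma realiz_form_series:
  assumes A: "geo_stable n A" and B: "B \<in> carrier_mat n c"
    and C: "C \<in> carrier_mat r n" and D: "D \<in> carrier_mat r c" and v: "dim_vec v = c" and u: "dim_vec u = r"
  shows "summable (\<lambda>j. cmod (inn (markov D C A B j *\<^sub>v v) u))"
    "cmod z \<le> 1 \<Longrightarrow> (\<Sum>j. inn (markov D C A B j *\<^sub>v v) u * z ^ j) = inn (realiz D C A B z *\<^sub>v v) u"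
proof -
  have m: "markov D C A B j \<in> carrier_mat r c" for j
    using D C B geo_stable_carrier[OF A] by (auto simp: markov_def)
  note s = realiz_series[OF A B C D]
  have e: "inn (M *\<^sub>v v) u = (\<Sum>a<r. \<Sum>b<c. M $$ (a,b) * (v $ b * cnj (u $ a)))" if "M \<in> carrier_mat r c" for M
    using u v carrier_matD[OF that]
    by (simp add: inn_sum mv_index sum_distrib_right sum_distrib_left mult_ac del: index_mult_mat_vec)
  have "summable (\<lambda>j. \<Sum>a<r. \<Sum>b<c. cmod (markov D C A B j $$ (a,b)) * cmod (v $ b * cnj (u $ a)))"
    by (intro summable_sum summable_mult2 s(1)) auto
  thus "summable (\<lambda>j. cmod (inn (markov D C A B j *\<^sub>v v) u))"
  proof (rule summable_comparison_test'[of _ 0])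
    fix j
    have "cmod (inn (markov D C A B j *\<^sub>v v) u) \<le> (\<Sum>a<r. \<Sum>b<c. cmod (markov D C A B j $$ (a,b) * (v $ b * cnj (u $ a))))"
      unfolding e[OF m] by (intro order_trans[OF norm_sum] sum_mono)  auto
    thus "norm (cmod (inn (markov D C A B j *\<^sub>v v) u)) \<le> (\<Sum>a<r. \<Sum>b<c. cmod (markov D C A B j $$ (a,b)) * cmod (v $ b * cnj (u $ a)))"
      by (simp add: norm_mult)
  qed
  assume z: "cmod z \<le> 1"
  have sz: "summable (\<lambda>j. markov D C A B j $$ (a,b) * z ^ j)" if "a < r" "b < c" for a b
  proof (rule summable_comparison_test'[OF s(1)[OF that], of 0])
    fix j
    have "cmod (markov D C A B j $$ (a,b)) * cmod z ^ j \<le> cmod (markov D C A B j $$ (a,b)) * 1"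
      using z by (intro mult_left_mono power_le_one) auto
    thus "norm (markov D C A B j $$ (a,b) * z ^ j) \<le> cmod (markov D C A B j $$ (a,b))"
      by (simp add: norm_mult norm_power)
  qed
  have "(\<lambda>j. \<Sum>a<r. \<Sum>b<c. markov D C A B j $$ (a,b) * z ^ j * (v $ b * cnj (u $ a)))
     sums (\<Sum>a<r. \<Sum>b<c. realiz D C A B z $$ (a,b) * (v $ b * cnj (u $ a)))"
    by (intro sums_sum sums_mult2) (use sz s(2)[OF _ _ z] in \<open>auto simp: sums_iff\<close>)
  hence "(\<lambda>j. inn (markov D C A B j *\<^sub>v v) u * z ^ j) sums inn (realiz D C A B z *\<^sub>v v) u"
    by (simp add: e[OF m] e[OF realiz_mv(2)[OF A z B C D v]] sum_distrib_right sum_distrib_left mult_ac)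
  thus "(\<Sum>j. inn (markov D C A B j *\<^sub>v v) u * z ^ j) = inn (realiz D C A B z *\<^sub>v v) u" by (simp add: sums_iff)
qed

section \<open>The quadratic form of the pair\<close>

locale realization_pair =
  fixes m p q n :: nat and A B1 B2 C D1 D2 :: "complex mat"
  assumes A: "geo_stable n A" and B1: "B1 \<in> carrier_mat n p" and B2: "B2 \<in> carrier_mat n q"
    and C: "C \<in> carrier_mat m n" and D1: "D1 \<in> carrier_mat m p" and D2: "D2 \<in> carrier_mat m q"
    and obs: "observable n C A"
begin

definition P1 where "P1 = ctrl_gram A B1"
definition P2 where "P2 = ctrl_gram A B2"
definition N where "N = P1 - P2"
definition R0 where "R0 = D1 * mat_adjoint D1 - D2 * mat_adjoint D2 + C * N * mat_adjoint C"
definition \<Gamma> where "\<Gamma> = B1 * mat_adjoint D1 - B2 * mat_adjoint D2 + A * N * mat_adjoint C"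
definition G where "G = realiz D1 C A B1"
definition K where "K = realiz D2 C A B2"
definition R where "R z = G z * mat_adjoint (G z) - K z * mat_adjoint (K z)"
text \<open>The contribution of one time step to the form of \<open>T_R\<close>: \<open>u\<close> is
  the current input and \<open>s\<close> the costate of the next instant. The block diagonal gives
  \<open>R0\<close>; the parts below and above it are adjoint to each other and give twice a real
  part.\<close>

definition \<phi> where "\<phi> u s = Re (inn (R0 *\<^sub>v u) u) + 2 * Re (inn (\<Gamma> *\<^sub>v u) s)"
definition quad where "quad y = ell2_inner
  (\<lambda>i. toeplitz m p G (toeplitz_adj m p G y) i - toeplitz m q K (toeplitz_adj m q K y) i) y"
definition costate where "costate = bwd_state (mat_adjoint A) (mat_adjoint C)"

lemmas Ac = geo_stable_carrier[OF A]
lemmas As = geo_stable_adjoint[OF A]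

lemma carriers: "P1 \<in> carrier_mat n n" "P2 \<in> carrier_mat n n" "N \<in> carrier_mat n n"
  "R0 \<in> carrier_mat m m" "\<Gamma> \<in> carrier_mat n m"
proof -
  show p: "P1 \<in> carrier_mat n n" "P2 \<in> carrier_mat n n"
    unfolding P1_def P2_def by (rule ctrl_gram_carrier[OF Ac])+
  show n: "N \<in> carrier_mat n n" unfolding N_def by (rule minus_carrier_mat[OF p(2)])
  show "R0 \<in> carrier_mat m m" "\<Gamma> \<in> carrier_mat n m"
    using n C D2 B2 Ac by (auto simp: R0_def \<Gamma>_def)
qed

lemmas dims = carrier_matD[OF Ac] carrier_matD[OF B1] carrier_matD[OF B2] carrier_matD[OF C]
  carrier_matD[OF D1] carrier_matD[OF D2] carrier_matD[OF carriers(1)] carrier_matD[OF carriers(2)]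
  carrier_matD[OF carriers(3)] carrier_matD[OF carriers(4)] carrier_matD[OF carriers(5)]

lemma herms: "herm P1" "herm P2" "herm N" "herm R0"
proof -
  show p: "herm P1" "herm P2" unfolding P1_def P2_def by (rule ctrl_gram_psd[OF A B1] ctrl_gram_psd[OF A B2])+
  thus n: "herm N" by (simp add: herm_def N_def adjoint_diff dims)
  have "mat_adjoint (C * N * mat_adjoint C) = C * N * mat_adjoint C"
  proof -
    have "mat_adjoint (C * N * mat_adjoint C) = C * (N * mat_adjoint C)"
      using n by (simp add: adjoint_mult dims herm_def)
    thus ?thesis using assoc_mult_mat[OF C carriers(3) adjoint_carrier[OF C]] by simp
  qed
  thus "herm R0" by (simp add: herm_def R0_def adjoint_add adjoint_diff adjoint_mult dims)
qed

text \<open>The balances of \<open>G\<close> and \<open>K\<close> share the same costate, so they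
  can be subtracted; the coefficients left over are exactly \<open>R0\<close> and \<Gamma>, and
  \<open>N\<close> is the difference of the storages.\<close>

lemma energy:
  assumes u: "dim_vec u = m" and s': "dim_vec s' = n" and s: "s = mat_adjoint C *\<^sub>v u + mat_adjoint A *\<^sub>v s'"
  shows "vnorm2 (mat_adjoint D1 *\<^sub>v u + mat_adjoint B1 *\<^sub>v s') - vnorm2 (mat_adjoint D2 *\<^sub>v u + mat_adjoint B2 *\<^sub>v s')
    = \<phi> u s' + Re (inn (N *\<^sub>v s') s') - Re (inn (N *\<^sub>v s) s)"
proof -
  note ds = dims u s'
  have dsx: "dim_vec s = n" by (simp add: s dims)
  have 1: "P1 = B1 * mat_adjoint B1 + A * P1 * mat_adjoint A" unfolding P1_def by (rule ctrl_gram_lyapunov[OF A B1])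
  have 2: "P2 = B2 * mat_adjoint B2 + A * P2 * mat_adjoint A" unfolding P2_def by (rule ctrl_gram_lyapunov[OF A B2])
  have R0v: "inn (R0 *\<^sub>v u) u = inn ((D1 * mat_adjoint D1 + C * P1 * mat_adjoint C) *\<^sub>v u) u
     - inn ((D2 * mat_adjoint D2 + C * P2 * mat_adjoint C) *\<^sub>v u) u"
    by (simp add: R0_def N_def mvs inns ds)
  have Gv: "inn (\<Gamma> *\<^sub>v u) s' = inn ((B1 * mat_adjoint D1 + A * P1 * mat_adjoint C) *\<^sub>v u) s'
     - inn ((B2 * mat_adjoint D2 + A * P2 * mat_adjoint C) *\<^sub>v u) s'"
    by (simp add: \<Gamma>_def N_def mvs inns ds)
  have Nv: "inn (N *\<^sub>v x) x = inn (P1 *\<^sub>v x) x - inn (P2 *\<^sub>v x) x" if "dim_vec x = n" for x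
    by (simp add: N_def mvs inns ds that)
  show ?thesis
    unfolding anticausal_energy[OF Ac B1 C D1 carriers(1) herms(1) 1 u s' s]
      anticausal_energy[OF Ac B2 C D2 carriers(2) herms(2) 2 u s' s]
      \<phi>_def R0v Gv Nv[OF s'] Nv[OF dsx] by simp
qed

lemma dim_bs [simp]: "dim_vec (costate y j) = n"
  by (simp add: costate_def dims)

lemma costate_step: "vbounded m y \<Longrightarrow> costate y j = mat_adjoint C *\<^sub>v y j + mat_adjoint A *\<^sub>v costate y (Suc j)"
  unfolding costate_def by (rule bwd_state_step[OF As adjoint_carrier[OF C]])

text \<open>Summing the one-step balance telescopes the \<open>N\<close>-terms. The one at the far
  end tends to 0 because the costate is square summable; the one at time 0 is the difference between
  \<open>quad\<close> and the form of \<open>T_R\<close>.\<close>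

lemma quad_limit:
  assumes y: "ell2 m y"
  shows "\<exists>S. quad y = of_real S \<and>
    (\<lambda>k. \<Sum>j<k. \<phi> (y j) (costate y (Suc j))) \<longlonglongrightarrow> S + Re (inn (N *\<^sub>v costate y 0) (costate y 0))"
proof -
  note yb = ell2_imp_vbounded[OF y]
  have dy: "dim_vec (y j) = m" for j using y by (auto simp: ell2_def)
  have GO: "G (cis t) = realiz D1 C A B1 (cis t)" "K (cis t) = realiz D2 C A B2 (cis t)" for t
    by (auto simp: G_def K_def)
  define a where "a j = vnorm2 (toeplitz_adj m p G y j)" for j
  define b where "b j = vnorm2 (toeplitz_adj m q K y j)" for j
  note s1 = sums_toeplitz_square[OF A B1 C D1 GO(1) y, folded a_def]
  note s2 = sums_toeplitz_square[OF A B2 C D2 GO(2) y, folded b_def]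
  define S where "S = suminf a - suminf b"
  have "(\<lambda>i. inn (toeplitz m p G (toeplitz_adj m p G y) i - toeplitz m q K (toeplitz_adj m q K y) i) (y i))
     = (\<lambda>i. inn (toeplitz m p G (toeplitz_adj m p G y) i) (y i) - inn (toeplitz m q K (toeplitz_adj m q K y) i) (y i))"
    by (rule ext) (simp add: inn_diff_left toeplitz_def dy)
  hence "quad y = (\<Sum>i. inn (toeplitz m p G (toeplitz_adj m p G y) i) (y i) - inn (toeplitz m q K (toeplitz_adj m q K y) i) (y i))"
    by (simp add: quad_def ell2_inner_def inn_def)
  also have "\<dots> = of_real S"
    using sums_diff[OF s1(1) s2(1)] by (simp add: S_def sums_iff)
  finally have q: "quad y = of_real S" .
  have e: "(\<Sum>j<k. \<phi> (y j) (costate y (Suc j))) = (\<Sum>j<k. a j - b j) - Re (inn (N *\<^sub>v costate y k) (costate y k)) + Re (inn (N *\<^sub>v costate y 0) (costate y 0))" for k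
  proof (induction k)
    case (Suc k)
    have "a k - b k = \<phi> (y k) (costate y (Suc k)) + Re (inn (N *\<^sub>v costate y (Suc k)) (costate y (Suc k))) - Re (inn (N *\<^sub>v costate y k) (costate y k))"
      unfolding a_def b_def toeplitz_adj_realiz[OF A B1 C D1 GO(1) yb] toeplitz_adj_realiz[OF A B2 C D2 GO(2) yb] costate_def[symmetric]
      by (rule energy[OF dy dim_bs costate_step[OF yb]])
    thus ?case using Suc by simp
  qed simp
  have l1: "(\<lambda>k. \<Sum>j<k. a j - b j) \<longlonglongrightarrow> S"
    using sums_diff[OF summable_sums[OF s1(2)] summable_sums[OF s2(2)]] by (simp add: sums_def S_def)
  have bl: "ell2 n (costate y)" unfolding costate_def by (rule bwd_state_ell2[OF As adjoint_carrier[OF C] y])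
  from ell2_imp_vbounded[OF ell2_mv[OF bl carriers(3)]] obtain X where X: "\<And>i. nrm (N *\<^sub>v costate y i) \<le> X"
    by (auto simp: vbounded_def)
  have "(\<lambda>k. inn (N *\<^sub>v costate y k) (costate y k)) \<longlonglongrightarrow> 0"
    by (rule tendsto_inn_0[OF _ dim_bs X ell2_tendsto_0[OF bl]]) (simp add: dims)
  hence l2: "(\<lambda>k. Re (inn (N *\<^sub>v costate y k) (costate y k))) \<longlonglongrightarrow> 0" using tendsto_Re by fastforce
  have "(\<lambda>k. \<Sum>j<k. \<phi> (y j) (costate y (Suc j))) \<longlonglongrightarrow> S - 0 + Re (inn (N *\<^sub>v costate y 0) (costate y 0))"
    unfolding e by (intro tendsto_intros l1 l2)
  thus ?thesis using q by auto
qed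

lemma R_carrier: "cmod z \<le> 1 \<Longrightarrow> R z \<in> carrier_mat m m"
  using realiz_mv(2)[OF A _ B1 C D1, of z "0\<^sub>v p"] realiz_mv(2)[OF A _ B2 C D2, of z "0\<^sub>v q"]
  by (auto simp: R_def G_def K_def)

text \<open>The one-step balance at the stationary costate, where the next state is the current one
  times a number of modulus 1. Both have the same \<open>N\<close>-term, so the storages
  cancel.\<close>

lemma R_form:
  assumes z: "cmod z = 1" and v: "dim_vec v = m"
  shows "inn (R z *\<^sub>v v) v = of_real (Re (inn (R0 *\<^sub>v v) v) + 2 * Re (inn (z \<cdot>\<^sub>v (C *\<^sub>v (resolv n A z *\<^sub>v (\<Gamma> *\<^sub>v v)))) v))"
proof -
  have z1: "cmod z \<le> 1" using z by simp
  note X = resolv(1)[OF A z1]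
  note ds = dims carrier_matD[OF X] v
  have Gc: "G z \<in> carrier_mat m p" "K z \<in> carrier_mat m q"
    unfolding G_def K_def using realiz_mv(2)[OF A z1 B1 C D1, of "0\<^sub>v p"] realiz_mv(2)[OF A z1 B2 C D2, of "0\<^sub>v q"] by auto
  define s where "s = mat_adjoint (resolv n A z) *\<^sub>v (mat_adjoint C *\<^sub>v v)"
  have s: "dim_vec s = n" by (simp add: s_def ds)
  have step: "s = mat_adjoint C *\<^sub>v v + mat_adjoint A *\<^sub>v (cnj z \<cdot>\<^sub>v s)"
    unfolding s_def by (rule resolv_adjoint[OF A z1]) (simp add: ds)
  have adj: "mat_adjoint (realiz D C A B z) *\<^sub>v v = mat_adjoint D *\<^sub>v v + mat_adjoint B *\<^sub>v (cnj z \<cdot>\<^sub>v s)"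
    if "B \<in> carrier_mat n k" "D \<in> carrier_mat m k" for B D k
  proof -
    have "realiz D C A B z = D + z \<cdot>\<^sub>m (C * resolv n A z * B)" by (simp add: realiz_def resolv_def dims)
    thus ?thesis using that by (simp add: adjoint_add adjoint_smult adjoint_mult mvs ds s_def)
  qed
  have zz: "z * cnj z = 1" using z by (simp add: complex_norm_square[symmetric])
  have Nz: "inn (N *\<^sub>v (cnj z \<cdot>\<^sub>v s)) (cnj z \<cdot>\<^sub>v s) = inn (N *\<^sub>v s) s"
  proof -
    have "inn (N *\<^sub>v (cnj z \<cdot>\<^sub>v s)) (cnj z \<cdot>\<^sub>v s) = (z * cnj z) * inn (N *\<^sub>v s) s"
      by (simp add: mvs inns ds s)
    thus ?thesis by (simp add: zz)
  qed
  have "inn (\<Gamma> *\<^sub>v v) (cnj z \<cdot>\<^sub>v s) = inn (z \<cdot>\<^sub>v (C *\<^sub>v (resolv n A z *\<^sub>v (\<Gamma> *\<^sub>v v)))) v"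
    by (simp add: inns inn_mv[of C] inn_mv[of "resolv n A z"] ds s_def)
  hence \<phi>: "\<phi> v (cnj z \<cdot>\<^sub>v s) = Re (inn (R0 *\<^sub>v v) v) + 2 * Re (inn (z \<cdot>\<^sub>v (C *\<^sub>v (resolv n A z *\<^sub>v (\<Gamma> *\<^sub>v v)))) v)"
    by (simp add: \<phi>_def)
  have "inn (R z *\<^sub>v v) v = of_real (vnorm2 (mat_adjoint (G z) *\<^sub>v v) - vnorm2 (mat_adjoint (K z) *\<^sub>v v))"
    using carrier_matD[OF Gc(1)] carrier_matD[OF Gc(2)] v
    by (simp add: R_def mvs inns inn_mv[of "G z"] inn_mv[of "K z"] inn_self)
  also have "vnorm2 (mat_adjoint (G z) *\<^sub>v v) - vnorm2 (mat_adjoint (K z) *\<^sub>v v) = \<phi> v (cnj z \<cdot>\<^sub>v s)"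
    unfolding G_def K_def adj[OF B1 D1] adj[OF B2 D2]
    using energy[OF v _ step] by (simp add: s Nz)
  finally show ?thesis unfolding \<phi> .
qed

text \<open>Spectral factor candidates: \<open>F0\<close> is \<open>\<Phi>(0)\<close> and \<open>CF\<close> is \<open>C\<^sub>\<Phi>\<close>.\<close>

definition Qg where "Qg CF = obs_gram CF A"
text \<open>\<open>R0'\<close> and \<open>C'\<close> are what \<open>R0\<close> and \<open>C\<close>
  become when the symbol is computed as \<open>\<Phi>^* \<Phi>\<close>: on the circle this product
  has constant coefficient \<open>R0'\<close> and causal part
  \<open>z C' (1 - z A)^-1 \<Gamma>\<close>.\<close>

definition R0' where "R0' F0 CF = mat_adjoint F0 * F0 + mat_adjoint \<Gamma> * Qg CF * \<Gamma>"
definition C' where "C' F0 CF = mat_adjoint F0 * CF + mat_adjoint \<Gamma> * Qg CF * A"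

context
  fixes r :: nat and F0 CF :: "complex mat"
  assumes F0: "F0 \<in> carrier_mat r m" and CF: "CF \<in> carrier_mat r n"
begin

lemma Qg_props: "Qg CF \<in> carrier_mat n n" "herm (Qg CF)" "dim_vec x = n \<Longrightarrow> 0 \<le> Re (inn (Qg CF *\<^sub>v x) x)"
  "Qg CF = mat_adjoint CF * CF + mat_adjoint A * Qg CF * A"
  unfolding Qg_def obs_gram_eq[OF Ac]
  using ctrl_gram_carrier[OF adjoint_carrier[OF Ac]] ctrl_gram_psd[OF As adjoint_carrier[OF CF]]
    ctrl_gram_lyapunov[OF As adjoint_carrier[OF CF]] by auto

lemmas Fdims = dims carrier_matD[OF F0] carrier_matD[OF CF] carrier_matD[OF Qg_props(1)]

lemma C'_carrier: "C' F0 CF \<in> carrier_mat m n" "R0' F0 CF \<in> carrier_mat m m"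
  by (auto simp: C'_def R0'_def Fdims intro!: carrier_matI)

lemma R0'_herm: "herm (R0' F0 CF)"
proof -
  have "mat_adjoint (mat_adjoint \<Gamma> * Qg CF * \<Gamma>) = mat_adjoint \<Gamma> * Qg CF * \<Gamma>"
  proof -
    have "mat_adjoint (mat_adjoint \<Gamma> * Qg CF * \<Gamma>) = mat_adjoint \<Gamma> * (Qg CF * \<Gamma>)"
      using Qg_props(2) by (simp add: adjoint_mult Fdims herm_def)
    thus ?thesis using assoc_mult_mat[OF adjoint_carrier[OF carriers(5)] Qg_props(1) carriers(5)] by simp
  qed
  thus ?thesis by (simp add: herm_def R0'_def adjoint_add adjoint_mult Fdims)
qed

lemma output_energy:
  assumes y: "dim_vec y = m" and x: "dim_vec x = n" and x': "x' = A *\<^sub>v x + \<Gamma> *\<^sub>v y"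
  shows "vnorm2 (F0 *\<^sub>v y + CF *\<^sub>v x) = Re (inn (R0' F0 CF *\<^sub>v y) y) + 2 * Re (inn (C' F0 CF *\<^sub>v x) y)
      + Re (inn (Qg CF *\<^sub>v x) x) - Re (inn (Qg CF *\<^sub>v x') x')"
  unfolding R0'_def C'_def
  by (rule causal_energy[OF Ac carriers(5) CF F0 Qg_props(1,2,4) y x x'])

text \<open>The causal balance at a stationary state: \<open>z w\<close> is followed by
  \<open>w\<close>, and for \<open>|z| = 1\<close> the \<open>Q\<close>-terms of the two
  cancel.\<close>

lemma factor_form:
  assumes z: "cmod z = 1" and v: "dim_vec v = m"
  shows "vnorm2 (realiz F0 CF A \<Gamma> z *\<^sub>v v)
    = Re (inn (R0' F0 CF *\<^sub>v v) v) + 2 * Re (inn (z \<cdot>\<^sub>v (C' F0 CF *\<^sub>v (resolv n A z *\<^sub>v (\<Gamma> *\<^sub>v v)))) v)"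
proof -
  have z1: "cmod z \<le> 1" using z by simp
  note X = resolv(1)[OF A z1]
  note ds = Fdims carrier_matD[OF X] v carrier_matD[OF C'_carrier(1)]
  define w where "w = resolv n A z *\<^sub>v (\<Gamma> *\<^sub>v v)"
  have w: "dim_vec w = n" by (simp add: w_def ds)
  have wz: "w = A *\<^sub>v (z \<cdot>\<^sub>v w) + \<Gamma> *\<^sub>v v"
  proof -
    have "w = \<Gamma> *\<^sub>v v + z \<cdot>\<^sub>v (A *\<^sub>v w)" unfolding w_def by (rule resolv(2)[OF A z1]) (simp add: ds)
    also have "\<dots> = A *\<^sub>v (z \<cdot>\<^sub>v w) + \<Gamma> *\<^sub>v v"
      using ds w by (simp add: mv_smult) (intro eq_vecI; simp)
    finally show ?thesis .
  qed
  have zz: "z * cnj z = 1" using z by (simp add: complex_norm_square[symmetric])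
  have Qz: "inn (Qg CF *\<^sub>v (z \<cdot>\<^sub>v w)) (z \<cdot>\<^sub>v w) = inn (Qg CF *\<^sub>v w) w"
  proof -
    have "inn (Qg CF *\<^sub>v (z \<cdot>\<^sub>v w)) (z \<cdot>\<^sub>v w) = (z * cnj z) * inn (Qg CF *\<^sub>v w) w"
      by (simp add: mvs inns ds w)
    thus ?thesis by (simp add: zz)
  qed
  have "realiz F0 CF A \<Gamma> z *\<^sub>v v = F0 *\<^sub>v v + CF *\<^sub>v (z \<cdot>\<^sub>v w)"
    unfolding realiz_mv(1)[OF A z1 carriers(5) CF F0 v] w_def using ds by (simp add: mv_smult)
  moreover have "vnorm2 (F0 *\<^sub>v v + CF *\<^sub>v (z \<cdot>\<^sub>v w))
      = Re (inn (R0' F0 CF *\<^sub>v v) v) + 2 * Re (inn (C' F0 CF *\<^sub>v (z \<cdot>\<^sub>v w)) v)"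
    using output_energy[OF v _ wz] w unfolding Qz by simp
  moreover have "C' F0 CF *\<^sub>v (z \<cdot>\<^sub>v w) = z \<cdot>\<^sub>v (C' F0 CF *\<^sub>v w)" using ds w by (simp add: mv_smult)
  ultimately show ?thesis by (simp only: w_def)
qed

lemma R_eq_factor_iff:
  assumes z: "cmod z = 1"
  shows "R z = mat_adjoint (realiz F0 CF A \<Gamma> z) * realiz F0 CF A \<Gamma> z \<longleftrightarrow>
    (\<forall>v\<in>carrier_vec m. Re (inn (R0 *\<^sub>v v) v) + 2 * Re (inn (z \<cdot>\<^sub>v (C *\<^sub>v (resolv n A z *\<^sub>v (\<Gamma> *\<^sub>v v)))) v)
      = Re (inn (R0' F0 CF *\<^sub>v v) v) + 2 * Re (inn (z \<cdot>\<^sub>v (C' F0 CF *\<^sub>v (resolv n A z *\<^sub>v (\<Gamma> *\<^sub>v v)))) v))"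
    (is "_ = ?M \<longleftrightarrow> _")
proof -
  have z1: "cmod z \<le> 1" using z by simp
  have Ph: "realiz F0 CF A \<Gamma> z \<in> carrier_mat r m"
    by (rule realiz_mv(2)[OF A z1 carriers(5) CF F0, of "0\<^sub>v m"]) simp
  have Mc: "?M \<in> carrier_mat m m" using Ph by auto
  have f: "inn (?M *\<^sub>v v) v = of_real (vnorm2 (realiz F0 CF A \<Gamma> z *\<^sub>v v))" if "dim_vec v = m" for v
    using carrier_matD[OF Ph] that
    by (simp add: mv_assoc inn_mv[of "mat_adjoint (realiz F0 CF A \<Gamma> z)"] inn_self)
  have "R z = ?M \<longleftrightarrow> (\<forall>v\<in>carrier_vec m. inn (R z *\<^sub>v v) v = inn (?M *\<^sub>v v) v)"
    using mat_eqI_form[OF R_carrier[OF z1] Mc] by auto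
  also have "\<dots> \<longleftrightarrow> (\<forall>v\<in>carrier_vec m. Re (inn (R0 *\<^sub>v v) v) + 2 * Re (inn (z \<cdot>\<^sub>v (C *\<^sub>v (resolv n A z *\<^sub>v (\<Gamma> *\<^sub>v v)))) v)
      = Re (inn (R0' F0 CF *\<^sub>v v) v) + 2 * Re (inn (z \<cdot>\<^sub>v (C' F0 CF *\<^sub>v (resolv n A z *\<^sub>v (\<Gamma> *\<^sub>v v)))) v))"
    by (intro ball_cong refl) (simp only: R_form[OF z] f factor_form[OF z] carrier_vecD of_real_eq_iff)
  finally show ?thesis .
qed

text \<open>The difference of the two symbols is twice the real part of a single realization, so
  uniqueness of coefficients applies to its form at every \<open>v\<close>. It yields agreement of
  \<open>C\<close> and \<open>C'\<close> on all \<open>A^j \<Gamma> u\<close>, which need not span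
  the whole space.\<close>

lemma factor_imp_coeffs:
  assumes R: "\<And>z. cmod z = 1 \<Longrightarrow> R z = mat_adjoint (realiz F0 CF A \<Gamma> z) * realiz F0 CF A \<Gamma> z"
  shows "R0 = R0' F0 CF" "dim_vec u = m \<Longrightarrow> C *\<^sub>v (A ^\<^sub>m j *\<^sub>v (\<Gamma> *\<^sub>v u)) = C' F0 CF *\<^sub>v (A ^\<^sub>m j *\<^sub>v (\<Gamma> *\<^sub>v u))"
proof -
  \<comment> \<open>The constant term is halved because the real part of the whole series is
    doubled.\<close>
  define D where "D = (1/2) \<cdot>\<^sub>m (R0 - R0' F0 CF)"
  define E where "E = C - C' F0 CF"
  note ds = Fdims carrier_matD[OF C'_carrier(1)] carrier_matD[OF C'_carrier(2)]
  have D: "D \<in> carrier_mat m m" using C'_carrier by (auto simp: D_def)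
  have E: "E \<in> carrier_mat m n" using C'_carrier by (auto simp: E_def)
  have Re0: "Re (inn (realiz D E A \<Gamma> z *\<^sub>v v) v) = 0" if z: "cmod z = 1" and v: "v \<in> carrier_vec m" for z v
  proof -
    have z1: "cmod z \<le> 1" using z by simp
    note X = resolv(1)[OF A z1]
    have dv: "dim_vec v = m" using v by simp
    have "inn (realiz D E A \<Gamma> z *\<^sub>v v) v = (1/2) * (inn (R0 *\<^sub>v v) v - inn (R0' F0 CF *\<^sub>v v) v)
       + (inn (z \<cdot>\<^sub>v (C *\<^sub>v (resolv n A z *\<^sub>v (\<Gamma> *\<^sub>v v)))) v - inn (z \<cdot>\<^sub>v (C' F0 CF *\<^sub>v (resolv n A z *\<^sub>v (\<Gamma> *\<^sub>v v)))) v)"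
      unfolding realiz_mv(1)[OF A z1 carriers(5) E D dv]
      using ds dv carrier_matD[OF X] by (simp add: D_def E_def mvs inns right_diff_distrib)
    hence "2 * Re (inn (realiz D E A \<Gamma> z *\<^sub>v v) v) = (Re (inn (R0 *\<^sub>v v) v) - Re (inn (R0' F0 CF *\<^sub>v v) v))
       + 2 * (Re (inn (z \<cdot>\<^sub>v (C *\<^sub>v (resolv n A z *\<^sub>v (\<Gamma> *\<^sub>v v)))) v) - Re (inn (z \<cdot>\<^sub>v (C' F0 CF *\<^sub>v (resolv n A z *\<^sub>v (\<Gamma> *\<^sub>v v)))) v))"
      by simp
    thus ?thesis using R_eq_factor_iff[OF z] R[OF z] v by fastforce
  qed
  have key: "Re (inn (D *\<^sub>v v) v) = 0 \<and> (\<forall>j. inn ((E * A ^\<^sub>m j * \<Gamma>) *\<^sub>v v) v = 0)" if v: "v \<in> carrier_vec m" for v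
  proof -
    have dv: "dim_vec v = m" using v by simp
    note S = realiz_form_series[OF A carriers(5) E D dv dv]
    have "Re (\<Sum>j. inn (markov D E A \<Gamma> j *\<^sub>v v) v * cis t ^ j) = 0" for t
      using Re0[of "cis t" v] v by (simp add: S(2))
    note P = power_series_Re_zero_on_circle[OF S(1) this]
    have "Re (inn (D *\<^sub>v v) v) = 0" using P(1) by (simp add: markov_def)
    moreover have "inn ((E * A ^\<^sub>m j * \<Gamma>) *\<^sub>v v) v = 0" for j using P(2)[of "Suc j"] by (simp add: markov_def)
    ultimately show ?thesis by simp
  qed
  show "R0 = R0' F0 CF"
  proof (rule mat_eqI_form[OF carriers(4) C'_carrier(2)])
    fix v :: "complex vec" assume v: "v \<in> carrier_vec m"
    have "Re (inn (R0 *\<^sub>v v) v) = Re (inn (R0' F0 CF *\<^sub>v v) v)"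
      using key[OF v] ds v by (simp add: D_def mvs inns)
    thus "inn (R0 *\<^sub>v v) v = inn (R0' F0 CF *\<^sub>v v) v"
      using herm_form_real[OF herms(4) carriers(4) v] herm_form_real[OF R0'_herm C'_carrier(2) v] by metis
  qed
  assume u: "dim_vec u = m"
  have "E * A ^\<^sub>m j * \<Gamma> = 0\<^sub>m m m"
    by (rule form_zero_imp_zero_mat) (use key E Ac carriers in auto)
  hence "(E * A ^\<^sub>m j * \<Gamma>) *\<^sub>v u = 0\<^sub>v m" using u by simp
  hence "C *\<^sub>v (A ^\<^sub>m j *\<^sub>v (\<Gamma> *\<^sub>v u)) - C' F0 CF *\<^sub>v (A ^\<^sub>m j *\<^sub>v (\<Gamma> *\<^sub>v u)) = 0\<^sub>v m"
    using ds u Ac by (simp add: E_def mvs)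
  hence *: "(C *\<^sub>v (A ^\<^sub>m j *\<^sub>v (\<Gamma> *\<^sub>v u))) $ i - (C' F0 CF *\<^sub>v (A ^\<^sub>m j *\<^sub>v (\<Gamma> *\<^sub>v u))) $ i = 0" if "i < m" for i
    using that ds by (metis dim_mv index_minus_vec(1) index_zero_vec(1))
  show "C *\<^sub>v (A ^\<^sub>m j *\<^sub>v (\<Gamma> *\<^sub>v u)) = C' F0 CF *\<^sub>v (A ^\<^sub>m j *\<^sub>v (\<Gamma> *\<^sub>v u))"
    by (rule eq_vecI) (use * ds in \<open>auto simp del: index_mult_mat_vec\<close>)
qed

text \<open>The output energy of the factor equals, up to its storage, the form with
  \<open>C' \<xi>\<close> in place of \<open>C \<xi>\<close>. The hypotheses on \<open>x\<close> and
  on the range of \<Gamma> keep the trajectory where both agree, and duality then turns the sum into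
  the form of \<open>T_R\<close> plus boundary terms.\<close>

lemma quad_lower_bound:
  assumes R: "R0 = R0' F0 CF" and c\<Gamma>: "\<And>u j. dim_vec u = m \<Longrightarrow> C *\<^sub>v (A ^\<^sub>m j *\<^sub>v (\<Gamma> *\<^sub>v u)) = C' F0 CF *\<^sub>v (A ^\<^sub>m j *\<^sub>v (\<Gamma> *\<^sub>v u))"
    and x: "dim_vec x = n" and cx: "\<And>j. C *\<^sub>v (A ^\<^sub>m j *\<^sub>v x) = C' F0 CF *\<^sub>v (A ^\<^sub>m j *\<^sub>v x)"
    and y: "ell2 m y" and q: "quad y = of_real S"
  shows "S \<ge> 2 * Re (inn x (costate y 0)) - Re (inn (Qg CF *\<^sub>v x) x) - Re (inn (N *\<^sub>v costate y 0) (costate y 0))"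
proof -
  note yb = ell2_imp_vbounded[OF y]
  have dy: "dim_vec (y j) = m" for j using y by (auto simp: ell2_def)
  \<comment> \<open>With the minus sign the boundary term at time 0 becomes
    \<open>+ 2 Re <x, s_0>\<close> in the lower bound.\<close>
  define x0 where "x0 = (-1) \<cdot>\<^sub>v x"
  have x0: "dim_vec x0 = n" by (simp add: x0_def x)
  define \<xi> where "\<xi> = fwd_state A \<Gamma> x0 y"
  have d\<xi>: "dim_vec (\<xi> i) = n" for i unfolding \<xi>_def by (rule dim_fwd_state[OF Ac carriers(5) x0])
  note ds = Fdims carrier_matD[OF C'_carrier(1)] dy d\<xi> x x0
  \<comment> \<open>The claim is proved for all powers \<open>A^j\<close> at once, since a time step
    replaces \<open>A^j\<close> by the next power.\<close>
  have c\<xi>: "C *\<^sub>v (A ^\<^sub>m j *\<^sub>v \<xi> i) = C' F0 CF *\<^sub>v (A ^\<^sub>m j *\<^sub>v \<xi> i)" for i j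
  proof (induction i arbitrary: j)
    case 0
    show ?case using cx[of j] Ac by (simp add: \<xi>_def x0_def mvs ds)
  next
    case (Suc i)
    have e: "A ^\<^sub>m j *\<^sub>v \<xi> (Suc i) = A ^\<^sub>m Suc j *\<^sub>v \<xi> i + A ^\<^sub>m j *\<^sub>v (\<Gamma> *\<^sub>v y i)"
      unfolding pow_mv_Suc(1)[OF Ac d\<xi>] using Ac ds d\<xi>[of i] by (simp add: \<xi>_def mv_add)
    show ?case unfolding e using Suc[of "Suc j"] c\<Gamma>[OF dy, of j i] Ac by (simp add: mv_add ds del: pow_mat.simps)
  qed
  have c0: "C *\<^sub>v \<xi> i = C' F0 CF *\<^sub>v \<xi> i" for i using c\<xi>[of 0 i] Ac by (simp add: ds)
  define w where "w k = Re (inn (\<xi> k) (costate y k))" for k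
  have sumv: "(\<Sum>i<k. vnorm2 (F0 *\<^sub>v y i + CF *\<^sub>v \<xi> i)) = (\<Sum>i<k. Re (inn (R0 *\<^sub>v y i) (y i)) + 2 * Re (inn (C *\<^sub>v \<xi> i) (y i)))
     + Re (inn (Qg CF *\<^sub>v x0) x0) - Re (inn (Qg CF *\<^sub>v \<xi> k) (\<xi> k))" for k
  proof (induction k)
    case (Suc k)
    have "\<xi> (Suc k) = A *\<^sub>v \<xi> k + \<Gamma> *\<^sub>v y k" by (simp add: \<xi>_def)
    from output_energy[OF dy d\<xi> this] Suc show ?case by (simp add: R c0)
  qed (simp add: \<xi>_def)
  have dual: "(\<Sum>i<k. Re (inn (C *\<^sub>v \<xi> i) (y i))) = (\<Sum>i<k. Re (inn (\<Gamma> *\<^sub>v y i) (costate y (Suc i)))) + Re (inn x0 (costate y 0)) - w k" for k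
    using arg_cong[OF state_duality_sum[OF A carriers(5) C dy yb x0, where N = k], of Re]
    by (simp add: \<xi>_def costate_def w_def)
  have le: "(\<Sum>j<k. \<phi> (y j) (costate y (Suc j))) \<ge> 2 * w k - 2 * Re (inn x0 (costate y 0)) - Re (inn (Qg CF *\<^sub>v x0) x0)" for k
  proof -
    have "(\<Sum>j<k. \<phi> (y j) (costate y (Suc j))) = (\<Sum>i<k. Re (inn (R0 *\<^sub>v y i) (y i))) + 2 * (\<Sum>i<k. Re (inn (\<Gamma> *\<^sub>v y i) (costate y (Suc i))))"
      by (simp add: \<phi>_def sum.distrib sum_distrib_left)
    moreover have "0 \<le> (\<Sum>i<k. vnorm2 (F0 *\<^sub>v y i + CF *\<^sub>v \<xi> i))" by (intro sum_nonneg) auto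
    moreover have "0 \<le> Re (inn (Qg CF *\<^sub>v \<xi> k) (\<xi> k))" by (rule Qg_props(3)[OF d\<xi>])
    ultimately show ?thesis unfolding sumv sum.distrib sum_distrib_left[symmetric] dual by simp
  qed
  obtain X where X: "\<And>i. nrm (\<xi> i) \<le> X"
    using fwd_state_bounded[OF A carriers(5) yb x0] by (auto simp: \<xi>_def)
  have bl: "ell2 n (costate y)" unfolding costate_def by (rule bwd_state_ell2[OF As adjoint_carrier[OF C] y])
  have "(\<lambda>k. inn (\<xi> k) (costate y k)) \<longlonglongrightarrow> 0" by (rule tendsto_inn_0[OF d\<xi> dim_bs X ell2_tendsto_0[OF bl]])
  hence w0: "w \<longlonglongrightarrow> 0" unfolding w_def using tendsto_Re by fastforce
  obtain S' where S': "quad y = of_real S'"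
    "(\<lambda>k. \<Sum>j<k. \<phi> (y j) (costate y (Suc j))) \<longlonglongrightarrow> S' + Re (inn (N *\<^sub>v costate y 0) (costate y 0))"
    using quad_limit[OF y] by blast
  have SS: "S' = S" using S'(1) q by simp
  have "S' + Re (inn (N *\<^sub>v costate y 0) (costate y 0)) \<ge> 2 * 0 - 2 * Re (inn x0 (costate y 0)) - Re (inn (Qg CF *\<^sub>v x0) x0)"
  proof (rule tendsto_le[OF _ S'(2)])
    show "(\<lambda>k. 2 * w k - 2 * Re (inn x0 (costate y 0)) - Re (inn (Qg CF *\<^sub>v x0) x0))
        \<longlonglongrightarrow> 2 * 0 - 2 * Re (inn x0 (costate y 0)) - Re (inn (Qg CF *\<^sub>v x0) x0)"
      by (intro tendsto_intros w0)
  qed (use le in auto)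
  thus ?thesis unfolding SS by (simp add: x0_def mvs inns ds)
qed

end

end

section \<open>Factorization from a Bellman equation\<close>

text \<open>Scaling test: a linear function of \<open>t\<close> that is bounded above on all of the
  complex plane vanishes. It shows orthogonality to the kernel of \<open>L\<close> in two
  places.\<close>

lemma Re_mult_bounded_imp_zero:
  fixes g :: complex
  assumes "\<And>t. Re (t * g) \<le> K"
  shows "g = 0"
proof (rule ccontr)
  assume g: "g \<noteq> 0"
  have "Re ((of_real (\<bar>K\<bar> + 1) / g) * g) \<le> K" by (rule assms)
  thus False using g by simp
qed

lemma two_Re_inn_le: "dim_vec a = dim_vec b \<Longrightarrow> 2 * Re (inn a b) \<le> vnorm2 a + vnorm2 b"
proof -
  assume d: "dim_vec a = dim_vec b"
  have "vnorm2 (a - b) = vnorm2 a + vnorm2 b - 2 * Re (inn a b)"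
    using d Re_inn_commute[OF d] by (simp add: vnorm2_Re inns)
  thus ?thesis using vnorm2_nonneg[of "a - b"] by linarith
qed

lemma add_zero_vec [simp]: "dim_vec v = k \<Longrightarrow> 0\<^sub>v k + v = v" "dim_vec v = k \<Longrightarrow> v + 0\<^sub>v k = v"
  for v :: "complex vec"
  by auto

lemma vec_diff_zero_iff: "dim_vec a = k \<Longrightarrow> dim_vec b = k \<Longrightarrow> a - b = 0\<^sub>v k \<longleftrightarrow> a = b" for a b :: "complex vec"
  by (auto simp: vec_eq_iff)

text \<open>The value \<open>|L x|\<^sup>2\<close> satisfies a Bellman inequality that is asymptotically an equality. After
  completing squares this says that the row \<open>[Y A2]\<close> is a coisometry.\<close>

lemma bellman_factorization:
  fixes A C \<Gamma> R0 L L' :: "complex mat"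
  assumes A: "A \<in> carrier_mat n n" and C: "C \<in> carrier_mat m n" and G: "\<Gamma> \<in> carrier_mat n m"
    and R0: "R0 \<in> carrier_mat m m" and hR: "herm R0"
    and L: "L \<in> carrier_mat k n" and L': "L' \<in> carrier_mat n k" and LL: "L * L' = 1\<^sub>m k"
    and le0: "\<forall>u x. dim_vec u = m \<longrightarrow> dim_vec x = n \<longrightarrow> vnorm2 (L *\<^sub>v (mat_adjoint C *\<^sub>v u + mat_adjoint A *\<^sub>v x))
        \<le> Re (inn (R0 *\<^sub>v u) u) + 2 * Re (inn (\<Gamma> *\<^sub>v u) x) + vnorm2 (L *\<^sub>v x)"
    and eq0: "\<forall>y \<epsilon>. dim_vec y = n \<longrightarrow> 0 < \<epsilon> \<longrightarrow> (\<exists>u x. dim_vec u = m \<and> dim_vec x = n \<and>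
        mat_adjoint C *\<^sub>v u + mat_adjoint A *\<^sub>v x = y \<and>
        Re (inn (R0 *\<^sub>v u) u) + 2 * Re (inn (\<Gamma> *\<^sub>v u) x) + vnorm2 (L *\<^sub>v x) < vnorm2 (L *\<^sub>v y) + \<epsilon>)"
  shows "\<exists>r F0 F0' G1 A2 Y. r \<le> m \<and> F0 \<in> carrier_mat r m \<and> F0' \<in> carrier_mat m r \<and> F0 * F0' = 1\<^sub>m r \<and>
    G1 \<in> carrier_mat k m \<and> A2 \<in> carrier_mat k k \<and> Y \<in> carrier_mat k r \<and>
    (\<forall>u. dim_vec u = m \<longrightarrow> \<Gamma> *\<^sub>v u = mat_adjoint L *\<^sub>v (G1 *\<^sub>v u)) \<and>
    (\<forall>x. dim_vec x = n \<longrightarrow> L *\<^sub>v (mat_adjoint A *\<^sub>v x) = A2 *\<^sub>v (L *\<^sub>v x)) \<and>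
    (\<forall>u. dim_vec u = m \<longrightarrow> R0 *\<^sub>v u = mat_adjoint F0 *\<^sub>v (F0 *\<^sub>v u) + mat_adjoint G1 *\<^sub>v (G1 *\<^sub>v u)) \<and>
    (\<forall>u. dim_vec u = m \<longrightarrow> L *\<^sub>v (mat_adjoint C *\<^sub>v u) = Y *\<^sub>v (F0 *\<^sub>v u) + A2 *\<^sub>v (G1 *\<^sub>v u)) \<and>
    (\<forall>b. dim_vec b = k \<longrightarrow> vnorm2 (mat_adjoint Y *\<^sub>v b) + vnorm2 (mat_adjoint A2 *\<^sub>v b) = vnorm2 b)"
proof -
  note le = le0[rule_format] and eq = eq0[rule_format]
  note d = carrier_matD[OF A] carrier_matD[OF C] carrier_matD[OF G] carrier_matD[OF R0] carrier_matD[OF L] carrier_matD[OF L']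
  have LLv: "L *\<^sub>v (L' *\<^sub>v a) = a" if "dim_vec a = k" for a
    using that by (simp add: mult_one_mv[OF LL] d)
  have ker: "L *\<^sub>v (x - L' *\<^sub>v (L *\<^sub>v x)) = 0\<^sub>v k" if "dim_vec x = n" for x
    using that by (simp add: mvs d LLv vec_diff_zero_iff)
  \<comment> \<open>On the kernel of \<open>L\<close> the quadratic term disappears under scaling of
    \<open>x\<close>, and the remaining linear term cannot be bounded below unless it is zero. Hence
    \<Gamma> maps into the range of \<open>L^*\<close>.\<close>
  have \<Gamma>ker: "inn (\<Gamma> *\<^sub>v u) x = 0" if u: "dim_vec u = m" and x: "dim_vec x = n" and Lx: "L *\<^sub>v x = 0\<^sub>v k" for u x
  proof (rule Re_mult_bounded_imp_zero)
    fix t :: complex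
    have "vnorm2 (L *\<^sub>v (mat_adjoint C *\<^sub>v u + mat_adjoint A *\<^sub>v (cnj (- t) \<cdot>\<^sub>v x)))
        \<le> Re (inn (R0 *\<^sub>v u) u) + 2 * Re (inn (\<Gamma> *\<^sub>v u) (cnj (- t) \<cdot>\<^sub>v x)) + vnorm2 (L *\<^sub>v (cnj (- t) \<cdot>\<^sub>v x))"
      by (rule le[OF u]) (simp add: x)
    hence "0 \<le> Re (inn (R0 *\<^sub>v u) u) + 2 * Re (inn (\<Gamma> *\<^sub>v u) (cnj (- t) \<cdot>\<^sub>v x)) + vnorm2 (L *\<^sub>v (cnj (- t) \<cdot>\<^sub>v x))"
      by (rule order_trans[OF vnorm2_nonneg])
    also have "L *\<^sub>v (cnj (- t) \<cdot>\<^sub>v x) = 0\<^sub>v k" using x Lx by (simp add: mv_smult d)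
    also have "inn (\<Gamma> *\<^sub>v u) (cnj (- t) \<cdot>\<^sub>v x) = - (t * inn (\<Gamma> *\<^sub>v u) x)" using x by (simp add: inn_smult_right d)
    finally show "Re (t * inn (\<Gamma> *\<^sub>v u) x) \<le> Re (inn (R0 *\<^sub>v u) u) / 2" by simp
  qed
  define G1 where "G1 = mat_adjoint L' * \<Gamma>"
  have G1c: "G1 \<in> carrier_mat k m" using L' G by (auto simp: G1_def)
  have \<Gamma>L: "\<Gamma> *\<^sub>v u = mat_adjoint L *\<^sub>v (G1 *\<^sub>v u)" if u: "dim_vec u = m" for u
  proof (rule vec_eqI_inn[of _ n])
    fix x :: "complex vec" assume "x \<in> carrier_vec n"
    hence x: "dim_vec x = n" by simp
    have "inn (\<Gamma> *\<^sub>v u) (x - L' *\<^sub>v (L *\<^sub>v x)) = 0" by (rule \<Gamma>ker[OF u _ ker[OF x]]) (simp add: d)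
    hence "inn (\<Gamma> *\<^sub>v u) x = inn (\<Gamma> *\<^sub>v u) (L' *\<^sub>v (L *\<^sub>v x))" using x by (simp add: inns d)
    also have "\<dots> = inn (mat_adjoint L *\<^sub>v (G1 *\<^sub>v u)) x"
      using x u by (simp add: G1_def mvs d inn_mv'[of L'] inn_mv'[of L])
    finally show "inn (\<Gamma> *\<^sub>v u) x = inn (mat_adjoint L *\<^sub>v (G1 *\<^sub>v u)) x" .
  qed (simp_all add: d)
  define A2 where "A2 = L * mat_adjoint A * L'"
  have A2c: "A2 \<in> carrier_mat k k" using L L' A by (auto simp: A2_def)
  \<comment> \<open>The inequality at \<open>u = 0\<close> and \<open>z\<close> in the kernel of
    \<open>L\<close> bounds \<open>|L A^* z|^2\<close> by 0, so that kernel is invariant under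
    \<open>A^*\<close> and \<open>A^*\<close> descends to \<open>A2\<close>.\<close>
  have LA: "L *\<^sub>v (mat_adjoint A *\<^sub>v x) = A2 *\<^sub>v (L *\<^sub>v x)" if x: "dim_vec x = n" for x
  proof -
    define z where "z = x - L' *\<^sub>v (L *\<^sub>v x)"
    have z: "dim_vec z = n" "L *\<^sub>v z = 0\<^sub>v k" using ker[OF x] by (auto simp: z_def d)
    have "vnorm2 (L *\<^sub>v (mat_adjoint C *\<^sub>v 0\<^sub>v m + mat_adjoint A *\<^sub>v z))
       \<le> Re (inn (R0 *\<^sub>v 0\<^sub>v m) (0\<^sub>v m)) + 2 * Re (inn (\<Gamma> *\<^sub>v 0\<^sub>v m) z) + vnorm2 (L *\<^sub>v z)"
      by (rule le) (simp_all add: z)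
    hence "vnorm2 (L *\<^sub>v (mat_adjoint A *\<^sub>v z)) \<le> 0" using z by (simp add: d mv_add)
    hence "L *\<^sub>v (mat_adjoint A *\<^sub>v z) = 0\<^sub>v k"
      using vnorm2_nonneg[of "L *\<^sub>v (mat_adjoint A *\<^sub>v z)"] vnorm2_eq_0[of "L *\<^sub>v (mat_adjoint A *\<^sub>v z)"] by (simp add: d)
    hence "L *\<^sub>v (mat_adjoint A *\<^sub>v x) - A2 *\<^sub>v (L *\<^sub>v x) = 0\<^sub>v k" using x by (simp add: z_def A2_def mvs d)
    thus ?thesis using A2c by (simp add: vec_diff_zero_iff d)
  qed
  note d2 = d carrier_matD[OF G1c] carrier_matD[OF A2c]
  define M0 where "M0 = R0 - mat_adjoint G1 * G1"
  have M0c: "M0 \<in> carrier_mat m m" using R0 G1c by (auto simp: M0_def)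
  have M0h: "herm M0" using hR by (simp add: herm_def M0_def adjoint_diff adjoint_mult d2)
  have M0f: "inn (M0 *\<^sub>v u) u = inn (R0 *\<^sub>v u) u - of_real (vnorm2 (G1 *\<^sub>v u))" if "dim_vec u = m" for u
    using that by (simp add: M0_def mvs inns d2 inn_mv[of "mat_adjoint G1"] inn_self)
  have M0p: "0 \<le> Re (inn (M0 *\<^sub>v u) u)" if "u \<in> carrier_vec m" for u
  proof -
    have u: "dim_vec u = m" using that by simp
    \<comment> \<open>A state with \<open>L x = - G1 u\<close>, which minimizes the right-hand side
      for fixed \<open>u\<close>. The inequality at this point says that the form \<open>M0\<close>
      left after completing the square is nonnegative.\<close>
    define x where "x = (-1) \<cdot>\<^sub>v (L' *\<^sub>v (G1 *\<^sub>v u))"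
    have x: "dim_vec x = n" by (simp add: x_def d)
    have Lx: "L *\<^sub>v x = (-1) \<cdot>\<^sub>v (G1 *\<^sub>v u)" using u by (simp add: x_def mv_smult d2 LLv)
    have "inn (\<Gamma> *\<^sub>v u) x = inn (G1 *\<^sub>v u) (L *\<^sub>v x)"
      unfolding \<Gamma>L[OF u] using x by (simp add: inn_mv[of "mat_adjoint L"] d2)
    hence 1: "inn (\<Gamma> *\<^sub>v u) x = - of_real (vnorm2 (G1 *\<^sub>v u))" unfolding Lx by (simp add: inn_smult_right inn_self)
    have 2: "vnorm2 (L *\<^sub>v x) = vnorm2 (G1 *\<^sub>v u)" unfolding Lx by (simp add: vnorm2_Re inns)
    have "0 \<le> Re (inn (R0 *\<^sub>v u) u) + 2 * Re (inn (\<Gamma> *\<^sub>v u) x) + vnorm2 (L *\<^sub>v x)"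
      by (rule order_trans[OF vnorm2_nonneg le[OF u x]])
    thus ?thesis unfolding 1 2 M0f[OF u] by simp
  qed
  obtain r F0 F0' where r: "r \<le> m" and F0: "F0 \<in> carrier_mat r m" and F0': "F0' \<in> carrier_mat m r"
    and FF: "F0 * F0' = 1\<^sub>m r" and Ff: "\<And>u. u \<in> carrier_vec m \<Longrightarrow> inn (M0 *\<^sub>v u) u = inn (F0 *\<^sub>v u) (F0 *\<^sub>v u)"
    using psd_rank_factorization[OF M0c M0h M0p] by metis
  note d3 = d2 carrier_matD[OF F0] carrier_matD[OF F0'] carrier_matD[OF M0c]
  have FFv: "F0 *\<^sub>v (F0' *\<^sub>v a) = a" if "dim_vec a = r" for a
    using that by (simp add: mult_one_mv[OF FF] d3)
  have M0F: "M0 = mat_adjoint F0 * F0"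
    by (rule mat_eqI_form[OF M0c]) (use F0 Ff in \<open>auto simp: mv_assoc inn_mv[of "mat_adjoint F0"]\<close>)
  have R0v: "R0 *\<^sub>v u = mat_adjoint F0 *\<^sub>v (F0 *\<^sub>v u) + mat_adjoint G1 *\<^sub>v (G1 *\<^sub>v u)" if u: "dim_vec u = m" for u
  proof -
    have "M0 *\<^sub>v u = mat_adjoint F0 *\<^sub>v (F0 *\<^sub>v u)" unfolding M0F using u by (simp add: mv_assoc d3)
    moreover have "M0 *\<^sub>v u = R0 *\<^sub>v u - mat_adjoint G1 *\<^sub>v (G1 *\<^sub>v u)" using u by (simp add: M0_def mvs d3)
    ultimately have "mat_adjoint F0 *\<^sub>v (F0 *\<^sub>v u) = R0 *\<^sub>v u - mat_adjoint G1 *\<^sub>v (G1 *\<^sub>v u)" by simp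
    thus ?thesis by (simp only:) (rule eq_vecI; simp add: d3)
  qed
  define Z where "Z = L * mat_adjoint C - A2 * G1"
  have Zc: "Z \<in> carrier_mat k m" using A2c G1c by (auto simp: Z_def)
  note d4 = d3 carrier_matD[OF Zc]
  have Zv: "Z *\<^sub>v u = L *\<^sub>v (mat_adjoint C *\<^sub>v u) - A2 *\<^sub>v (G1 *\<^sub>v u)" if "dim_vec u = m" for u
    using that by (simp add: Z_def mvs d3)
  \<comment> \<open>Completion of squares: the cost becomes the squared norm of the pair formed by
    \<open>F0 u\<close> and \<open>L x + G1 u\<close>.\<close>
  have cost: "Re (inn (R0 *\<^sub>v u) u) + 2 * Re (inn (\<Gamma> *\<^sub>v u) x) + vnorm2 (L *\<^sub>v x)
      = vnorm2 (F0 *\<^sub>v u) + vnorm2 (L *\<^sub>v x + G1 *\<^sub>v u)" if u: "dim_vec u = m" and x: "dim_vec x = n" for u x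
  proof -
    have 1: "inn (R0 *\<^sub>v u) u = inn (F0 *\<^sub>v u) (F0 *\<^sub>v u) + inn (G1 *\<^sub>v u) (G1 *\<^sub>v u)"
      unfolding R0v[OF u] using u by (simp add: inns inn_mv[of "mat_adjoint F0"] inn_mv[of "mat_adjoint G1"] d4)
    have 2: "inn (\<Gamma> *\<^sub>v u) x = inn (G1 *\<^sub>v u) (L *\<^sub>v x)"
      unfolding \<Gamma>L[OF u] using x by (simp add: inn_mv[of "mat_adjoint L"] d4)
    have 3: "Re (inn (L *\<^sub>v x) (G1 *\<^sub>v u)) = Re (inn (G1 *\<^sub>v u) (L *\<^sub>v x))"
      by (rule Re_inn_commute) (simp add: d4)
    show ?thesis unfolding 1 2 by (simp add: vnorm2_Re inns d4 3)
  qed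
  have next_state: "L *\<^sub>v (mat_adjoint C *\<^sub>v u + mat_adjoint A *\<^sub>v x) = Z *\<^sub>v u + A2 *\<^sub>v (L *\<^sub>v x + G1 *\<^sub>v u)"
    if u: "dim_vec u = m" and x: "dim_vec x = n" for u x
    using u x by (simp add: mv_add d4 Zv LA) (rule eq_vecI; simp add: d4)
  \<comment> \<open>As \<open>L\<close> is onto, \<open>L x + G1 u\<close> can be prescribed freely
    as \<sigma>, independently of \<open>u\<close>.\<close>
  have le1: "vnorm2 (Z *\<^sub>v u + A2 *\<^sub>v \<sigma>) \<le> vnorm2 (F0 *\<^sub>v u) + vnorm2 \<sigma>" if u: "dim_vec u = m" and s: "dim_vec \<sigma> = k" for u \<sigma>
  proof -
    define x where "x = L' *\<^sub>v (\<sigma> - G1 *\<^sub>v u)"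
    have x: "dim_vec x = n" by (simp add: x_def d)
    have "L *\<^sub>v x = \<sigma> - G1 *\<^sub>v u" unfolding x_def by (rule LLv) (simp add: d4)
    hence e: "L *\<^sub>v x + G1 *\<^sub>v u = \<sigma>" using s by (simp only:) (rule eq_vecI; simp add: d4)
    show ?thesis using le[OF u x] unfolding cost[OF u x] next_state[OF u x] e .
  qed
  define Y where "Y = Z * F0'"
  have Yc: "Y \<in> carrier_mat k r" using Zc F0' by (auto simp: Y_def)
  note d5 = d4 carrier_matD[OF Yc]
  \<comment> \<open>A vector in the kernel of \<open>F0\<close> costs nothing, so the contraction
    bound sends it to 0 and \<open>Z\<close> factors through \<open>F0\<close>.\<close>
  have ZY: "Z *\<^sub>v u = Y *\<^sub>v (F0 *\<^sub>v u)" if u: "dim_vec u = m" for u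
  proof -
    define w where "w = u - F0' *\<^sub>v (F0 *\<^sub>v u)"
    have w: "dim_vec w = m" "F0 *\<^sub>v w = 0\<^sub>v r" using u by (auto simp: w_def mvs d5 FFv vec_diff_zero_iff)
    have "vnorm2 (Z *\<^sub>v w + A2 *\<^sub>v 0\<^sub>v k) \<le> vnorm2 (F0 *\<^sub>v w) + vnorm2 (0\<^sub>v k)" by (rule le1) (simp_all add: w)
    moreover have "Z *\<^sub>v w + A2 *\<^sub>v 0\<^sub>v k = Z *\<^sub>v w" by (rule eq_vecI) (simp_all add: d5 del: index_mult_mat_vec)
    ultimately have "vnorm2 (Z *\<^sub>v w) \<le> 0" by (simp add: w)
    hence "Z *\<^sub>v w = 0\<^sub>v k" using vnorm2_nonneg[of "Z *\<^sub>v w"] vnorm2_eq_0[of "Z *\<^sub>v w"] by (simp add: d5)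
    hence "Z *\<^sub>v u - Y *\<^sub>v (F0 *\<^sub>v u) = 0\<^sub>v k" using u by (simp add: w_def Y_def mvs d5)
    thus ?thesis by (simp add: vec_diff_zero_iff d5)
  qed
  have le2: "vnorm2 (Y *\<^sub>v a + A2 *\<^sub>v \<sigma>) \<le> vnorm2 a + vnorm2 \<sigma>" if a: "dim_vec a = r" and s: "dim_vec \<sigma> = k" for a \<sigma>
    using le1[of "F0' *\<^sub>v a" \<sigma>] s by (simp add: d5 ZY FFv[OF a])
  \<comment> \<open>The Bellman inequality makes the row \<open>[Y A2]\<close> a contraction, hence
    \<open>\<beta> \<le> |b|^2\<close>. For the reverse, near-optimal steps write \<open>b\<close>
    as \<open>Y a + A2 \<sigma>\<close> with \<open>|a|^2 + |\<sigma>|^2\<close> almost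
    \<open>|b|^2\<close>; pairing this with \<open>b\<close> gives
    \<open>|b|^2 \<le> \<beta> + \<epsilon>\<close>.\<close>
  have coiso: "vnorm2 (mat_adjoint Y *\<^sub>v b) + vnorm2 (mat_adjoint A2 *\<^sub>v b) = vnorm2 b" if b: "dim_vec b = k" for b
  proof -
    define \<beta> where "\<beta> = vnorm2 (mat_adjoint Y *\<^sub>v b) + vnorm2 (mat_adjoint A2 *\<^sub>v b)"
    define z where "z = Y *\<^sub>v (mat_adjoint Y *\<^sub>v b) + A2 *\<^sub>v (mat_adjoint A2 *\<^sub>v b)"
    have z: "dim_vec z = k" by (simp add: z_def d5)
    have "inn z b = of_real \<beta>" using b by (simp add: z_def \<beta>_def inns inn_mv[of Y] inn_mv[of A2] d5 inn_self)
    moreover have "vnorm2 z \<le> \<beta>" unfolding z_def \<beta>_def by (rule le2) (simp_all add: d5)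
    ultimately have up: "\<beta> \<le> vnorm2 b" using two_Re_inn_le[of z b] z b by simp
    have lo: "vnorm2 b \<le> \<beta> + \<epsilon>" if e: "0 < \<epsilon>" for \<epsilon>
    proof -
      from eq[of "L' *\<^sub>v b" \<epsilon>] e obtain u x where u: "dim_vec u = m" and x: "dim_vec x = n"
        and ux: "mat_adjoint C *\<^sub>v u + mat_adjoint A *\<^sub>v x = L' *\<^sub>v b"
        and lt: "Re (inn (R0 *\<^sub>v u) u) + 2 * Re (inn (\<Gamma> *\<^sub>v u) x) + vnorm2 (L *\<^sub>v x) < vnorm2 (L *\<^sub>v (L' *\<^sub>v b)) + \<epsilon>"
        by (auto simp: d5)
      define a where "a = F0 *\<^sub>v u"
      define \<sigma> where "\<sigma> = L *\<^sub>v x + G1 *\<^sub>v u"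
      have da: "dim_vec a = r" "dim_vec \<sigma> = k" by (simp_all add: a_def \<sigma>_def d5)
      have bz: "b = Y *\<^sub>v a + A2 *\<^sub>v \<sigma>"
        using next_state[OF u x] unfolding ux LLv[OF b] by (simp add: a_def \<sigma>_def ZY[OF u])
      have lt': "vnorm2 a + vnorm2 \<sigma> < vnorm2 b + \<epsilon>" using lt unfolding cost[OF u x] LLv[OF b] by (simp add: a_def \<sigma>_def)
      have "inn b b = inn (Y *\<^sub>v a + A2 *\<^sub>v \<sigma>) b" using bz by simp
      also have "\<dots> = inn a (mat_adjoint Y *\<^sub>v b) + inn \<sigma> (mat_adjoint A2 *\<^sub>v b)"
        using b da by (simp add: inns inn_mv[of Y] inn_mv[of A2] d5)
      finally have "2 * vnorm2 b = 2 * Re (inn a (mat_adjoint Y *\<^sub>v b)) + 2 * Re (inn \<sigma> (mat_adjoint A2 *\<^sub>v b))"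
        unfolding vnorm2_Re by simp
      also have "\<dots> \<le> (vnorm2 a + vnorm2 (mat_adjoint Y *\<^sub>v b)) + (vnorm2 \<sigma> + vnorm2 (mat_adjoint A2 *\<^sub>v b))"
        by (intro add_mono two_Re_inn_le) (simp_all add: da d5)
      finally show ?thesis using lt' unfolding \<beta>_def by linarith
    qed
    have "vnorm2 b \<le> \<beta>" by (rule field_le_epsilon) (rule lo)
    thus ?thesis using up unfolding \<beta>_def by linarith
  qed
  have LC: "L *\<^sub>v (mat_adjoint C *\<^sub>v u) = Y *\<^sub>v (F0 *\<^sub>v u) + A2 *\<^sub>v (G1 *\<^sub>v u)" if u: "dim_vec u = m" for u
    unfolding ZY[OF u, symmetric] Zv[OF u] by (rule eq_vecI) (simp_all add: d5 del: index_mult_mat_vec)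
  show ?thesis
    by (intro exI[of _ r] exI[of _ F0] exI[of _ F0'] exI[of _ G1] exI[of _ A2] exI[of _ Y] conjI allI impI)
      (rule r F0 F0' FF G1c A2c Yc | (rule \<Gamma>L LA R0v LC coiso; assumption))+
qed

section \<open>The value of finite inputs\<close>

context realization_pair
begin

text \<open>A list is read from time 0 on, so \<open>Cons\<close> puts an input in front and moves
  the others one step into the future; this is the backward recursion of the costate, with zero
  state after the end. Finite lists keep the infimum defining \<theta> free of convergence
  questions.\<close>

primrec st :: "complex vec list \<Rightarrow> complex vec" where
  "st [] = 0\<^sub>v n"
| "st (u # l) = mat_adjoint C *\<^sub>v u + mat_adjoint A *\<^sub>v st l"

primrec cost :: "complex vec list \<Rightarrow> real" where
  "cost [] = 0"
| "cost (u # l) = \<phi> u (st l) + cost l"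

definition seq_of :: "complex vec list \<Rightarrow> nat \<Rightarrow> complex vec" where
  "seq_of l i = (if i < length l then l ! i else 0\<^sub>v m)"

abbreviation valid :: "complex vec list \<Rightarrow> bool" where
  "valid l \<equiv> \<forall>u\<in>set l. dim_vec u = m"

lemma dim_st [simp]: "dim_vec (st l) = n"
  by (cases l) (simp_all add: dims)

lemma seq_of_Cons: "seq_of (u # l) 0 = u" "seq_of (u # l) (Suc i) = seq_of l i" "seq_of [] i = 0\<^sub>v m"
  by (auto simp: seq_of_def)

lemma dim_sq: "valid l \<Longrightarrow> dim_vec (seq_of l i) = m"
  by (auto simp: seq_of_def)

lemma seq_of_ell2: "valid l \<Longrightarrow> ell2 m (seq_of l)"
proof -
  assume l: "valid l"
  have "summable (\<lambda>i. vnorm2 (seq_of l i))"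
    by (rule summable_finite[of "{..<length l}"]) (auto simp: seq_of_def)
  thus ?thesis using dim_sq[OF l] by (auto simp: ell2_def intro!: carrier_vecI)
qed

lemma costate_sq_Nil: "costate (seq_of []) j = 0\<^sub>v n"
  by (rule eq_vecI) (simp_all add: costate_def bwd_state_def seq_of_Cons dims pow_carrier_mat adjoint_pow[OF Ac, symmetric]
      dim_pow[OF Ac] del: index_mult_mat_vec)

lemma costate_sq_Suc: "costate (seq_of (u # l)) (Suc j) = costate (seq_of l) j"
  by (simp add: costate_def bwd_state_def seq_of_Cons)

lemma costate_sq_0: "valid l \<Longrightarrow> costate (seq_of l) 0 = st l"
proof (induction l)
  case (Cons u l)
  have "costate (seq_of (u # l)) 0 = mat_adjoint C *\<^sub>v seq_of (u # l) 0 + mat_adjoint A *\<^sub>v costate (seq_of (u # l)) (Suc 0)"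
    by (rule costate_step[OF ell2_imp_vbounded[OF seq_of_ell2[OF Cons.prems]]])
  thus ?case using Cons by (simp add: seq_of_Cons costate_sq_Suc)
qed (simp add: costate_sq_Nil)

lemma costate_sq_end: "length l \<le> j \<Longrightarrow> costate (seq_of l) j = 0\<^sub>v n"
proof (induction l arbitrary: j)
  case (Cons u l)
  then obtain j' where "j = Suc j'" by (cases j) auto
  thus ?case using Cons by (simp add: costate_sq_Suc)
qed (simp add: costate_sq_Nil)

lemma \<phi>_zero [simp]: "dim_vec s = n \<Longrightarrow> \<phi> (0\<^sub>v m) s = 0"
  by (simp add: \<phi>_def dims)

lemma cost_sq: "length l \<le> k \<Longrightarrow> (\<Sum>j<k. \<phi> (seq_of l j) (costate (seq_of l) (Suc j))) = cost l" if "valid l"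
  using that
proof (induction l arbitrary: k)
  case (Cons u l)
  then obtain k' where k: "k = Suc k'" by (cases k) auto
  have "(\<Sum>j<k. \<phi> (seq_of (u # l) j) (costate (seq_of (u # l)) (Suc j)))
     = \<phi> u (costate (seq_of l) 0) + (\<Sum>j<k'. \<phi> (seq_of l j) (costate (seq_of l) (Suc j)))"
    unfolding k by (subst sum.lessThan_Suc_shift) (simp add: seq_of_Cons costate_sq_Suc)
  thus ?case using Cons k by (simp add: costate_sq_0)
qed (simp add: seq_of_Cons costate_sq_Nil)

lemma quad_sq: "valid l \<Longrightarrow> quad (seq_of l) = of_real (cost l - Re (inn (N *\<^sub>v st l) (st l)))"
proof -
  assume l: "valid l"
  obtain S where S: "quad (seq_of l) = of_real S"
    "(\<lambda>k. \<Sum>j<k. \<phi> (seq_of l j) (costate (seq_of l) (Suc j))) \<longlonglongrightarrow> S + Re (inn (N *\<^sub>v costate (seq_of l) 0) (costate (seq_of l) 0))"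
    using quad_limit[OF seq_of_ell2[OF l]] by blast
  have "eventually (\<lambda>k. (\<Sum>j<k. \<phi> (seq_of l j) (costate (seq_of l) (Suc j))) = cost l) sequentially"
    unfolding eventually_sequentially using cost_sq[OF l] by blast
  hence "(\<lambda>k. \<Sum>j<k. \<phi> (seq_of l j) (costate (seq_of l) (Suc j))) \<longlonglongrightarrow> cost l" by (rule tendsto_eventually)
  from LIMSEQ_unique[OF S(2) this] have "S = cost l - Re (inn (N *\<^sub>v st l) (st l))"
    unfolding costate_sq_0[OF l] by linarith
  thus ?thesis using S(1) by (simp only:)
qed

text \<open>Delaying an input multiplies its state by a power of \<open>A^*\<close> and leaves the
  cost alone, as expected from a Toeplitz form. This will separate the cost from the
  \<open>N\<close>-term.\<close>

lemma pad_front: "st (replicate k (0\<^sub>v m) @ l) = mat_adjoint A ^\<^sub>m k *\<^sub>v st l"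
  "cost (replicate k (0\<^sub>v m) @ l) = cost l"
proof -
  note Aa = adjoint_carrier[OF Ac]
  show "st (replicate k (0\<^sub>v m) @ l) = mat_adjoint A ^\<^sub>m k *\<^sub>v st l"
  proof (induction k)
    case (Suc k)
    show ?case unfolding pow_mv_Suc(2)[OF Aa dim_st] using Suc by (simp add: dims)
  qed (simp add: dims)
  show "cost (replicate k (0\<^sub>v m) @ l) = cost l" by (induction k) auto
qed

lemma pad_back: "st (l @ replicate k (0\<^sub>v m)) = st l" "cost (l @ replicate k (0\<^sub>v m)) = cost l"
proof -
  have 0: "st (replicate k (0\<^sub>v m)) = 0\<^sub>v n" "cost (replicate k (0\<^sub>v m)) = 0"
    by (induction k) (simp_all add: dims)
  show s: "st (l @ replicate k (0\<^sub>v m)) = st l" for l by (induction l) (simp_all add: 0)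
  show "cost (l @ replicate k (0\<^sub>v m)) = cost l" by (induction l) (simp_all add: 0 s)
qed

lemma st_map2: "length l = length l' \<Longrightarrow> valid l \<Longrightarrow> valid l' \<Longrightarrow>
    st (map2 (+) l l') = st l + st l' \<and> st (map2 (-) l l') = st l - st l'"
proof (induction l l' rule: list_induct2)
  case (Cons u l u' l')
  hence "st (map2 (+) l l') = st l + st l'" "st (map2 (-) l l') = st l - st l'" "dim_vec u = m" "dim_vec u' = m"
    by auto
  thus ?case by (auto simp: mvs dims)
qed auto

lemma \<phi>_parallelogram: "dim_vec u = m \<Longrightarrow> dim_vec u' = m \<Longrightarrow> dim_vec s = n \<Longrightarrow> dim_vec s' = n \<Longrightarrow>
    \<phi> (u + u') (s + s') + \<phi> (u - u') (s - s') = 2 * \<phi> u s + 2 * \<phi> u' s'"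
  by (simp add: \<phi>_def mvs inns dims)

lemma cost_map2: "length l = length l' \<Longrightarrow> valid l \<Longrightarrow> valid l' \<Longrightarrow>
    cost (map2 (+) l l') + cost (map2 (-) l l') = 2 * cost l + 2 * cost l'"
proof (induction l l' rule: list_induct2)
  case (Cons u l u' l')
  thus ?case using \<phi>_parallelogram[of u u' "st l" "st l'"] st_map2[of l l'] by simp
qed auto

lemma \<phi>_smult: "dim_vec u = m \<Longrightarrow> dim_vec s = n \<Longrightarrow> \<phi> (c \<cdot>\<^sub>v u) (c \<cdot>\<^sub>v s) = (cmod c)\<^sup>2 * \<phi> u s"
proof -
  assume d: "dim_vec u = m" "dim_vec s = n"
  have 1: "inn (R0 *\<^sub>v (c \<cdot>\<^sub>v u)) (c \<cdot>\<^sub>v u) = (c * cnj c) * inn (R0 *\<^sub>v u) u" using d by (simp add: mvs inns dims)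
  have 2: "inn (\<Gamma> *\<^sub>v (c \<cdot>\<^sub>v u)) (c \<cdot>\<^sub>v s) = (c * cnj c) * inn (\<Gamma> *\<^sub>v u) s" using d by (simp add: mvs inns dims)
  have 3: "c * cnj c = complex_of_real ((cmod c)\<^sup>2)" by (rule complex_norm_square[symmetric])
  show ?thesis unfolding \<phi>_def 1 2 3 by (simp add: algebra_simps)
qed

lemma st_smult: "valid l \<Longrightarrow> st (map (\<lambda>u. c \<cdot>\<^sub>v u) l) = c \<cdot>\<^sub>v st l"
proof (induction l)
  case (Cons u l)
  have "c \<cdot>\<^sub>v (mat_adjoint C *\<^sub>v u) + c \<cdot>\<^sub>v (mat_adjoint A *\<^sub>v st l)
      = c \<cdot>\<^sub>v (mat_adjoint C *\<^sub>v u + mat_adjoint A *\<^sub>v st l)"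
    by (rule smult_add_distrib_vec[symmetric, of _ n]) (simp_all add: carrier_vecI dims)
  thus ?case using Cons by (simp add: mvs dims)
qed simp

lemma cost_smult: "valid l \<Longrightarrow> cost (map (\<lambda>u. c \<cdot>\<^sub>v u) l) = (cmod c)\<^sup>2 * cost l"
  by (induction l) (simp_all add: st_smult \<phi>_smult algebra_simps)

lemma valid_pad: "valid l \<Longrightarrow> valid (replicate k (0\<^sub>v m) @ l)" "valid l \<Longrightarrow> valid (l @ replicate k (0\<^sub>v m))"
  by (auto simp: in_set_replicate)

lemma valid_map2: "length l = length l' \<Longrightarrow> valid l \<Longrightarrow> valid l' \<Longrightarrow>
    valid (map2 (+) l l') \<and> valid (map2 (-) l l')"
  by (induction l l' rule: list_induct2) auto

lemma equal_length:
  assumes "valid l" "valid l'"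
  obtains k k' where "length (l @ replicate k (0\<^sub>v m)) = length (l' @ replicate k' (0\<^sub>v m))"
    "valid (l @ replicate k (0\<^sub>v m))" "valid (l' @ replicate k' (0\<^sub>v m))"
  by (rule that[of "length l'" "length l"]) (simp, (rule valid_pad assms)+)

text \<open>The states of finite inputs form a subspace. A vector orthogonal to it is orthogonal to
  every \<open>A^*\<close>-power applied to the range of \<open>C^*\<close>, so it is annihilated by
  all \<open>C A^j\<close> and vanishes by observability. The orthogonal projection comes from
  \<open>maximal_orthonormal\<close> with the identity matrix.\<close>

lemma reachable:
  assumes x: "dim_vec x = n"
  shows "\<exists>l. valid l \<and> st l = x"
proof -
  define U where "U = {st l | l. valid l}"
  have U: "U \<subseteq> carrier_vec n" by (auto simp: U_def intro!: carrier_vecI)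
  have U0: "0\<^sub>v n \<in> U" unfolding U_def by (rule CollectI, rule exI[of _ "[]"]) simp
  have Ua: "a + b \<in> U" if "a \<in> U" "b \<in> U" for a b
  proof -
    from that obtain l l' where l: "valid l" "a = st l" "valid l'" "b = st l'" by (auto simp: U_def)
    obtain k k' where k: "length (l @ replicate k (0\<^sub>v m)) = length (l' @ replicate k' (0\<^sub>v m))"
      "valid (l @ replicate k (0\<^sub>v m))" "valid (l' @ replicate k' (0\<^sub>v m))" using equal_length[OF l(1,3)] by blast
    define h where "h = map2 (+) (l @ replicate k (0\<^sub>v m)) (l' @ replicate k' (0\<^sub>v m))"
    have "st h = a + b" unfolding h_def using st_map2[OF k] pad_back(1) l by simp
    moreover have "valid h" unfolding h_def using valid_map2[OF k] by (rule conjunct1)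
    ultimately show ?thesis unfolding U_def by (intro CollectI exI[of _ h] conjI) (simp_all only:)
  qed
  have Us: "c \<cdot>\<^sub>v a \<in> U" if "a \<in> U" for a c
  proof -
    from that obtain l where l: "valid l" "a = st l" by (auto simp: U_def)
    have "st (map (\<lambda>u. c \<cdot>\<^sub>v u) l) = c \<cdot>\<^sub>v a" using st_smult[OF l(1)] l by simp
    moreover have "valid (map (\<lambda>u. c \<cdot>\<^sub>v u) l)" using l by auto
    ultimately show ?thesis unfolding U_def by (intro CollectI exI[of _ "map (\<lambda>u. c \<cdot>\<^sub>v u) l"] conjI) (simp_all only:)
  qed
  have h1: "herm (1\<^sub>m n)" by (simp add: herm_def)
  have pos1: "0 \<le> Re (inn (1\<^sub>m n *\<^sub>v v) v)" if "v \<in> carrier_vec n" for v using that by (simp add: inn_self)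
  obtain k W where W: "W \<in> carrier_mat n k" and WU: "\<And>a. a \<in> carrier_vec k \<Longrightarrow> W *\<^sub>v a \<in> U"
    and z: "\<And>x z. x \<in> U \<Longrightarrow> z = x - W *\<^sub>v (mat_adjoint W *\<^sub>v (1\<^sub>m n *\<^sub>v x)) \<Longrightarrow> inn (1\<^sub>m n *\<^sub>v z) z = 0"
    and one: "mat_adjoint W * 1\<^sub>m n * W = 1\<^sub>m k"
    using maximal_orthonormal[OF one_carrier_mat h1 pos1 U0 U Ua Us] by metis
  note dW = carrier_matD[OF W]
  define v where "v = x - W *\<^sub>v (mat_adjoint W *\<^sub>v x)"
  have v: "dim_vec v = n" by (simp add: v_def dW)
  have orth: "mat_adjoint W *\<^sub>v v = 0\<^sub>v k"
  proof -
    have "(mat_adjoint W * 1\<^sub>m n * W) *\<^sub>v (mat_adjoint W *\<^sub>v x) = mat_adjoint W *\<^sub>v x"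
      unfolding one by (simp add: dW)
    hence "mat_adjoint W *\<^sub>v (W *\<^sub>v (mat_adjoint W *\<^sub>v x)) = mat_adjoint W *\<^sub>v x" using x by (simp add: mvs dW)
    thus ?thesis using x by (simp add: v_def mvs dW vec_diff_zero_iff)
  qed
  have perp: "inn v a = 0" if a: "a \<in> U" for a
  proof -
    have da: "dim_vec a = n" using a U by auto
    define c where "c = a - W *\<^sub>v (mat_adjoint W *\<^sub>v a)"
    have dc: "dim_vec c = n" by (simp add: c_def dW)
    have "inn (1\<^sub>m n *\<^sub>v c) c = 0" by (rule z[OF a]) (simp add: c_def da)
    hence "c = 0\<^sub>v n" using dc vnorm2_eq_0[of c] by (simp add: inn_self)
    hence "a = W *\<^sub>v (mat_adjoint W *\<^sub>v a)" using da by (simp add: c_def vec_diff_zero_iff dW)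
    hence "inn v a = inn v (W *\<^sub>v (mat_adjoint W *\<^sub>v a))" by simp
    also have "\<dots> = 0" using v da by (simp add: inn_mv'[of W] dW orth)
    finally show ?thesis .
  qed
  have "(C * A ^\<^sub>m j) *\<^sub>v v = 0\<^sub>v (dim_row C)" for j
  proof (rule vec_eqI_inn[of _ m])
    fix u :: "complex vec" assume "u \<in> carrier_vec m"
    hence u: "dim_vec u = m" by simp
    define l where "l = replicate j (0\<^sub>v m) @ [u]"
    have "st l \<in> U" unfolding U_def l_def using u by (intro CollectI exI conjI refl) auto
    moreover have "st l = mat_adjoint A ^\<^sub>m j *\<^sub>v (mat_adjoint C *\<^sub>v u)"
      unfolding l_def pad_front(1) by (simp add: dims)
    ultimately have "inn v (mat_adjoint A ^\<^sub>m j *\<^sub>v (mat_adjoint C *\<^sub>v u)) = 0" using perp by metis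
    hence "inn (C *\<^sub>v (A ^\<^sub>m j *\<^sub>v v)) u = 0"
      using u v Ac by (simp add: adjoint_pow[OF Ac, symmetric] inn_mv[of C] inn_mv[of "A ^\<^sub>m j"] dims)
    thus "inn ((C * A ^\<^sub>m j) *\<^sub>v v) u = inn (0\<^sub>v (dim_row C)) u" using u v Ac by (simp add: mvs dims)
  qed (simp_all add: dims)
  hence "v = 0\<^sub>v n" using obs v by (auto simp: observable_def)
  hence "x = W *\<^sub>v (mat_adjoint W *\<^sub>v x)" using x by (simp add: v_def vec_diff_zero_iff dW)
  moreover have "W *\<^sub>v (mat_adjoint W *\<^sub>v x) \<in> U" by (rule WU) (simp add: dW carrier_vecI)
  ultimately show ?thesis unfolding U_def by auto
qed

text \<open>The least cost of steering the costate to \<open>x\<close> at time 0. The set is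
  nonempty by \<open>reachable\<close>; it is bounded below once nonnegativity of the costs has been
  derived.\<close>

definition \<theta> :: "complex vec \<Rightarrow> real" where
  "\<theta> x = Inf {cost l | l. valid l \<and> st l = x}"

section \<open>The value function when the operator difference is nonnegative\<close>

context
  assumes pos: "\<And>y. ell2 m y \<Longrightarrow> nonneg_complex (quad y)"
begin

lemma cost_ge_N: "valid l \<Longrightarrow> Re (inn (N *\<^sub>v st l) (st l)) \<le> cost l"
  using pos[OF seq_of_ell2, of l] by (simp add: quad_sq nonneg_complex_def)

text \<open>The hypothesis bounds the cost only by the \<open>N\<close>-term of the state. Delaying
  the input by \<open>k\<close> steps keeps the cost while the state decays geometrically, so in the
  limit the bound becomes 0.\<close>

lemma cost_nonneg: "valid l \<Longrightarrow> 0 \<le> cost l"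
proof -
  assume l: "valid l"
  define x where "x k = mat_adjoint A ^\<^sub>m k *\<^sub>v st l" for k
  note Aa = adjoint_carrier[OF Ac]
  have dx: "dim_vec (x k) = n" for k using Aa by (simp add: x_def dims)
  from geo_stable_nrm[OF As] obtain c \<rho> where c: "0 \<le> c" "0 < \<rho>" "\<rho> < 1"
    "\<And>j v. dim_vec v = n \<Longrightarrow> nrm (mat_adjoint A ^\<^sub>m j *\<^sub>v v) \<le> c * \<rho> ^ j * nrm v" by blast
  have x0: "(\<lambda>k. nrm (x k)) \<longlonglongrightarrow> 0"
  proof (rule Lim_null_comparison)
    show "eventually (\<lambda>k. norm (nrm (x k)) \<le> c * nrm (st l) * \<rho> ^ k) sequentially"
      using c(4)[OF dim_st] by (intro always_eventually allI) (simp add: x_def mult_ac)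
    show "(\<lambda>k. c * nrm (st l) * \<rho> ^ k) \<longlonglongrightarrow> 0"
      using tendsto_mult_left[OF LIMSEQ_realpow_zero, of \<rho> "c * nrm (st l)"] c by simp
  qed
  obtain K where K: "0 \<le> K" "\<And>v. dim_vec v = n \<Longrightarrow> nrm (N *\<^sub>v v) \<le> K * nrm v" using mat_bounded[of N] by (auto simp: dims)
  have bd: "nrm (N *\<^sub>v x k) \<le> K * (c * nrm (st l))" for k
  proof -
    have "nrm (x k) \<le> c * \<rho> ^ k * nrm (st l)" unfolding x_def by (rule c(4)) simp
    also have "\<dots> \<le> c * 1 * nrm (st l)" using c by (intro mult_right_mono mult_left_mono power_le_one) auto
    finally show ?thesis using K(2)[OF dx, of k] mult_left_mono[OF _ K(1), of "nrm (x k)" "c * nrm (st l)"] by simp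
  qed
  have "(\<lambda>k. inn (N *\<^sub>v x k) (x k)) \<longlonglongrightarrow> 0"
    by (rule tendsto_inn_0[OF _ dx bd x0]) (simp add: dims)
  hence lim: "(\<lambda>k. Re (inn (N *\<^sub>v x k) (x k))) \<longlonglongrightarrow> 0" using tendsto_Re by fastforce
  have "Re (inn (N *\<^sub>v x k) (x k)) \<le> cost l" for k
    using cost_ge_N[OF valid_pad(1)[OF l, of k]] unfolding pad_front x_def .
  thus ?thesis by (intro LIMSEQ_le_const2[OF lim]) auto
qed

lemma \<theta>_le: "valid l \<Longrightarrow> \<theta> (st l) \<le> cost l"
  unfolding \<theta>_def by (rule cInf_lower) (auto intro!: bdd_belowI[of _ 0] cost_nonneg)

lemma \<theta>_approx:
  assumes x: "dim_vec x = n" and e: "0 < \<epsilon>"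
  obtains l where "valid l" "st l = x" "cost l < \<theta> x + \<epsilon>"
proof -
  have ne: "{cost l | l. valid l \<and> st l = x} \<noteq> {}" using reachable[OF x] by auto
  have "Inf {cost l | l. valid l \<and> st l = x} < \<theta> x + \<epsilon>" using e by (simp add: \<theta>_def)
  from cInf_lessD[OF ne this] show thesis using that by auto
qed

lemma \<theta>_nonneg: "dim_vec x = n \<Longrightarrow> 0 \<le> \<theta> x"
  unfolding \<theta>_def by (rule cInf_greatest) (use reachable cost_nonneg in auto)

lemma \<theta>_ge_N: "dim_vec x = n \<Longrightarrow> Re (inn (N *\<^sub>v x) x) \<le> \<theta> x"
proof -
  assume x: "dim_vec x = n"
  show ?thesis unfolding \<theta>_def
  proof (rule cInf_greatest)
    show "{cost l | l. valid l \<and> st l = x} \<noteq> {}" using reachable[OF x] by blast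
    fix c assume "c \<in> {cost l | l. valid l \<and> st l = x}"
    then obtain l where l: "valid l" "st l = x" "c = cost l" by blast
    show "Re (inn (N *\<^sub>v x) x) \<le> c" using cost_ge_N[OF l(1)] unfolding l .
  qed
qed

text \<open>Adding and subtracting near-optimal inputs, padded to equal length, gives one inequality
  of the parallelogram law. The same inequality for \<open>x + y\<close> and \<open>x - y\<close>,
  whose sum and difference are \<open>2 x\<close> and \<open>2 y\<close>, gives the other by
  homogeneity, which is itself obtained from an estimate for \<open>c\<close> and one for its
  inverse.\<close>

lemma \<theta>_parallelogram:
  assumes x: "dim_vec x = n" and y: "dim_vec y = n"
  shows "\<theta> (x + y) + \<theta> (x - y) = 2 * \<theta> x + 2 * \<theta> y"
    and \<theta>_smult: "\<theta> (c \<cdot>\<^sub>v x) = (cmod c)\<^sup>2 * \<theta> x"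
proof -
  have \<theta>0: "\<theta> (0\<^sub>v n) = 0" using \<theta>_le[of "[]"] \<theta>_nonneg[of "0\<^sub>v n"] by simp
  have hom_le: "\<theta> (c \<cdot>\<^sub>v x) \<le> (cmod c)\<^sup>2 * \<theta> x" if x: "dim_vec x = n" for c x
  proof (cases "c = 0")
    case True
    hence "c \<cdot>\<^sub>v x = 0\<^sub>v n" using x by auto
    thus ?thesis using True \<theta>0 by simp
  next
    case False
    show ?thesis
    proof (rule field_le_epsilon)
      fix e :: real assume e: "0 < e"
      have cp: "0 < (cmod c)\<^sup>2" using False by simp
      obtain l where l: "valid l" "st l = x" "cost l < \<theta> x + e / (cmod c)\<^sup>2"
        using \<theta>_approx[OF x, of "e / (cmod c)\<^sup>2"] e cp by auto
      have v: "valid (map (\<lambda>u. c \<cdot>\<^sub>v u) l)" using l by auto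
      have "\<theta> (c \<cdot>\<^sub>v x) \<le> (cmod c)\<^sup>2 * cost l"
        using \<theta>_le[OF v] l by (simp add: st_smult cost_smult)
      also have "\<dots> \<le> (cmod c)\<^sup>2 * (\<theta> x + e / (cmod c)\<^sup>2)" using l(3) cp by (intro mult_left_mono) auto
      also have "\<dots> = (cmod c)\<^sup>2 * \<theta> x + e" using cp False by (simp add: algebra_simps)
      finally show "\<theta> (c \<cdot>\<^sub>v x) \<le> (cmod c)\<^sup>2 * \<theta> x + e" .
    qed
  qed
  have hom: "\<theta> (c \<cdot>\<^sub>v x) = (cmod c)\<^sup>2 * \<theta> x" if x: "dim_vec x = n" for c x
  proof (cases "c = 0")
    case True
    hence "c \<cdot>\<^sub>v x = 0\<^sub>v n" using x by auto
    thus ?thesis using True \<theta>0 by simp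
  next
    case False
    have "inverse c \<cdot>\<^sub>v (c \<cdot>\<^sub>v x) = x" using False by (simp add: smult_smult_assoc)
    hence "\<theta> x \<le> (cmod (inverse c))\<^sup>2 * \<theta> (c \<cdot>\<^sub>v x)" using hom_le[of "c \<cdot>\<^sub>v x" "inverse c"] x by simp
    hence "(cmod c)\<^sup>2 * \<theta> x \<le> (cmod c)\<^sup>2 * ((cmod (inverse c))\<^sup>2 * \<theta> (c \<cdot>\<^sub>v x))" by (intro mult_left_mono) auto
    also have "\<dots> = (cmod (c * inverse c))\<^sup>2 * \<theta> (c \<cdot>\<^sub>v x)"
      by (simp only: norm_mult power_mult_distrib mult.assoc)
    also have "\<dots> = \<theta> (c \<cdot>\<^sub>v x)" using False by simp
    finally show ?thesis using hom_le[OF x, of c] by simp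
  qed
  show "\<theta> (c \<cdot>\<^sub>v x) = (cmod c)\<^sup>2 * \<theta> x" by (rule hom[OF x])
  have le: "\<theta> (x + y) + \<theta> (x - y) \<le> 2 * \<theta> x + 2 * \<theta> y" if x: "dim_vec x = n" and y: "dim_vec y = n" for x y
  proof (rule field_le_epsilon)
    fix e :: real assume e: "0 < e"
    obtain l where l: "valid l" "st l = x" "cost l < \<theta> x + e / 4" using \<theta>_approx[OF x, of "e / 4"] e by auto
    obtain l' where l': "valid l'" "st l' = y" "cost l' < \<theta> y + e / 4" using \<theta>_approx[OF y, of "e / 4"] e by auto
    obtain k k' where k: "length (l @ replicate k (0\<^sub>v m)) = length (l' @ replicate k' (0\<^sub>v m))"
      "valid (l @ replicate k (0\<^sub>v m))" "valid (l' @ replicate k' (0\<^sub>v m))" using equal_length[OF l(1) l'(1)] by blast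
    define a where "a = map2 (+) (l @ replicate k (0\<^sub>v m)) (l' @ replicate k' (0\<^sub>v m))"
    define b where "b = map2 (-) (l @ replicate k (0\<^sub>v m)) (l' @ replicate k' (0\<^sub>v m))"
    have "valid a" "valid b" unfolding a_def b_def using valid_map2[OF k] by blast+
    moreover have "st a = x + y" "st b = x - y" unfolding a_def b_def using st_map2[OF k] pad_back(1) l l' by simp_all
    ultimately have "\<theta> (x + y) \<le> cost a" "\<theta> (x - y) \<le> cost b" using \<theta>_le by metis+
    moreover have "cost a + cost b = 2 * cost l + 2 * cost l'"
      unfolding a_def b_def using cost_map2[OF k] pad_back(2) by simp
    ultimately show "\<theta> (x + y) + \<theta> (x - y) \<le> 2 * \<theta> x + 2 * \<theta> y + e" using l(3) l'(3) by simp
  qed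
  have e: "(x + y) + (x - y) = 2 \<cdot>\<^sub>v x" "(x + y) - (x - y) = 2 \<cdot>\<^sub>v y" using x y by auto
  have "4 * \<theta> x + 4 * \<theta> y \<le> 2 * \<theta> (x + y) + 2 * \<theta> (x - y)"
    using le[of "x + y" "x - y"] x y unfolding e by (simp add: hom)
  thus "\<theta> (x + y) + \<theta> (x - y) = 2 * \<theta> x + 2 * \<theta> y" using le[OF x y] by simp
qed

lemma \<theta>_form:
  obtains k L L' where "L \<in> carrier_mat k n" "L' \<in> carrier_mat n k" "L * L' = 1\<^sub>m k"
    "\<And>x. dim_vec x = n \<Longrightarrow> \<theta> x = vnorm2 (L *\<^sub>v x)"
proof -
  obtain M where M: "M \<in> carrier_mat n n" "herm M" "\<And>x. x \<in> carrier_vec n \<Longrightarrow> inn (M *\<^sub>v x) x = of_real (\<theta> x)"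
  proof (rule parallelogram_imp_form[of n \<theta>])
    show "\<theta> (x + y) + \<theta> (x - y) = 2 * \<theta> x + 2 * \<theta> y" if "x \<in> carrier_vec n" "y \<in> carrier_vec n" for x y
      by (rule \<theta>_parallelogram) (use that in auto)
    show "\<theta> (c \<cdot>\<^sub>v x) = (cmod c)\<^sup>2 * \<theta> x" if "x \<in> carrier_vec n" for x c
      by (rule \<theta>_smult[of x x]) (use that in auto)
    show "0 \<le> \<theta> x" if "x \<in> carrier_vec n" for x using \<theta>_nonneg that by auto
  qed auto
  have Mp: "0 \<le> Re (inn (M *\<^sub>v x) x)" if "x \<in> carrier_vec n" for x using M(3)[OF that] \<theta>_nonneg[of x] that by simp
  obtain k L L' where L: "L \<in> carrier_mat k n" "L' \<in> carrier_mat n k" "L * L' = 1\<^sub>m k"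
    "\<And>x. x \<in> carrier_vec n \<Longrightarrow> inn (M *\<^sub>v x) x = inn (L *\<^sub>v x) (L *\<^sub>v x)"
    using psd_rank_factorization[OF M(1,2) Mp] by metis
  have "\<theta> x = vnorm2 (L *\<^sub>v x)" if "dim_vec x = n" for x
    using L(4)[OF carrier_vecI[OF that]] M(3)[OF carrier_vecI[OF that]] by (simp add: inn_self)
  thus thesis by (rule that[OF L(1-3)])
qed

lemma \<theta>_bellman_le:
  assumes u: "dim_vec u = m" and x: "dim_vec x = n"
  shows "\<theta> (mat_adjoint C *\<^sub>v u + mat_adjoint A *\<^sub>v x) \<le> \<phi> u x + \<theta> x"
proof (rule field_le_epsilon)
  fix e :: real assume e: "0 < e"
  obtain l where l: "valid l" "st l = x" "cost l < \<theta> x + e" using \<theta>_approx[OF x e] by auto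
  have "\<theta> (st (u # l)) \<le> cost (u # l)" by (rule \<theta>_le) (use u l in auto)
  thus "\<theta> (mat_adjoint C *\<^sub>v u + mat_adjoint A *\<^sub>v x) \<le> \<phi> u x + \<theta> x + e" using l by simp
qed

text \<open>The head of a near-optimal list is the step, and its tail competes for the remaining
  value. The empty list can occur only for \<open>y = 0\<close>, where the zero step does.\<close>

lemma \<theta>_bellman_approx:
  assumes y: "dim_vec y = n" and e: "0 < \<epsilon>"
  shows "\<exists>u x. dim_vec u = m \<and> dim_vec x = n \<and> mat_adjoint C *\<^sub>v u + mat_adjoint A *\<^sub>v x = y \<and> \<phi> u x + \<theta> x < \<theta> y + \<epsilon>"
proof -
  obtain l where l: "valid l" "st l = y" "cost l < \<theta> y + \<epsilon>" using \<theta>_approx[OF y e] by auto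
  show ?thesis
  proof (cases l)
    case Nil
    have "\<theta> (0\<^sub>v n) \<le> 0" using \<theta>_le[of "[]"] by simp
    thus ?thesis using Nil l by (intro exI[of _ "0\<^sub>v m"] exI[of _ "0\<^sub>v n"]) (auto simp: dims)
  next
    case (Cons u l')
    have "\<theta> (st l') \<le> cost l'" by (rule \<theta>_le) (use Cons l in auto)
    thus ?thesis using Cons l by (intro exI[of _ u] exI[of _ "st l'"]) auto
  qed
qed

end

end

section \<open>Construction of the spectral factor\<close>

lemma pow_mv_add:
  fixes A :: "complex mat"
  assumes "A \<in> carrier_mat n n" "dim_vec x = n"
  shows "A ^\<^sub>m (i + j) *\<^sub>v x = A ^\<^sub>m i *\<^sub>v (A ^\<^sub>m j *\<^sub>v x)"
proof (induction i)
  case 0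
  show ?case using assms by simp
next
  case (Suc i)
  have "A ^\<^sub>m (Suc i + j) *\<^sub>v x = A *\<^sub>v (A ^\<^sub>m (i + j) *\<^sub>v x)"
    using pow_mv_Suc(2)[OF assms, of "i + j"] by (simp only: add_Suc)
  also have "\<dots> = A ^\<^sub>m Suc i *\<^sub>v (A ^\<^sub>m j *\<^sub>v x)"
    unfolding Suc using assms by (intro pow_mv_Suc(2)[symmetric]) simp_all
  finally show ?case .
qed

context realization_pair
begin

text \<open>The coisometry lives on coordinates of the range of \<open>L^*\<close>;
  \<open>L'\<close> transports it back to the state space. The conclusions collect what the
  verification needs: an \<open>A\<close>-invariant range containing that of \<Gamma> on which
  \<open>C\<close> and \<open>C'\<close> agree, the identity \<open>L Q L^* = 1\<close>, and inputs
  whose first output is prescribed and whose cost hardly exceeds its energy.\<close>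

lemma factor_construction:
  assumes pos0: "\<forall>y. ell2 m y \<longrightarrow> nonneg_complex (quad y)"
  shows "\<exists>r F0 CF k L L'. r \<le> m \<and> F0 \<in> carrier_mat r m \<and> CF \<in> carrier_mat r n \<and>
    L \<in> carrier_mat k n \<and> L' \<in> carrier_mat n k \<and> L * L' = 1\<^sub>m k \<and>
    (\<forall>x. dim_vec x = n \<longrightarrow> \<theta> x = vnorm2 (L *\<^sub>v x)) \<and>
    L * Qg CF * mat_adjoint L = 1\<^sub>m k \<and> R0 = R0' F0 CF \<and>
    (\<forall>a. dim_vec a = k \<longrightarrow> C *\<^sub>v (mat_adjoint L *\<^sub>v a) = C' F0 CF *\<^sub>v (mat_adjoint L *\<^sub>v a)) \<and>
    (\<forall>a. dim_vec a = k \<longrightarrow> (\<exists>b. dim_vec b = k \<and> A *\<^sub>v (mat_adjoint L *\<^sub>v a) = mat_adjoint L *\<^sub>v b)) \<and>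
    (\<forall>u. dim_vec u = m \<longrightarrow> (\<exists>b. dim_vec b = k \<and> \<Gamma> *\<^sub>v u = mat_adjoint L *\<^sub>v b)) \<and>
    (\<forall>b \<epsilon>. dim_vec b = r \<longrightarrow> 0 < \<epsilon> \<longrightarrow> (\<exists>l. valid l \<and> cost l < vnorm2 b + \<epsilon> \<and> F0 *\<^sub>v seq_of l 0 = b))"
proof -
  note pos = pos0[rule_format]
  obtain k L L' where L: "L \<in> carrier_mat k n" and L': "L' \<in> carrier_mat n k" and LL: "L * L' = 1\<^sub>m k"
    and \<theta>L: "\<And>x. dim_vec x = n \<Longrightarrow> \<theta> x = vnorm2 (L *\<^sub>v x)" using \<theta>_form[OF pos] by metis
  have le: "\<forall>u x. dim_vec u = m \<longrightarrow> dim_vec x = n \<longrightarrow> vnorm2 (L *\<^sub>v (mat_adjoint C *\<^sub>v u + mat_adjoint A *\<^sub>v x))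
      \<le> Re (inn (R0 *\<^sub>v u) u) + 2 * Re (inn (\<Gamma> *\<^sub>v u) x) + vnorm2 (L *\<^sub>v x)"
  proof (intro allI impI)
    fix u x :: "complex vec" assume ux: "dim_vec u = m" "dim_vec x = n"
    show "vnorm2 (L *\<^sub>v (mat_adjoint C *\<^sub>v u + mat_adjoint A *\<^sub>v x))
      \<le> Re (inn (R0 *\<^sub>v u) u) + 2 * Re (inn (\<Gamma> *\<^sub>v u) x) + vnorm2 (L *\<^sub>v x)"
      using \<theta>_bellman_le[OF pos ux] \<theta>L ux by (simp add: \<phi>_def dims)
  qed
  have eq: "\<forall>y \<epsilon>. dim_vec y = n \<longrightarrow> 0 < \<epsilon> \<longrightarrow> (\<exists>u x. dim_vec u = m \<and> dim_vec x = n \<and>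
        mat_adjoint C *\<^sub>v u + mat_adjoint A *\<^sub>v x = y \<and>
        Re (inn (R0 *\<^sub>v u) u) + 2 * Re (inn (\<Gamma> *\<^sub>v u) x) + vnorm2 (L *\<^sub>v x) < vnorm2 (L *\<^sub>v y) + \<epsilon>)"
  proof (intro allI impI)
    fix y :: "complex vec" and \<epsilon> :: real assume y: "dim_vec y = n" and e: "0 < \<epsilon>"
    obtain u x where u: "dim_vec u = m" "dim_vec x = n" "mat_adjoint C *\<^sub>v u + mat_adjoint A *\<^sub>v x = y"
      "\<phi> u x + \<theta> x < \<theta> y + \<epsilon>" using \<theta>_bellman_approx[OF pos y e] by blast
    show "\<exists>u x. dim_vec u = m \<and> dim_vec x = n \<and> mat_adjoint C *\<^sub>v u + mat_adjoint A *\<^sub>v x = y \<and>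
        Re (inn (R0 *\<^sub>v u) u) + 2 * Re (inn (\<Gamma> *\<^sub>v u) x) + vnorm2 (L *\<^sub>v x) < vnorm2 (L *\<^sub>v y) + \<epsilon>"
      using u \<theta>L[OF y] \<theta>L[OF u(2)] by (intro exI[of _ u] exI[of _ x]) (simp add: \<phi>_def)
  qed
  obtain r F0 F0' G1 A2 Y where r: "r \<le> m" and F0: "F0 \<in> carrier_mat r m" and F0': "F0' \<in> carrier_mat m r"
    and FF: "F0 * F0' = 1\<^sub>m r" and G1: "G1 \<in> carrier_mat k m" and A2: "A2 \<in> carrier_mat k k" and Y: "Y \<in> carrier_mat k r"
    and \<Gamma>L0: "\<forall>u. dim_vec u = m \<longrightarrow> \<Gamma> *\<^sub>v u = mat_adjoint L *\<^sub>v (G1 *\<^sub>v u)"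
    and LA0: "\<forall>x. dim_vec x = n \<longrightarrow> L *\<^sub>v (mat_adjoint A *\<^sub>v x) = A2 *\<^sub>v (L *\<^sub>v x)"
    and R0v0: "\<forall>u. dim_vec u = m \<longrightarrow> R0 *\<^sub>v u = mat_adjoint F0 *\<^sub>v (F0 *\<^sub>v u) + mat_adjoint G1 *\<^sub>v (G1 *\<^sub>v u)"
    and LC0: "\<forall>u. dim_vec u = m \<longrightarrow> L *\<^sub>v (mat_adjoint C *\<^sub>v u) = Y *\<^sub>v (F0 *\<^sub>v u) + A2 *\<^sub>v (G1 *\<^sub>v u)"
    and coiso0: "\<forall>b. dim_vec b = k \<longrightarrow> vnorm2 (mat_adjoint Y *\<^sub>v b) + vnorm2 (mat_adjoint A2 *\<^sub>v b) = vnorm2 b"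
    using bellman_factorization[OF Ac C carriers(5,4) herms(4) L L' LL le eq] by blast
  note \<Gamma>L = \<Gamma>L0[rule_format] and LA = LA0[rule_format] and R0v = R0v0[rule_format]
    and LC = LC0[rule_format] and coiso = coiso0[rule_format]
  \<comment> \<open>Because \<open>L L' = 1\<close>, this choice gives \<open>CF L^* = Y^*\<close>,
    which prescribes the output matrix on the range of \<open>L^*\<close>.\<close>
  define CF where "CF = mat_adjoint Y * mat_adjoint L'"
  have CF: "CF \<in> carrier_mat r n" using Y L' by (auto simp: CF_def)
  note Q = Qg_props[OF F0 CF]
  note d = dims carrier_matD[OF L] carrier_matD[OF L'] carrier_matD[OF F0] carrier_matD[OF F0'] carrier_matD[OF G1]
    carrier_matD[OF A2] carrier_matD[OF Y] carrier_matD[OF CF] carrier_matD[OF Q(1)]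
  have LLv: "L *\<^sub>v (L' *\<^sub>v a) = a" if "dim_vec a = k" for a
    using that by (simp add: mult_one_mv[OF LL] d)
  have LLa: "mat_adjoint L' *\<^sub>v (mat_adjoint L *\<^sub>v a) = a" if "dim_vec a = k" for a
    using that by (simp add: mult_one_adjoint_mv[OF LL] d)
  have AL: "A *\<^sub>v (mat_adjoint L *\<^sub>v a) = mat_adjoint L *\<^sub>v (mat_adjoint A2 *\<^sub>v a)" if a: "dim_vec a = k" for a
  proof (rule vec_eqI_inn[of _ n])
    fix x :: "complex vec" assume "x \<in> carrier_vec n"
    hence x: "dim_vec x = n" by simp
    have "inn (A *\<^sub>v (mat_adjoint L *\<^sub>v a)) x = inn a (L *\<^sub>v (mat_adjoint A *\<^sub>v x))"
      using a x by (simp add: inn_mv[of A] inn_mv[of "mat_adjoint L"] d)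
    also have "\<dots> = inn a (A2 *\<^sub>v (L *\<^sub>v x))" by (simp only: LA[OF x])
    also have "\<dots> = inn (mat_adjoint L *\<^sub>v (mat_adjoint A2 *\<^sub>v a)) x"
      using a x by (simp add: inn_mv'[of A2] inn_mv'[of L] d)
    finally show "inn (A *\<^sub>v (mat_adjoint L *\<^sub>v a)) x = inn (mat_adjoint L *\<^sub>v (mat_adjoint A2 *\<^sub>v a)) x" .
  qed (simp_all add: d)
  have CFL: "CF *\<^sub>v (mat_adjoint L *\<^sub>v a) = mat_adjoint Y *\<^sub>v a" if "dim_vec a = k" for a
    using that by (simp add: CF_def mvs d LLa)
  have CL: "C *\<^sub>v (mat_adjoint L *\<^sub>v a) = mat_adjoint F0 *\<^sub>v (mat_adjoint Y *\<^sub>v a) + mat_adjoint G1 *\<^sub>v (mat_adjoint A2 *\<^sub>v a)"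
    if a: "dim_vec a = k" for a
  proof (rule vec_eqI_inn[of _ m])
    fix u :: "complex vec" assume "u \<in> carrier_vec m"
    hence u: "dim_vec u = m" by simp
    have "inn (C *\<^sub>v (mat_adjoint L *\<^sub>v a)) u = inn a (L *\<^sub>v (mat_adjoint C *\<^sub>v u))"
      using a u by (simp add: inn_mv[of C] inn_mv[of "mat_adjoint L"] d)
    also have "\<dots> = inn a (Y *\<^sub>v (F0 *\<^sub>v u) + A2 *\<^sub>v (G1 *\<^sub>v u))" by (simp only: LC[OF u])
    also have "\<dots> = inn (mat_adjoint F0 *\<^sub>v (mat_adjoint Y *\<^sub>v a) + mat_adjoint G1 *\<^sub>v (mat_adjoint A2 *\<^sub>v a)) u"
      using a u by (simp add: inns inn_mv'[of Y] inn_mv'[of F0] inn_mv'[of A2] inn_mv'[of G1] d)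
    finally show "inn (C *\<^sub>v (mat_adjoint L *\<^sub>v a)) u = inn (mat_adjoint F0 *\<^sub>v (mat_adjoint Y *\<^sub>v a) + mat_adjoint G1 *\<^sub>v (mat_adjoint A2 *\<^sub>v a)) u" .
  qed (simp_all add: d)
  have LQL: "L * Qg CF * mat_adjoint L = 1\<^sub>m k"
  proof (rule mat_eqI_form[of _ k])
    show "L * Qg CF * mat_adjoint L \<in> carrier_mat k k" using L Q(1) by auto
    fix a :: "complex vec" assume "a \<in> carrier_vec k"
    hence a: "dim_vec a = k" by simp
    define b where "b \<nu> = mat_adjoint A2 ^\<^sub>m \<nu> *\<^sub>v a" for \<nu>
    note A2a = adjoint_carrier[OF A2]
    have db: "dim_vec (b \<nu>) = k" for \<nu> using A2a by (simp add: b_def d)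
    have bS: "b (Suc \<nu>) = mat_adjoint A2 *\<^sub>v b \<nu>" for \<nu> unfolding b_def by (rule pow_mv_Suc(2)[OF A2a a])
    have Ab: "A ^\<^sub>m \<nu> *\<^sub>v (mat_adjoint L *\<^sub>v a) = mat_adjoint L *\<^sub>v b \<nu>" for \<nu>
    proof (induction \<nu>)
      case 0
      show ?case using a by (simp add: b_def d)
    next
      case (Suc \<nu>)
      show ?case unfolding bS AL[OF db, symmetric] Suc[symmetric] by (rule pow_mv_Suc(2)[OF Ac]) (simp add: d)
    qed
    \<comment> \<open>On the range of \<open>L^*\<close>, \<open>A\<close> acts as
      \<open>A2^*\<close> and \<open>CF\<close> as \<open>Y^*\<close>, so the coisometry identity
      makes each term of the Gramian series the energy lost in one step.\<close>
    have step: "vnorm2 (CF *\<^sub>v (A ^\<^sub>m \<nu> *\<^sub>v (mat_adjoint L *\<^sub>v a))) = vnorm2 (b \<nu>) - vnorm2 (b (Suc \<nu>))" for \<nu>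
      unfolding Ab CFL[OF db] bS using coiso[OF db, of \<nu>] by simp
    \<comment> \<open>Decay of the powers of \<open>A2^*\<close> is inherited from \<open>A\<close>:
      they are \<open>L'^* A^\<nu> L^*\<close>. Hence the telescoping series of the Gramian returns
      all of \<open>|a|^2\<close>.\<close>
    have lim: "(\<lambda>\<nu>. vnorm2 (b \<nu>)) \<longlonglongrightarrow> 0"
    proof -
      from geo_stable_nrm[OF A] obtain c \<rho> where c: "0 \<le> c" "0 < \<rho>" "\<rho> < 1"
        "\<And>j v. dim_vec v = n \<Longrightarrow> nrm (A ^\<^sub>m j *\<^sub>v v) \<le> c * \<rho> ^ j * nrm v" by blast
      obtain K where K: "0 \<le> K" "\<And>v. dim_vec v = n \<Longrightarrow> nrm (mat_adjoint L' *\<^sub>v v) \<le> K * nrm v"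
        using mat_bounded[of "mat_adjoint L'"] by (auto simp: d)
      define w where "w = mat_adjoint L *\<^sub>v a"
      have w: "dim_vec w = n" by (simp add: w_def d)
      have "nrm (b \<nu>) \<le> K * c * nrm w * \<rho> ^ \<nu>" for \<nu>
      proof -
        have "b \<nu> = mat_adjoint L' *\<^sub>v (A ^\<^sub>m \<nu> *\<^sub>v w)" unfolding w_def Ab LLa[OF db] ..
        hence "nrm (b \<nu>) \<le> K * nrm (A ^\<^sub>m \<nu> *\<^sub>v w)" using K(2)[of "A ^\<^sub>m \<nu> *\<^sub>v w"] Ac by simp
        also have "\<dots> \<le> K * (c * \<rho> ^ \<nu> * nrm w)" using c(4)[OF w] K(1) by (intro mult_left_mono)
        finally show ?thesis by (simp add: mult_ac)
      qed
      moreover have "(\<lambda>\<nu>. K * c * nrm w * \<rho> ^ \<nu>) \<longlonglongrightarrow> 0"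
        using tendsto_mult_left[OF LIMSEQ_realpow_zero, of \<rho> "K * c * nrm w"] c by simp
      ultimately have "(\<lambda>\<nu>. nrm (b \<nu>)) \<longlonglongrightarrow> 0"
        by (intro Lim_null_comparison[of "\<lambda>\<nu>. nrm (b \<nu>)"]) (auto intro!: always_eventually)
      from tendsto_power[OF this, of 2] show ?thesis by (simp add: nrm_sq)
    qed
    have "(\<lambda>\<nu>. complex_of_real (vnorm2 (CF *\<^sub>v (A ^\<^sub>m \<nu> *\<^sub>v (mat_adjoint L *\<^sub>v a)))))
        sums inn (Qg CF *\<^sub>v (mat_adjoint L *\<^sub>v a)) (mat_adjoint L *\<^sub>v a)"
      using ctrl_gram_form[OF As adjoint_carrier[OF CF], of "mat_adjoint L *\<^sub>v a"]
      unfolding Qg_def obs_gram_eq[OF Ac] by (simp add: d)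
    moreover have "(\<lambda>\<nu>. complex_of_real (vnorm2 (b \<nu>) - vnorm2 (b (Suc \<nu>)))) sums of_real (vnorm2 (b 0) - 0)"
      by (rule sums_of_real[OF telescope_sums'[OF lim]])
    ultimately have "inn (Qg CF *\<^sub>v (mat_adjoint L *\<^sub>v a)) (mat_adjoint L *\<^sub>v a) = of_real (vnorm2 (b 0))"
      unfolding step using sums_unique2 by fastforce
    moreover have "b 0 = a" using a by (simp add: b_def d)
    ultimately show "inn (L * Qg CF * mat_adjoint L *\<^sub>v a) a = inn (1\<^sub>m k *\<^sub>v a) a"
      using a by (simp add: mvs inn_mv[of L] d inn_self)
  qed simp
  have LQv: "L *\<^sub>v (Qg CF *\<^sub>v (mat_adjoint L *\<^sub>v a)) = a" if "dim_vec a = k" for a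
  proof -
    have "L *\<^sub>v (Qg CF *\<^sub>v (mat_adjoint L *\<^sub>v a)) = (L * Qg CF * mat_adjoint L) *\<^sub>v a" using that by (simp add: mvs d)
    thus ?thesis using that by (simp add: LQL)
  qed
  have \<Gamma>a: "mat_adjoint \<Gamma> *\<^sub>v x = mat_adjoint G1 *\<^sub>v (L *\<^sub>v x)" if x: "dim_vec x = n" for x
  proof (rule vec_eqI_inn[of _ m])
    fix u :: "complex vec" assume "u \<in> carrier_vec m"
    hence u: "dim_vec u = m" by simp
    have "inn (mat_adjoint \<Gamma> *\<^sub>v x) u = inn x (\<Gamma> *\<^sub>v u)" using x u by (simp add: inn_mv[of "mat_adjoint \<Gamma>"] d)
    also have "\<dots> = inn (mat_adjoint G1 *\<^sub>v (L *\<^sub>v x)) u"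
      unfolding \<Gamma>L[OF u] using x u by (simp add: inn_mv'[of "mat_adjoint L"] inn_mv'[of G1] d)
    finally show "inn (mat_adjoint \<Gamma> *\<^sub>v x) u = inn (mat_adjoint G1 *\<^sub>v (L *\<^sub>v x)) u" .
  qed (simp_all add: d)
  have R0': "R0 = R0' F0 CF"
  proof (rule mat_eqI_vec[OF carriers(4) C'_carrier(2)[OF F0 CF]])
    fix u :: "complex vec" assume "u \<in> carrier_vec m"
    hence u: "dim_vec u = m" by simp
    have "R0' F0 CF *\<^sub>v u = mat_adjoint F0 *\<^sub>v (F0 *\<^sub>v u) + mat_adjoint \<Gamma> *\<^sub>v (Qg CF *\<^sub>v (\<Gamma> *\<^sub>v u))"
      using u by (simp add: R0'_def mvs d)
    also have "mat_adjoint \<Gamma> *\<^sub>v (Qg CF *\<^sub>v (\<Gamma> *\<^sub>v u)) = mat_adjoint G1 *\<^sub>v (G1 *\<^sub>v u)"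
      using u by (simp add: \<Gamma>a \<Gamma>L LQv d)
    finally show "R0 *\<^sub>v u = R0' F0 CF *\<^sub>v u" unfolding R0v[OF u] by simp
  qed
  have CC: "C *\<^sub>v (mat_adjoint L *\<^sub>v a) = C' F0 CF *\<^sub>v (mat_adjoint L *\<^sub>v a)" if a: "dim_vec a = k" for a
  proof -
    have "C' F0 CF *\<^sub>v (mat_adjoint L *\<^sub>v a)
       = mat_adjoint F0 *\<^sub>v (CF *\<^sub>v (mat_adjoint L *\<^sub>v a)) + mat_adjoint \<Gamma> *\<^sub>v (Qg CF *\<^sub>v (A *\<^sub>v (mat_adjoint L *\<^sub>v a)))"
      using a by (simp add: C'_def mvs d)
    also have "\<dots> = mat_adjoint F0 *\<^sub>v (mat_adjoint Y *\<^sub>v a) + mat_adjoint G1 *\<^sub>v (mat_adjoint A2 *\<^sub>v a)"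
      using a by (simp add: CFL AL \<Gamma>a LQv d)
    finally show ?thesis using CL[OF a] by simp
  qed
  have FFv: "F0 *\<^sub>v (F0' *\<^sub>v a) = a" if "dim_vec a = r" for a
    using that by (simp add: mult_one_mv[OF FF] d)
  \<comment> \<open>Choose \<open>u\<close> with \<open>F0 u = b\<close> and then \<open>x\<close>
    with \<open>L x = - G1 u\<close>: the second square in the completed cost vanishes and
    \<open>\<phi> u x + \<theta> x\<close> is exactly \<open>|b|^2\<close>. A near-optimal list for
    \<open>x\<close>, put after \<open>u\<close>, costs at most \<epsilon> more.\<close>
  have dense: "\<exists>l. valid l \<and> cost l < vnorm2 b + \<epsilon> \<and> F0 *\<^sub>v seq_of l 0 = b" if b: "dim_vec b = r" and e: "0 < \<epsilon>" for b \<epsilon>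
  proof -
    define u where "u = F0' *\<^sub>v b"
    have u: "dim_vec u = m" by (simp add: u_def d)
    have Fu: "F0 *\<^sub>v u = b" unfolding u_def by (rule FFv[OF b])
    define x where "x = (-1) \<cdot>\<^sub>v (L' *\<^sub>v (G1 *\<^sub>v u))"
    have x: "dim_vec x = n" by (simp add: x_def d)
    have Lx: "L *\<^sub>v x = (-1) \<cdot>\<^sub>v (G1 *\<^sub>v u)" using u by (simp add: x_def mv_smult d LLv)
    have 1: "inn (\<Gamma> *\<^sub>v u) x = - of_real (vnorm2 (G1 *\<^sub>v u))"
    proof -
      have "inn (\<Gamma> *\<^sub>v u) x = inn (G1 *\<^sub>v u) (L *\<^sub>v x)"
        unfolding \<Gamma>L[OF u] using x by (simp add: inn_mv[of "mat_adjoint L"] d)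
      thus ?thesis unfolding Lx by (simp add: inn_smult_right inn_self)
    qed
    have 2: "\<theta> x = vnorm2 (G1 *\<^sub>v u)" unfolding \<theta>L[OF x] Lx by (simp add: vnorm2_Re inns)
    have "inn (R0 *\<^sub>v u) u = of_real (vnorm2 (F0 *\<^sub>v u)) + of_real (vnorm2 (G1 *\<^sub>v u))"
      unfolding R0v[OF u] using u by (simp add: inns inn_mv[of "mat_adjoint F0"] inn_mv[of "mat_adjoint G1"] d inn_self)
    hence 3: "inn (R0 *\<^sub>v u) u = of_real (vnorm2 b) + of_real (vnorm2 (G1 *\<^sub>v u))" by (simp only: Fu)
    obtain l where l: "valid l" "st l = x" "cost l < \<theta> x + \<epsilon>" using \<theta>_approx[OF pos x e] by blast
    have "cost (u # l) < vnorm2 b + \<epsilon>" using l(3) unfolding cost.simps l(2) \<phi>_def 1 2 3 by simp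
    thus ?thesis using l u Fu by (intro exI[of _ "u # l"]) (simp add: seq_of_Cons)
  qed
  have AL': "\<exists>b. dim_vec b = k \<and> A *\<^sub>v (mat_adjoint L *\<^sub>v a) = mat_adjoint L *\<^sub>v b" if "dim_vec a = k" for a
    using AL[OF that] by (intro exI[of _ "mat_adjoint A2 *\<^sub>v a"]) (simp add: d)
  have \<Gamma>L': "\<exists>b. dim_vec b = k \<and> \<Gamma> *\<^sub>v u = mat_adjoint L *\<^sub>v b" if "dim_vec u = m" for u
    using \<Gamma>L[OF that] by (intro exI[of _ "G1 *\<^sub>v u"]) (simp add: d)
  show ?thesis
    by (intro exI[of _ r] exI[of _ F0] exI[of _ CF] exI[of _ k] exI[of _ L] exI[of _ L'] conjI allI impI)
      (rule r F0 CF L L' LL LQL R0' | (rule \<theta>L CC AL' \<Gamma>L' dense; assumption))+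
qed

text \<open>The backward state of the observed sequence is the Gramian applied to the next point of
  the trajectory. So \<open>T_\<Phi>^*\<close> sends it to the sequence \<open>C' A^j x\<close>, and
  the identity demanded of elements of the subspace means precisely that \<open>C\<close> and
  \<open>C'\<close> agree along \<open>A^j x\<close>.\<close>

lemma toeplitz_adj_W_obs:
  assumes F0: "F0 \<in> carrier_mat r m" and CF: "CF \<in> carrier_mat r n" and dx: "dim_vec x = n"
    and \<Phi>: "\<And>t. \<Phi> (cis t) = realiz F0 CF A \<Gamma> (cis t)"
  shows "ell2 r (W_obs CF A x)" "toeplitz_adj r m \<Phi> (W_obs CF A x) j = C' F0 CF *\<^sub>v (A ^\<^sub>m j *\<^sub>v x)"
proof -
  note ds = Fdims[OF F0 CF]
  have W: "W_obs CF A x j = CF *\<^sub>v (A ^\<^sub>m j *\<^sub>v x)" for j using dx Ac by (simp add: W_obs_def mvs ds)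
  have "(\<lambda>\<nu>. complex_of_real (vnorm2 (CF *\<^sub>v (A ^\<^sub>m \<nu> *\<^sub>v x)))) sums inn (ctrl_gram (mat_adjoint A) (mat_adjoint CF) *\<^sub>v x) x"
    using ctrl_gram_form[OF As adjoint_carrier[OF CF] dx] by simp
  from sums_Re[OF this] have "summable (\<lambda>\<nu>. vnorm2 (CF *\<^sub>v (A ^\<^sub>m \<nu> *\<^sub>v x)))" by (simp add: sums_iff)
  thus W2: "ell2 r (W_obs CF A x)" unfolding ell2_def W by (simp add: carrier_vecI ds)
  define xj where "xj = A ^\<^sub>m Suc j *\<^sub>v x"
  have dxj: "dim_vec xj = n" using Ac by (simp add: xj_def ds del: pow_mat.simps)
  have W': "W_obs CF A x (i + Suc j) = CF *\<^sub>v (A ^\<^sub>m i *\<^sub>v xj)" for i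
    unfolding W xj_def pow_mv_add[OF Ac dx] ..
  have "bwd_state (mat_adjoint A) (mat_adjoint CF) (W_obs CF A x) (Suc j) = Qg CF *\<^sub>v xj"
    unfolding bwd_state_def W' Qg_def obs_gram_eq[OF Ac]
    using ctrl_gram_mv(2)[OF As adjoint_carrier[OF CF] dxj] by (simp add: ds)
  hence "toeplitz_adj r m \<Phi> (W_obs CF A x) j = mat_adjoint F0 *\<^sub>v (CF *\<^sub>v (A ^\<^sub>m j *\<^sub>v x)) + mat_adjoint \<Gamma> *\<^sub>v (Qg CF *\<^sub>v xj)"
    using toeplitz_adj_realiz[OF A carriers(5) CF F0 \<Phi> ell2_imp_vbounded[OF W2], of j] by (simp only: W)
  also have "xj = A *\<^sub>v (A ^\<^sub>m j *\<^sub>v x)" unfolding xj_def by (rule pow_mv_Suc(2)[OF Ac dx])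
  also have "mat_adjoint F0 *\<^sub>v (CF *\<^sub>v (A ^\<^sub>m j *\<^sub>v x)) + mat_adjoint \<Gamma> *\<^sub>v (Qg CF *\<^sub>v (A *\<^sub>v (A ^\<^sub>m j *\<^sub>v x)))
     = C' F0 CF *\<^sub>v (A ^\<^sub>m j *\<^sub>v x)" using Ac by (simp add: C'_def mvs ds)
  finally show "toeplitz_adj r m \<Phi> (W_obs CF A x) j = C' F0 CF *\<^sub>v (A ^\<^sub>m j *\<^sub>v x)" .
qed

section \<open>Verification of the constructed factor\<close>

context
  fixes r F0 CF k L L'
  assumes pos0: "\<forall>y. ell2 m y \<longrightarrow> nonneg_complex (quad y)"
    and F0: "F0 \<in> carrier_mat r m" and CF: "CF \<in> carrier_mat r n"
    and L: "L \<in> carrier_mat k n" and L': "L' \<in> carrier_mat n k" and LL: "L * L' = 1\<^sub>m k"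
    and \<theta>L0: "\<forall>x. dim_vec x = n \<longrightarrow> \<theta> x = vnorm2 (L *\<^sub>v x)"
    and LQL: "L * Qg CF * mat_adjoint L = 1\<^sub>m k"
    and R0eq: "R0 = R0' F0 CF"
    and CL0: "\<forall>a. dim_vec a = k \<longrightarrow> C *\<^sub>v (mat_adjoint L *\<^sub>v a) = C' F0 CF *\<^sub>v (mat_adjoint L *\<^sub>v a)"
    and AL0: "\<forall>a. dim_vec a = k \<longrightarrow> (\<exists>b. dim_vec b = k \<and> A *\<^sub>v (mat_adjoint L *\<^sub>v a) = mat_adjoint L *\<^sub>v b)"
    and \<Gamma>L0: "\<forall>u. dim_vec u = m \<longrightarrow> (\<exists>b. dim_vec b = k \<and> \<Gamma> *\<^sub>v u = mat_adjoint L *\<^sub>v b)"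
    and dense0: "\<forall>b \<epsilon>. dim_vec b = r \<longrightarrow> 0 < \<epsilon> \<longrightarrow> (\<exists>l. valid l \<and> cost l < vnorm2 b + \<epsilon> \<and> F0 *\<^sub>v seq_of l 0 = b)"
begin

lemmas pos = pos0[rule_format] and \<theta>L = \<theta>L0[rule_format] and CL = CL0[rule_format]
  and AL = AL0[rule_format] and \<Gamma>L = \<Gamma>L0[rule_format] and dense = dense0[rule_format]

text \<open>The range of \<open>L^*\<close>. It is shown in \<open>X_eq\<close> to be the subspace
  attached to the factor, and until then it serves as the invariant carrying trajectories on which
  \<open>C\<close> and \<open>C'\<close> agree.\<close>

definition rng where "rng x \<longleftrightarrow> (\<exists>a. dim_vec a = k \<and> x = mat_adjoint L *\<^sub>v a)"

lemmas ds = dims carrier_matD[OF L] carrier_matD[OF L'] carrier_matD[OF F0] carrier_matD[OF CF]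
  carrier_matD[OF Qg_props(1)[OF F0 CF]] carrier_matD[OF C'_carrier(1)[OF F0 CF]]

lemma rng_dim: "rng x \<Longrightarrow> dim_vec x = n"
  by (auto simp: rng_def ds)

lemma rng_closed: "rng (0\<^sub>v n)" "rng x \<Longrightarrow> rng y \<Longrightarrow> rng (x + y)" "rng x \<Longrightarrow> rng (A *\<^sub>v x)"
  "dim_vec u = m \<Longrightarrow> rng (\<Gamma> *\<^sub>v u)" "rng x \<Longrightarrow> C *\<^sub>v x = C' F0 CF *\<^sub>v x"
proof -
  show "rng (0\<^sub>v n)" unfolding rng_def by (rule exI[of _ "0\<^sub>v k"]) (simp add: ds)
  show "rng (x + y)" if "rng x" "rng y"
  proof -
    from that obtain a b where "dim_vec a = k" "dim_vec b = k" "x = mat_adjoint L *\<^sub>v a" "y = mat_adjoint L *\<^sub>v b"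
      by (auto simp: rng_def)
    thus ?thesis unfolding rng_def by (intro exI[of _ "a + b"]) (simp add: mv_add ds)
  qed
  show "rng (A *\<^sub>v x)" if "rng x" using that AL by (auto simp: rng_def)
  show "rng (\<Gamma> *\<^sub>v u)" if "dim_vec u = m" unfolding rng_def by (rule \<Gamma>L[OF that])
  show "C *\<^sub>v x = C' F0 CF *\<^sub>v x" if "rng x" using that CL by (auto simp: rng_def)
qed

lemma rng_pow: "rng x \<Longrightarrow> rng (A ^\<^sub>m j *\<^sub>v x)"
proof (induction j)
  case 0
  thus ?case using rng_dim by (simp add: ds)
next
  case (Suc j)
  show ?case unfolding pow_mv_Suc(2)[OF Ac rng_dim[OF Suc.prems]] by (rule rng_closed(3)[OF Suc.IH[OF Suc.prems]])
qed

lemma rng_fwd_state: "(\<And>i. dim_vec (y i) = m) \<Longrightarrow> rng (fwd_state A \<Gamma> (0\<^sub>v n) y i)"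
  by (induction i) (auto intro: rng_closed)

abbreviation \<Psi> where "\<Psi> \<equiv> realiz F0 CF A \<Gamma>"

text \<open>Equality of \<open>C\<close> and \<open>C'\<close> is available only on
  \<open>rng\<close>, but all terms \<open>A^j \<Gamma> v\<close> of the resolvent series lie there,
  which is enough for the symbols to coincide.\<close>

lemma R_factor: "cmod z = 1 \<Longrightarrow> R z = mat_adjoint (\<Psi> z) * \<Psi> z"
proof -
  assume z: "cmod z = 1"
  hence z1: "cmod z \<le> 1" by simp
  have "C *\<^sub>v (resolv n A z *\<^sub>v (\<Gamma> *\<^sub>v v)) = C' F0 CF *\<^sub>v (resolv n A z *\<^sub>v (\<Gamma> *\<^sub>v v))" if v: "dim_vec v = m" for v
  proof -
    have dG: "dim_vec (\<Gamma> *\<^sub>v v) = n" by (simp add: ds)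
    note X = resolv(3,4)[OF A z1 dG]
    have e: "M *\<^sub>v (resolv n A z *\<^sub>v (\<Gamma> *\<^sub>v v)) = vec_suminf m (\<lambda>j. z ^ j \<cdot>\<^sub>v (M *\<^sub>v (A ^\<^sub>m j *\<^sub>v (\<Gamma> *\<^sub>v v))))"
      if M: "dim_row M = m" "dim_col M = n" for M
      unfolding X(1) vsummable_mv(2)[OF X(2) M(2,1)] using M Ac by (simp add: mv_smult)
    show ?thesis unfolding e[OF carrier_matD[OF C]] e[OF carrier_matD[OF C'_carrier(1)[OF F0 CF]]]
      rng_closed(5)[OF rng_pow[OF rng_closed(4)[OF v]]] ..
  qed
  thus ?thesis unfolding R_eq_factor_iff[OF F0 CF z] using R0eq by simp
qed

section \<open>Dense range of the Toeplitz operator of the factor\<close>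

definition T where "T y i = F0 *\<^sub>v y i + CF *\<^sub>v fwd_state A \<Gamma> (0\<^sub>v n) y i"

lemma dim_T [simp]: "dim_vec (T y i) = r"
  by (simp add: T_def ds)

lemma toeplitz_T: "(\<And>i. dim_vec (y i) = m) \<Longrightarrow> toeplitz r m \<Psi> y i = T y i"
  unfolding T_def by (rule toeplitz_realiz[OF A carriers(5) CF F0 refl])

text \<open>Output energy plus the storage \<open><Q x_j, x_j>\<close> equals the form with
  \<open>C x_i\<close> paired against the input. Once the input has ended, the costate is zero,
  duality leaves no boundary term, and that form is \<open>cost l\<close>; dropping the storage
  gives the bound.\<close>

lemma output_bound:
  assumes l: "valid l"
  shows "summable (\<lambda>i. vnorm2 (T (seq_of l) i))" "(\<Sum>i. vnorm2 (T (seq_of l) i)) \<le> cost l"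
proof -
  define x where "x = fwd_state A \<Gamma> (0\<^sub>v n) (seq_of l)"
  have x: "rng (x i)" for i unfolding x_def by (rule rng_fwd_state[OF dim_sq[OF l]])
  have dx: "dim_vec (x i) = n" for i by (rule rng_dim[OF x])
  note yb = ell2_imp_vbounded[OF seq_of_ell2[OF l]]
  have e: "(\<Sum>i<j. vnorm2 (T (seq_of l) i)) = (\<Sum>i<j. Re (inn (R0 *\<^sub>v seq_of l i) (seq_of l i)) + 2 * Re (inn (C *\<^sub>v x i) (seq_of l i)))
     - Re (inn (Qg CF *\<^sub>v x j) (x j))" for j
  proof (induction j)
    case 0
    show ?case by (simp add: x_def ds)
  next
    case (Suc j)
    have "x (Suc j) = A *\<^sub>v x j + \<Gamma> *\<^sub>v seq_of l j" by (simp add: x_def)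
    from output_energy[OF F0 CF dim_sq[OF l] dx this] Suc show ?case
      by (simp add: T_def x_def[symmetric] R0eq[symmetric] rng_closed(5)[OF x])
  qed
  have le: "(\<Sum>i<j. vnorm2 (T (seq_of l) i)) \<le> cost l" if j: "length l \<le> j" for j
  proof -
    have "(\<Sum>i<j. Re (inn (C *\<^sub>v x i) (seq_of l i))) = (\<Sum>i<j. Re (inn (\<Gamma> *\<^sub>v seq_of l i) (costate (seq_of l) (Suc i))))"
      using arg_cong[OF state_duality_sum[OF A carriers(5) C dim_sq[OF l] yb index_zero_vec(2), where N = j], of Re]
        costate_sq_end[OF j] dx[of j] by (simp add: x_def costate_def[symmetric])
    hence "(\<Sum>i<j. vnorm2 (T (seq_of l) i)) = cost l - Re (inn (Qg CF *\<^sub>v x j) (x j))"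
      unfolding e cost_sq[OF l j, symmetric] by (simp add: \<phi>_def sum.distrib sum_distrib_left[symmetric])
    thus ?thesis using Qg_props(3)[OF F0 CF dx, of j] by simp
  qed
  have le': "(\<Sum>i<j. vnorm2 (T (seq_of l) i)) \<le> cost l" for j
  proof -
    have "(\<Sum>i<j. vnorm2 (T (seq_of l) i)) \<le> (\<Sum>i<max j (length l). vnorm2 (T (seq_of l) i))"
      by (rule sum_mono2) auto
    also have "\<dots> \<le> cost l" by (rule le) simp
    finally show ?thesis .
  qed
  show s: "summable (\<lambda>i. vnorm2 (T (seq_of l) i))"
    by (rule summableI_nonneg_bounded[of _ "cost l"]) (use le' in auto)
  show "(\<Sum>i. vnorm2 (T (seq_of l) i)) \<le> cost l"
    by (rule suminf_le_const[OF s]) (rule le')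
qed

lemma T_add:
  assumes "\<And>i. dim_vec (y i) = m" "\<And>i. dim_vec (z i) = m"
  shows "T (\<lambda>i. y i + z i) i = T y i + T z i"
proof -
  have x: "fwd_state A \<Gamma> (0\<^sub>v n) (\<lambda>i. y i + z i) i = fwd_state A \<Gamma> (0\<^sub>v n) y i + fwd_state A \<Gamma> (0\<^sub>v n) z i" for i
  proof (induction i)
    case (Suc i)
    have d: "dim_vec (fwd_state A \<Gamma> (0\<^sub>v n) y i) = n" "dim_vec (fwd_state A \<Gamma> (0\<^sub>v n) z i) = n"
      by (rule rng_dim[OF rng_fwd_state], rule assms)+
    show ?case unfolding fwd_state.simps Suc using assms d
      by (simp add: mv_add ds) (rule eq_vecI; simp add: ds del: index_mult_mat_vec)
  qed simp
  have d: "dim_vec (fwd_state A \<Gamma> (0\<^sub>v n) y i) = n" "dim_vec (fwd_state A \<Gamma> (0\<^sub>v n) z i) = n"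
    by (rule rng_dim[OF rng_fwd_state], rule assms)+
  show ?thesis unfolding T_def x using assms d
    by (simp add: mv_add ds) (rule eq_vecI; simp add: ds del: index_mult_mat_vec)
qed

definition delay where "delay b y = (\<lambda>i. case i of 0 \<Rightarrow> b | Suc j \<Rightarrow> y j)" for b :: "complex vec" and y :: "nat \<Rightarrow> complex vec"

lemma delay_simps [simp]: "delay b y 0 = b" "delay b y (Suc i) = y i"
  by (simp_all add: delay_def)

lemma T_delay: "(\<And>i. dim_vec (y i) = m) \<Longrightarrow> T (delay (0\<^sub>v m) y) 0 = 0\<^sub>v r"
  "(\<And>i. dim_vec (y i) = m) \<Longrightarrow> T (delay (0\<^sub>v m) y) (Suc i) = T y i"
proof -
  assume y: "\<And>i. dim_vec (y i) = m"
  have x: "fwd_state A \<Gamma> (0\<^sub>v n) (delay (0\<^sub>v m) y) (Suc i) = fwd_state A \<Gamma> (0\<^sub>v n) y i" for i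
    by (induction i) (simp_all add: ds)
  show "T (delay (0\<^sub>v m) y) 0 = 0\<^sub>v r" by (simp add: T_def ds)
  show "T (delay (0\<^sub>v m) y) (Suc i) = T y i" unfolding T_def x by simp
qed

text \<open>Summability is demanded explicitly, since the infinite sum of a divergent series carries
  no information and errors have to be added later.\<close>

definition approximable where "approximable g \<longleftrightarrow> (\<forall>\<epsilon>>0. \<exists>y. ell2 m y \<and> summable (\<lambda>i. vnorm2 (T y i - g i)) \<and> (\<Sum>i. vnorm2 (T y i - g i)) < \<epsilon>)"

lemma error_split:
  assumes "\<And>i. dim_vec (e1 i) = r" "\<And>i. dim_vec (e2 i) = r"
    and s: "summable (\<lambda>i. vnorm2 (e1 i))" "summable (\<lambda>i. vnorm2 (e2 i))"
    and lt: "(\<Sum>i. vnorm2 (e1 i)) < \<epsilon> / 4" "(\<Sum>i. vnorm2 (e2 i)) < \<epsilon> / 4"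
  shows "summable (\<lambda>i. vnorm2 (e1 i + e2 i))" "(\<Sum>i. vnorm2 (e1 i + e2 i)) < \<epsilon>"
proof -
  have b: "vnorm2 (e1 i + e2 i) \<le> 2 * vnorm2 (e1 i) + 2 * vnorm2 (e2 i)" for i
    by (rule vnorm2_add_le) (simp add: assms)
  have s2: "summable (\<lambda>i. 2 * vnorm2 (e1 i) + 2 * vnorm2 (e2 i))" by (intro summable_add summable_mult s)
  show s3: "summable (\<lambda>i. vnorm2 (e1 i + e2 i))"
    by (rule summable_comparison_test'[OF s2, of 0]) (use b in auto)
  have "(\<Sum>i. vnorm2 (e1 i + e2 i)) \<le> (\<Sum>i. 2 * vnorm2 (e1 i) + 2 * vnorm2 (e2 i))"
    by (rule suminf_le[OF b s3 s2])
  also have "\<dots> = 2 * (\<Sum>i. vnorm2 (e1 i)) + 2 * (\<Sum>i. vnorm2 (e2 i))"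
    using s by (subst suminf_add[symmetric]) (auto intro!: summable_mult simp: suminf_mult)
  finally show "(\<Sum>i. vnorm2 (e1 i + e2 i)) < \<epsilon>" using lt by simp
qed

lemma ell2_delay: "ell2 m y \<Longrightarrow> ell2 m (delay (0\<^sub>v m) y)"
proof -
  assume y: "ell2 m y"
  have "summable (\<lambda>i. vnorm2 (delay (0\<^sub>v m) y (Suc i)))" using y by (simp add: ell2_def)
  hence "summable (\<lambda>i. vnorm2 (delay (0\<^sub>v m) y i))" by (subst (asm) summable_Suc_iff)
  moreover have "delay (0\<^sub>v m) y i \<in> carrier_vec m" for i using y by (cases i) (auto simp: ell2_def)
  ultimately show ?thesis by (simp add: ell2_def)
qed

text \<open>An input from \<open>dense\<close> has first output exactly \<open>b\<close> and total
  output energy below \<open>|b|^2 + \<epsilon>/4\<close>, so its later outputs are negligible.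
  Adding a delayed approximant of \<open>g\<close> produces \<open>b\<close> followed by
  \<open>g\<close>. The quarters compensate for the factor 2 in the squared triangle inequality
  together with the two error terms.\<close>

lemma approximable_delay:
  assumes g: "approximable g" and dg: "\<And>i. dim_vec (g i) = r" and b: "dim_vec b = r"
  shows "approximable (delay b g)"
  unfolding approximable_def
proof (intro allI impI)
  fix \<epsilon> :: real assume "0 < \<epsilon>"
  hence e: "0 < \<epsilon> / 4" by simp
  obtain l where l: "valid l" "cost l < vnorm2 b + \<epsilon> / 4" "F0 *\<^sub>v seq_of l 0 = b" using dense[OF b e] by blast
  obtain y where y: "ell2 m y" "summable (\<lambda>i. vnorm2 (T y i - g i))" "(\<Sum>i. vnorm2 (T y i - g i)) < \<epsilon> / 4"
    using g e unfolding approximable_def by blast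
  have dy: "dim_vec (y i) = m" for i using y(1) by (auto simp: ell2_def)
  have ddy: "dim_vec (delay (0\<^sub>v m) y i) = m" for i using dy by (cases i) simp_all
  define e1 where "e1 i = T (seq_of l) i - delay b (\<lambda>_. 0\<^sub>v r) i" for i
  define e2 where "e2 i = T (delay (0\<^sub>v m) y) i - delay (0\<^sub>v r) g i" for i
  define z where "z i = seq_of l i + delay (0\<^sub>v m) y i" for i
  have dd: "dim_vec (delay b g i) = r" "dim_vec (delay b (\<lambda>_. 0\<^sub>v r) i) = r" "dim_vec (delay (0\<^sub>v r) g i) = r" for i
    by (cases i; simp add: b dg)+
  have z: "ell2 m z" unfolding z_def by (intro ell2_add seq_of_ell2 l ell2_delay y)
  have Tz: "T z i - delay b g i = e1 i + e2 i" for i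
  proof -
    have Ta: "T z i = T (seq_of l) i + T (delay (0\<^sub>v m) y) i" unfolding z_def[abs_def] by (rule T_add[OF dim_sq[OF l(1)] ddy])
    show ?thesis unfolding Ta e1_def e2_def
      by (rule eq_vecI; cases i; simp add: dd b dg)
  qed
  have T0: "T (seq_of l) 0 = b" using l(3) b by (simp add: T_def ds)
  have s1: "summable (\<lambda>i. vnorm2 (T (seq_of l) i))" by (rule output_bound(1)[OF l(1)])
  have e10: "vnorm2 (e1 0) = 0" and e1S: "e1 (Suc i) = T (seq_of l) (Suc i)" for i
    using b by (auto simp: e1_def T0 vec_eq_iff vnorm2_def)
  have s1': "summable (\<lambda>i. vnorm2 (e1 (Suc i)))" unfolding e1S using s1 by (subst summable_Suc_iff)
  hence se1: "summable (\<lambda>i. vnorm2 (e1 i))" by (subst (asm) summable_Suc_iff)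
  have "(\<Sum>i. vnorm2 (e1 i)) = (\<Sum>i. vnorm2 (T (seq_of l) (Suc i)))"
    using suminf_split_head[OF se1] e10 by (simp add: e1S)
  also have "\<dots> = (\<Sum>i. vnorm2 (T (seq_of l) i)) - vnorm2 b" using suminf_split_head[OF s1] by (simp add: T0)
  also have "\<dots> < \<epsilon> / 4" using output_bound(2)[OF l(1)] l(2) by simp
  finally have lt1: "(\<Sum>i. vnorm2 (e1 i)) < \<epsilon> / 4" .
  have e20: "vnorm2 (e2 0) = 0" and e2S: "e2 (Suc i) = T y i - g i" for i
    using T_delay[OF dy] by (auto simp: e2_def)
  have s2': "summable (\<lambda>i. vnorm2 (e2 (Suc i)))" unfolding e2S by (rule y(2))
  hence se2: "summable (\<lambda>i. vnorm2 (e2 i))" by (subst (asm) summable_Suc_iff)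
  have lt2: "(\<Sum>i. vnorm2 (e2 i)) < \<epsilon> / 4" using suminf_split_head[OF se2] e20 y(3) by (simp add: e2S)
  have de: "dim_vec (e1 i) = r" "dim_vec (e2 i) = r" for i by (simp_all add: e1_def e2_def dd)
  show "\<exists>y. ell2 m y \<and> summable (\<lambda>i. vnorm2 (T y i - delay b g i)) \<and> (\<Sum>i. vnorm2 (T y i - delay b g i)) < \<epsilon>"
    using error_split[OF de se1 se2 lt1 lt2] z unfolding Tz[symmetric] by blast
qed

lemma approximable_finite: "(\<And>i. dim_vec (g i) = r) \<Longrightarrow> (\<And>i. M \<le> i \<Longrightarrow> g i = 0\<^sub>v r) \<Longrightarrow> approximable g"
proof (induction M arbitrary: g)
  case 0
  have x: "fwd_state A \<Gamma> (0\<^sub>v n) (\<lambda>_. 0\<^sub>v m) i = 0\<^sub>v n" for i by (induction i) (simp_all add: ds)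
  have T0: "T (\<lambda>_. 0\<^sub>v m) i = 0\<^sub>v r" for i by (simp add: T_def x ds)
  have "ell2 m (\<lambda>_. 0\<^sub>v m)" by (simp add: ell2_def)
  moreover have "vnorm2 (T (\<lambda>_. 0\<^sub>v m) i - g i) = 0" for i using 0 by (simp add: T0)
  ultimately show ?case unfolding approximable_def by (intro allI impI exI[of _ "\<lambda>_. 0\<^sub>v m"]) simp
next
  case (Suc M)
  have "approximable (\<lambda>i. g (Suc i))" by (rule Suc.IH) (use Suc.prems in auto)
  hence "approximable (delay (g 0) (\<lambda>i. g (Suc i)))" by (rule approximable_delay) (use Suc.prems in auto)
  moreover have "delay (g 0) (\<lambda>i. g (Suc i)) = g"
  proof
    fix i show "delay (g 0) (\<lambda>i. g (Suc i)) i = g i" by (cases i) simp_all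
  qed
  ultimately show ?case by simp
qed

lemma dense_range: "toeplitz_dense_range r m \<Psi>"
  unfolding toeplitz_dense_range_def
proof (intro allI impI)
  fix g and \<epsilon> :: real assume g: "ell2 r g" and "0 < \<epsilon>"
  hence e: "0 < \<epsilon> / 4" by simp
  have dg: "dim_vec (g i) = r" for i using g by (auto simp: ell2_def)
  have sg: "summable (\<lambda>i. vnorm2 (g i))" using g by (simp add: ell2_def)
  obtain M where M: "\<bar>\<Sum>i. vnorm2 (g (i + M))\<bar> < \<epsilon> / 4"
    using suminf_exist_split[OF e sg] by (metis order_refl real_norm_def)
  define h where "h i = (if i < M then g i else 0\<^sub>v r)" for i
  have dh: "dim_vec (h i) = r" for i by (simp add: h_def dg)
  have "approximable h" by (rule approximable_finite[of h M]) (auto simp: h_def dg)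
  then obtain y where y: "ell2 m y" "summable (\<lambda>i. vnorm2 (T y i - h i))" "(\<Sum>i. vnorm2 (T y i - h i)) < \<epsilon> / 4"
    using e unfolding approximable_def by blast
  have dy: "dim_vec (y i) = m" for i using y(1) by (auto simp: ell2_def)
  have hg: "vnorm2 (h i - g i) = (if i < M then 0 else vnorm2 (g i))" for i
  proof -
    have "h i - g i = (if i < M then 0\<^sub>v r else (-1) \<cdot>\<^sub>v g i)"
      by (cases "i < M"; rule eq_vecI; simp add: h_def dg)
    moreover have "vnorm2 ((-1) \<cdot>\<^sub>v g i) = vnorm2 (g i)" by (simp add: vnorm2_Re inns)
    ultimately show ?thesis by simp
  qed
  have s2: "summable (\<lambda>i. vnorm2 (h i - g i))" unfolding hg
    by (rule summable_comparison_test'[OF sg, of 0]) auto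
  have "(\<Sum>i. vnorm2 (h i - g i)) = (\<Sum>i. vnorm2 (h (i + M) - g (i + M))) + (\<Sum>i<M. vnorm2 (h i - g i))"
    by (rule suminf_split_initial_segment[OF s2])
  also have "\<dots> = (\<Sum>i. vnorm2 (g (i + M)))" by (simp add: hg)
  also have "\<dots> < \<epsilon> / 4" using M by linarith
  finally have lt2: "(\<Sum>i. vnorm2 (h i - g i)) < \<epsilon> / 4" .
  have de: "dim_vec (T y i - h i) = r" "dim_vec (h i - g i) = r" for i by (simp_all add: dh dg)
  have "T y i - g i = (T y i - h i) + (h i - g i)" for i by (rule eq_vecI) (simp_all add: dh dg)
  hence "(\<Sum>i. vnorm2 (T y i - g i)) < \<epsilon>" using error_split(2)[OF de y(2) s2 y(3) lt2] by simp
  hence "ell2_dist2 (toeplitz r m \<Psi> y) g < \<epsilon>" by (simp add: ell2_dist2_def toeplitz_T[OF dy])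
  thus "\<exists>x. ell2 m x \<and> ell2_dist2 (toeplitz r m \<Psi> x) g < \<epsilon>" using y(1) by blast
qed

section \<open>The subspace of the factor and the operator \<Delta>\<close>

lemma W_obs_factor:
  assumes x: "rng x"
  shows "ell2 r (W_obs CF A x)" "W_obs C A x = toeplitz_adj r m \<Psi> (W_obs CF A x)"
proof -
  have dx: "dim_vec x = n" by (rule rng_dim[OF x])
  show "ell2 r (W_obs CF A x)" by (rule toeplitz_adj_W_obs(1)[OF F0 CF dx refl])
  show "W_obs C A x = toeplitz_adj r m \<Psi> (W_obs CF A x)"
  proof
    fix j
    have "W_obs C A x j = C *\<^sub>v (A ^\<^sub>m j *\<^sub>v x)" using dx Ac by (simp add: W_obs_def mvs ds)
    also have "\<dots> = C' F0 CF *\<^sub>v (A ^\<^sub>m j *\<^sub>v x)" by (rule rng_closed(5)[OF rng_pow[OF x]])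
    finally show "W_obs C A x j = toeplitz_adj r m \<Psi> (W_obs CF A x) j"
      unfolding toeplitz_adj_W_obs(2)[OF F0 CF dx refl] .
  qed
qed

text \<open>If \<open>W_obs C A x = T_\<Phi>^* y\<close>, then pairing \<open>x\<close> with the
  state of an input is pairing the output of the factor with \<open>y\<close>, which is controlled
  by \<open>cost l\<close> plus the energy of \<open>y\<close>. All multiples of a kernel vector of
  \<open>L\<close> have value 0 and are reached at cost below 1, so \<open>x\<close> is orthogonal
  to the kernel and lies in the range of \<open>L^*\<close>.\<close>

lemma W_obs_range_imp_rng:
  assumes x: "dim_vec x = n" and y: "ell2 r y" and W: "W_obs C A x = toeplitz_adj r m \<Psi> y"
  shows "rng x"
proof -
  define Y where "Y = (\<Sum>i. vnorm2 (y i))"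
  have dy: "dim_vec (y i) = r" for i using y by (auto simp: ell2_def)
  have sy: "summable (\<lambda>i. vnorm2 (y i))" using y by (simp add: ell2_def)
  have LLv: "L *\<^sub>v (L' *\<^sub>v a) = a" if "dim_vec a = k" for a
    using that by (simp add: mult_one_mv[OF LL] ds)
  have bound: "2 * Re (inn x (st l)) \<le> cost l + Y" if l: "valid l" for l
  proof -
    have xp: "fwd_state A \<Gamma> x (\<lambda>_. 0\<^sub>v m) i = A ^\<^sub>m i *\<^sub>v x" for i
    proof (induction i)
      case (Suc i)
      show ?case unfolding fwd_state.simps Suc pow_mv_Suc(2)[OF Ac x] by (simp add: ds)
    qed (simp add: x ds)
    have "inn x (st l) = (\<Sum>i<length l. inn (C *\<^sub>v (A ^\<^sub>m i *\<^sub>v x)) (seq_of l i))"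
      using state_duality_sum[OF A carriers(5) C index_zero_vec(2) ell2_imp_vbounded[OF seq_of_ell2[OF l]] x, where N = "length l"]
        costate_sq_end[of l "length l"] costate_sq_0[OF l] Ac unfolding xp costate_def[symmetric] by (simp add: ds)
    also have "\<dots> = (\<Sum>i<length l. inn (toeplitz_adj r m \<Psi> y i) (seq_of l i))"
    proof (rule sum.cong[OF refl])
      fix i
      have "C *\<^sub>v (A ^\<^sub>m i *\<^sub>v x) = toeplitz_adj r m \<Psi> y i"
        using fun_cong[OF W, of i] x Ac by (simp add: W_obs_def mvs ds)
      thus "inn (C *\<^sub>v (A ^\<^sub>m i *\<^sub>v x)) (seq_of l i) = inn (toeplitz_adj r m \<Psi> y i) (seq_of l i)" by simp
    qed
    finally have ix: "Re (inn x (st l)) = Re (\<Sum>i<length l. inn (seq_of l i) (toeplitz_adj r m \<Psi> y i))"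
      using Re_inn_commute dim_sq[OF l] by (simp add: toeplitz_adj_def)
    have "(\<lambda>i. inn (seq_of l i) (toeplitz_adj r m \<Psi> y i)) sums (\<Sum>i<length l. inn (seq_of l i) (toeplitz_adj r m \<Psi> y i))"
      by (rule sums_finite) (auto simp: seq_of_def toeplitz_adj_def)
    from sums_toeplitz_adjoint[OF A carriers(5) CF F0 refl seq_of_ell2[OF l] y this]
    have sm: "(\<lambda>i. inn (T (seq_of l) i) (y i)) sums (\<Sum>i<length l. inn (seq_of l i) (toeplitz_adj r m \<Psi> y i))"
      by (simp add: toeplitz_T[OF dim_sq[OF l]])
    have s1: "(\<lambda>i. 2 * Re (inn (T (seq_of l) i) (y i))) sums (2 * Re (inn x (st l)))"
      unfolding ix by (intro sums_mult sums_Re sm)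
    have s2: "(\<lambda>i. vnorm2 (T (seq_of l) i) + vnorm2 (y i)) sums ((\<Sum>i. vnorm2 (T (seq_of l) i)) + Y)"
      unfolding Y_def by (intro sums_add summable_sums output_bound(1)[OF l] sy)
    have "2 * Re (inn x (st l)) \<le> (\<Sum>i. vnorm2 (T (seq_of l) i)) + Y"
      by (rule sums_le[OF _ s1 s2]) (simp add: two_Re_inn_le dy)
    thus ?thesis using output_bound(2)[OF l] by simp
  qed
  have ker: "inn x z = 0" if z: "dim_vec z = n" "L *\<^sub>v z = 0\<^sub>v k" for z
  proof (rule Re_mult_bounded_imp_zero)
    fix t :: complex
    define w where "w = cnj t \<cdot>\<^sub>v z"
    have w: "dim_vec w = n" by (simp add: w_def z)
    have "\<theta> w = 0" unfolding \<theta>L[OF w] using z by (simp add: w_def mv_smult ds)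
    then obtain l where l: "valid l" "st l = w" "cost l < 1" using \<theta>_approx[OF pos w, of 1] by auto
    have "inn x w = t * inn x z" using x z by (simp add: w_def inn_smult_right)
    thus "Re (t * inn x z) \<le> (1 + Y) / 2" using bound[OF l(1)] l by simp
  qed
  have "x = mat_adjoint L *\<^sub>v (mat_adjoint L' *\<^sub>v x)"
  proof (rule vec_eqI_inn[of _ n])
    fix u :: "complex vec" assume "u \<in> carrier_vec n"
    hence u: "dim_vec u = n" by simp
    have "inn x (u - L' *\<^sub>v (L *\<^sub>v u)) = 0"
      by (rule ker) (use u in \<open>simp_all add: mvs ds LLv vec_diff_zero_iff\<close>)
    hence "inn x u = inn x (L' *\<^sub>v (L *\<^sub>v u))" using u x by (simp add: inns ds)
    also have "\<dots> = inn (mat_adjoint L *\<^sub>v (mat_adjoint L' *\<^sub>v x)) u"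
      using u x by (simp add: inn_mv'[of L'] inn_mv'[of L] ds)
    finally show "inn x u = inn (mat_adjoint L *\<^sub>v (mat_adjoint L' *\<^sub>v x)) u" .
  qed (simp_all add: x ds)
  thus ?thesis unfolding rng_def by (intro exI[of _ "mat_adjoint L' *\<^sub>v x"]) (simp add: ds)
qed

lemma X_eq: "{x \<in> carrier_vec n. \<exists>y. ell2 r y \<and> W_obs C A x = toeplitz_adj r m \<Psi> y} = {x. rng x}"
proof (intro equalityI subsetI)
  fix x assume "x \<in> {x \<in> carrier_vec n. \<exists>y. ell2 r y \<and> W_obs C A x = toeplitz_adj r m \<Psi> y}"
  then obtain y where "x \<in> carrier_vec n" "ell2 r y" "W_obs C A x = toeplitz_adj r m \<Psi> y" by blast
  thus "x \<in> {x. rng x}" using W_obs_range_imp_rng[OF carrier_vecD] by blast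
next
  fix x assume "x \<in> {x. rng x}"
  hence x: "rng x" by simp
  show "x \<in> {x \<in> carrier_vec n. \<exists>y. ell2 r y \<and> W_obs C A x = toeplitz_adj r m \<Psi> y}"
    using W_obs_factor[OF x] carrier_vecI[OF rng_dim[OF x]] by blast
qed

text \<open>Orthonormalizing with respect to \<open>M = L L^*\<close> gives \<open>W\<close> with
  \<open>M^-1 = W W^*\<close>, and \<open>V = L^* W\<close> has orthonormal columns spanning
  \<open>rng\<close>. By \<open>L Q L^* = 1\<close> the compression of \<open>Q\<close> is
  \<open>W^* W\<close>; inverting it and transporting back collapses to
  \<open>L^* L\<close>.\<close>

lemma orthonormal_range:
  obtains k' V where "V \<in> carrier_mat n k'" "mat_adjoint V * V = 1\<^sub>m k'"
    "(\<lambda>w. V *\<^sub>v w) ` carrier_vec k' = {x. rng x}"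
    "invertible_mat (mat_adjoint V * Qg CF * V)"
    "V * cmat_inv (mat_adjoint V * Qg CF * V) * mat_adjoint V = mat_adjoint L * L"
proof -
  define M where "M = L * mat_adjoint L"
  have M: "M \<in> carrier_mat k k" using L by (auto simp: M_def)
  have Mh: "herm M" by (simp add: herm_def M_def adjoint_mult ds)
  have Mf: "inn (M *\<^sub>v v) v = of_real (vnorm2 (mat_adjoint L *\<^sub>v v))" if "dim_vec v = k" for v
    using that by (simp add: M_def mvs inn_mv[of L] ds inn_self)
  have Mp: "0 \<le> Re (inn (M *\<^sub>v v) v)" if "v \<in> carrier_vec k" for v using Mf[of v] that by simp
  obtain k' W where W: "W \<in> carrier_mat k k'" and one: "mat_adjoint W * M * W = 1\<^sub>m k'"
    and z: "\<And>x z. x \<in> carrier_vec k \<Longrightarrow> z = x - W *\<^sub>v (mat_adjoint W *\<^sub>v (M *\<^sub>v x)) \<Longrightarrow> inn (M *\<^sub>v z) z = 0"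
    by (rule maximal_orthonormal[OF M Mh Mp, of "carrier_vec k"]) auto
  note Qc = Qg_props(1)[OF F0 CF]
  note dd = ds carrier_matD[OF M] carrier_matD[OF W]
  have LLa: "mat_adjoint L' *\<^sub>v (mat_adjoint L *\<^sub>v a) = a" if "dim_vec a = k" for a
    using that by (simp add: mult_one_adjoint_mv[OF LL] ds)
  \<comment> \<open>\<open>L^*\<close> is injective, so \<open>M\<close> is definite and the
    residue, having \<open>M\<close>-norm zero, is itself zero: \<open>W W^*\<close> is a left
    inverse of \<open>M\<close>.\<close>
  have WM: "W *\<^sub>v (mat_adjoint W *\<^sub>v (M *\<^sub>v a)) = a" if a: "dim_vec a = k" for a
  proof -
    define e where "e = a - W *\<^sub>v (mat_adjoint W *\<^sub>v (M *\<^sub>v a))"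
    have de: "dim_vec e = k" by (simp add: e_def dd)
    have "inn (M *\<^sub>v e) e = 0" by (rule z[OF carrier_vecI[OF a]]) (simp add: e_def)
    hence "mat_adjoint L *\<^sub>v e = 0\<^sub>v n" using Mf[OF de] vnorm2_eq_0[of "mat_adjoint L *\<^sub>v e"] by (simp add: dd)
    hence "e = 0\<^sub>v k" using LLa[OF de] by (simp add: dd)
    thus ?thesis using a by (simp add: e_def vec_diff_zero_iff dd)
  qed
  have MW: "M *\<^sub>v (W *\<^sub>v (mat_adjoint W *\<^sub>v a)) = a" if a: "dim_vec a = k" for a
  proof (rule vec_eqI_inn[of _ k])
    fix u :: "complex vec" assume "u \<in> carrier_vec k"
    hence u: "dim_vec u = k" by simp
    have "inn (M *\<^sub>v (W *\<^sub>v (mat_adjoint W *\<^sub>v a))) u = inn a (W *\<^sub>v (mat_adjoint W *\<^sub>v (M *\<^sub>v u)))"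
      using a u Mh by (simp add: inn_mv[of M] inn_mv[of W] inn_mv[of "mat_adjoint W"] dd herm_def)
    thus "inn (M *\<^sub>v (W *\<^sub>v (mat_adjoint W *\<^sub>v a))) u = inn a u" by (simp only: WM[OF u])
  qed (simp_all add: dd a)
  have LQv: "L *\<^sub>v (Qg CF *\<^sub>v (mat_adjoint L *\<^sub>v a)) = a" if "dim_vec a = k" for a
  proof -
    have "L *\<^sub>v (Qg CF *\<^sub>v (mat_adjoint L *\<^sub>v a)) = (L * Qg CF * mat_adjoint L) *\<^sub>v a" using that by (simp add: mvs ds)
    thus ?thesis using that by (simp add: LQL)
  qed
  define V where "V = mat_adjoint L * W"
  have V: "V \<in> carrier_mat n k'" using L W by (auto simp: V_def)
  have Va: "mat_adjoint V = mat_adjoint W * L" by (simp add: V_def adjoint_mult dd)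
  define \<Omega> where "\<Omega> = mat_adjoint V * Qg CF * V"
  define Z where "Z = mat_adjoint W * M * (M * W)"
  have \<Omega>c: "\<Omega> \<in> carrier_mat k' k'" using V Qc by (auto simp: \<Omega>_def)
  have Zc: "Z \<in> carrier_mat k' k'" using W M by (auto simp: Z_def)
  note dV = dd carrier_matD[OF V] carrier_matD[OF \<Omega>c] carrier_matD[OF Zc]
  have onev: "mat_adjoint W *\<^sub>v (M *\<^sub>v (W *\<^sub>v w)) = w" if "dim_vec w = k'" for w
  proof -
    have "mat_adjoint W *\<^sub>v (M *\<^sub>v (W *\<^sub>v w)) = (mat_adjoint W * M * W) *\<^sub>v w" using that by (simp add: mvs dd)
    thus ?thesis using that by (simp add: one)
  qed
  have VV: "mat_adjoint V * V = 1\<^sub>m k'"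
  proof (rule mat_eqI_vec[of _ k' k'])
    show "mat_adjoint V * V \<in> carrier_mat k' k'" using V by auto
    fix w :: "complex vec" assume "w \<in> carrier_vec k'"
    hence w: "dim_vec w = k'" by simp
    have "(mat_adjoint V * V) *\<^sub>v w = mat_adjoint W *\<^sub>v (M *\<^sub>v (W *\<^sub>v w))"
      unfolding Va unfolding V_def M_def using w by (simp add: mvs dd)
    thus "(mat_adjoint V * V) *\<^sub>v w = 1\<^sub>m k' *\<^sub>v w" using w by (simp add: onev)
  qed simp
  have im: "(\<lambda>w. V *\<^sub>v w) ` carrier_vec k' = {x. rng x}"
  proof (intro equalityI subsetI)
    fix x assume "x \<in> (\<lambda>w. V *\<^sub>v w) ` carrier_vec k'"
    then obtain w where wc: "w \<in> carrier_vec k'" and wx: "x = V *\<^sub>v w" by blast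
    hence w: "dim_vec w = k'" by simp
    with wx have "x = mat_adjoint L *\<^sub>v (W *\<^sub>v w)" by (simp add: V_def mvs dd)
    thus "x \<in> {x. rng x}" unfolding rng_def by (intro CollectI exI[of _ "W *\<^sub>v w"]) (simp add: dd)
  next
    fix x assume "x \<in> {x. rng x}"
    then obtain a where a: "dim_vec a = k" "x = mat_adjoint L *\<^sub>v a" by (auto simp: rng_def)
    have "V *\<^sub>v (mat_adjoint W *\<^sub>v (M *\<^sub>v a)) = mat_adjoint L *\<^sub>v (W *\<^sub>v (mat_adjoint W *\<^sub>v (M *\<^sub>v a)))"
      by (simp add: V_def mvs dd)
    hence "x = V *\<^sub>v (mat_adjoint W *\<^sub>v (M *\<^sub>v a))" using a WM[OF a(1)] by simp
    thus "x \<in> (\<lambda>w. V *\<^sub>v w) ` carrier_vec k'" by (rule image_eqI) (simp add: carrier_vecI dd)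
  qed
  have \<Omega>Z: "\<Omega> * Z = 1\<^sub>m k'"
  proof (rule mat_eqI_vec[of _ k' k'])
    show "\<Omega> * Z \<in> carrier_mat k' k'" using \<Omega>c Zc by auto
    fix w :: "complex vec" assume "w \<in> carrier_vec k'"
    hence w: "dim_vec w = k'" by simp
    have "\<Omega> *\<^sub>v v = mat_adjoint W *\<^sub>v (W *\<^sub>v v)" if v: "dim_vec v = k'" for v
    proof -
      have "\<Omega> *\<^sub>v v = mat_adjoint W *\<^sub>v (L *\<^sub>v (Qg CF *\<^sub>v (mat_adjoint L *\<^sub>v (W *\<^sub>v v))))"
        unfolding \<Omega>_def Va unfolding V_def using v by (simp add: mvs dd)
      thus ?thesis by (simp add: LQv dd)
    qed
    hence "(\<Omega> * Z) *\<^sub>v w = mat_adjoint W *\<^sub>v (W *\<^sub>v (Z *\<^sub>v w))" using w by (simp add: mv_assoc dV)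
    also have "Z *\<^sub>v w = mat_adjoint W *\<^sub>v (M *\<^sub>v (M *\<^sub>v (W *\<^sub>v w)))" using w by (simp add: Z_def mvs dd)
    finally show "(\<Omega> * Z) *\<^sub>v w = 1\<^sub>m k' *\<^sub>v w" using w by (simp add: WM onev dd)
  qed simp
  have inv: "invertible_mat \<Omega>"
  proof -
    have "Z * \<Omega> = 1\<^sub>m k'" by (rule mat_mult_left_right_inverse[OF \<Omega>c Zc \<Omega>Z])
    thus ?thesis unfolding invertible_mat_def inverts_mat_def using \<Omega>Z \<Omega>c Zc by (auto intro!: exI[of _ Z])
  qed
  have D: "V * cmat_inv \<Omega> * mat_adjoint V = mat_adjoint L * L"
    unfolding cmat_inv_eq[OF \<Omega>c Zc \<Omega>Z]
  proof (rule mat_eqI_vec[of _ n n])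
    show "V * Z * mat_adjoint V \<in> carrier_mat n n" "mat_adjoint L * L \<in> carrier_mat n n" using V Zc L by auto
    fix x :: "complex vec" assume "x \<in> carrier_vec n"
    hence x: "dim_vec x = n" by simp
    have "(V * Z * mat_adjoint V) *\<^sub>v x
       = mat_adjoint L *\<^sub>v (W *\<^sub>v (mat_adjoint W *\<^sub>v (M *\<^sub>v (M *\<^sub>v (W *\<^sub>v (mat_adjoint W *\<^sub>v (L *\<^sub>v x)))))))"
      unfolding Va unfolding V_def Z_def using x by (simp add: mvs dd)
    thus "(V * Z * mat_adjoint V) *\<^sub>v x = (mat_adjoint L * L) *\<^sub>v x" using x by (simp add: WM MW mvs dd)
  qed
  show thesis by (rule that[OF V VV im inv[unfolded \<Omega>_def] D[unfolded \<Omega>_def]])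
qed

end

end

section \<open>The equivalence\<close>

lemma psd_mat_iff:
  assumes "M \<in> carrier_mat n n" "herm M"
  shows "psd_mat n M \<longleftrightarrow> (\<forall>v\<in>carrier_vec n. 0 \<le> Re (inn (M *\<^sub>v v) v))"
proof -
  have "Im (inn (M *\<^sub>v v) v) = 0" if "v \<in> carrier_vec n" for v
    by (subst herm_form_real[OF assms(2,1) that]) simp
  thus ?thesis using assms(1) by (auto simp: psd_mat_def nonneg_complex_def inn_def)
qed

context realization_pair
begin

text \<open>A zero symbol has the factor with no rows, so comparing coefficients applies with
  \<open>r = 0\<close>. Its Gramian and \<open>C'\<close> vanish, hence all
  \<open>C A^j \<Gamma> v\<close> are zero and observability gives
  \<open>\<Gamma> v = 0\<close>.\<close>

lemma zero_coeffs:
  assumes R: "\<And>z. cmod z = 1 \<Longrightarrow> R z = 0\<^sub>m m m" and v: "dim_vec v = m"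
  shows "inn (R0 *\<^sub>v v) v = 0" "\<Gamma> *\<^sub>v v = 0\<^sub>v n"
proof -
  define F0 :: "complex mat" where "F0 = 0\<^sub>m 0 m"
  define CF :: "complex mat" where "CF = 0\<^sub>m 0 n"
  have F0: "F0 \<in> carrier_mat 0 m" and CF: "CF \<in> carrier_mat 0 n" by (simp_all add: F0_def CF_def)
  note ds = Fdims[OF F0 CF]
  have Rr: "R z = mat_adjoint (realiz F0 CF A \<Gamma> z) * realiz F0 CF A \<Gamma> z" if z: "cmod z = 1" for z
  proof -
    have c: "realiz F0 CF A \<Gamma> z \<in> carrier_mat 0 m"
      by (rule realiz_mv(2)[OF A _ carriers(5) CF F0, of z "0\<^sub>v m"]) (use z in auto)
    show ?thesis unfolding R[OF z]
      by (rule eq_matI) (use carrier_matD[OF c] in \<open>auto simp: scalar_prod_def\<close>)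
  qed
  have co1: "R0 = R0' F0 CF" by (rule factor_imp_coeffs(1)[OF F0 CF Rr])
  have co2: "C *\<^sub>v (A ^\<^sub>m j *\<^sub>v (\<Gamma> *\<^sub>v v)) = C' F0 CF *\<^sub>v (A ^\<^sub>m j *\<^sub>v (\<Gamma> *\<^sub>v v))" for j
    by (rule factor_imp_coeffs(2)[OF F0 CF Rr v])
  have Q: "Qg CF = 0\<^sub>m n n"
  proof (rule form_zero_imp_zero_mat[OF Qg_props(1)[OF F0 CF]])
    fix x :: "complex vec" assume "x \<in> carrier_vec n"
    hence x: "dim_vec x = n" by simp
    have "(\<lambda>\<nu>. 0::complex) sums inn (Qg CF *\<^sub>v x) x"
      using ctrl_gram_form[OF As adjoint_carrier[OF CF] x] unfolding Qg_def obs_gram_eq[OF Ac]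
      by (simp add: vnorm2_def ds)
    thus "inn (Qg CF *\<^sub>v x) x = 0" by (simp add: sums_iff)
  qed
  have e0: "mat_adjoint F0 *\<^sub>v w = 0\<^sub>v m" if "dim_vec w = 0" for w
    by (rule eq_vecI) (use that in \<open>simp_all add: mv_index ds del: index_mult_mat_vec\<close>)
  have C0: "C' F0 CF *\<^sub>v x = 0\<^sub>v m" if "dim_vec x = n" for x
    using that e0[of "CF *\<^sub>v x"] by (simp add: C'_def mvs ds Q)
  have "C *\<^sub>v (A ^\<^sub>m j *\<^sub>v (\<Gamma> *\<^sub>v v)) = 0\<^sub>v m" for j
    unfolding co2 by (rule C0) (use Ac in simp)
  hence "(C * A ^\<^sub>m j) *\<^sub>v (\<Gamma> *\<^sub>v v) = 0\<^sub>v (dim_row C)" for j using Ac v by (simp add: mvs ds)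
  moreover have "\<Gamma> *\<^sub>v v \<in> carrier_vec n" by (simp add: carrier_vecI ds)
  ultimately show "\<Gamma> *\<^sub>v v = 0\<^sub>v n" using obs unfolding observable_def by blast
  have "R0 *\<^sub>v v = 0\<^sub>v m"
    unfolding co1 using v e0[of "F0 *\<^sub>v v"] by (simp add: R0'_def mvs ds Q)
  thus "inn (R0 *\<^sub>v v) v = 0" using v by simp
qed

lemma neg_N_psd_iff: "psd_mat n (P2 - P1) \<longleftrightarrow> (\<forall>x\<in>carrier_vec n. Re (inn (N *\<^sub>v x) x) \<le> 0)"
proof -
  have c: "P2 - P1 \<in> carrier_mat n n" by (rule minus_carrier_mat[OF carriers(1)])
  have h: "herm (P2 - P1)" using herms(1,2) by (simp add: herm_def adjoint_diff dims)
  have "inn ((P2 - P1) *\<^sub>v x) x = - inn (N *\<^sub>v x) x" if "x \<in> carrier_vec n" for x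
    using that by (simp add: N_def mvs inns dims)
  thus ?thesis unfolding psd_mat_iff[OF c h] by auto
qed

text \<open>With \<phi> identically zero, \<open>quad\<close> reduces to minus the
  \<open>N\<close>-form at the initial costate, and every vector occurs as such a costate.\<close>

lemma zero_symbol_iff:
  assumes R: "\<And>z. cmod z = 1 \<Longrightarrow> R z = 0\<^sub>m m m"
  shows "(\<forall>y. ell2 m y \<longrightarrow> nonneg_complex (quad y)) \<longleftrightarrow> psd_mat n (P2 - P1)"
proof -
  have \<phi>0: "\<phi> u s = 0" if "dim_vec u = m" "dim_vec s = n" for u s
    using that zero_coeffs[OF R that(1)] by (simp add: \<phi>_def)
  show ?thesis unfolding neg_N_psd_iff
  proof
    assume pos: "\<forall>y. ell2 m y \<longrightarrow> nonneg_complex (quad y)"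
    show "\<forall>x\<in>carrier_vec n. Re (inn (N *\<^sub>v x) x) \<le> 0"
    proof
      fix x :: "complex vec" assume "x \<in> carrier_vec n"
      hence x: "dim_vec x = n" by simp
      obtain l where l: "valid l" "st l = x" using reachable[OF x] by blast
      have "cost l = 0" using l(1) by (induction l) (simp_all add: \<phi>0)
      moreover have "0 \<le> Re (quad (seq_of l))" using pos seq_of_ell2[OF l(1)] by (simp add: nonneg_complex_def)
      ultimately show "Re (inn (N *\<^sub>v x) x) \<le> 0" using quad_sq[OF l(1)] l(2) by simp
    qed
  next
    assume N: "\<forall>x\<in>carrier_vec n. Re (inn (N *\<^sub>v x) x) \<le> 0"
    show "\<forall>y. ell2 m y \<longrightarrow> nonneg_complex (quad y)"
    proof (intro allI impI)
      fix y assume y: "ell2 m y"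
      have dy: "dim_vec (y j) = m" for j using y by (auto simp: ell2_def)
      obtain S where S: "quad y = of_real S"
        "(\<lambda>k. \<Sum>j<k. \<phi> (y j) (costate y (Suc j))) \<longlonglongrightarrow> S + Re (inn (N *\<^sub>v costate y 0) (costate y 0))"
        using quad_limit[OF y] by blast
      have "S + Re (inn (N *\<^sub>v costate y 0) (costate y 0)) = 0"
        using S(2) by (simp add: \<phi>0 dy LIMSEQ_const_iff)
      moreover have "Re (inn (N *\<^sub>v costate y 0) (costate y 0)) \<le> 0" using N carrier_vecI[OF dim_bs] by blast
      ultimately show "nonneg_complex (quad y)" unfolding S(1) nonneg_complex_def by simp
    qed
  qed
qed

text \<open>The subspace is encoded by a matrix \<open>V\<close> with orthonormal columns, a
  coordinate version of the canonical embedding: \<open>\<Omega>_\<Phi>\<close> becomes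
  \<open>V^* Q V\<close> and \<Delta> becomes \<open>V (V^* Q V)^-1 V^*\<close>, which is the same
  for every orthonormal basis.\<close>

definition spectral_certificate where
  "spectral_certificate r \<Phi> CF k V \<longleftrightarrow>
     r \<le> m \<and> CF \<in> carrier_mat r n \<and> \<Phi> 0 \<in> carrier_mat r m \<and>
     (\<forall>z. cmod z \<le> 1 \<longrightarrow> \<Phi> z = \<Phi> 0 + z \<cdot>\<^sub>m (CF * cmat_inv (1\<^sub>m n - z \<cdot>\<^sub>m A) * \<Gamma>)) \<and>
     (\<forall>\<zeta>. cmod \<zeta> = 1 \<longrightarrow> R \<zeta> = mat_adjoint (\<Phi> \<zeta>) * \<Phi> \<zeta>) \<and>
     toeplitz_dense_range r m \<Phi> \<and>
     (let X = {x \<in> carrier_vec n. \<exists>y. ell2 r y \<and> W_obs C A x = toeplitz_adj r m \<Phi> y};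
          Q = obs_gram CF A
      in (\<forall>x \<in> X. W_obs C A x = toeplitz_adj r m \<Phi> (W_obs CF A x)) \<and>
         V \<in> carrier_mat n k \<and> mat_adjoint V * V = 1\<^sub>m k \<and>
         (\<lambda>w. V *\<^sub>v w) ` carrier_vec k = X \<and>
         invertible_mat (mat_adjoint V * Q * V) \<and>
         psd_mat n (V * cmat_inv (mat_adjoint V * Q * V) * mat_adjoint V + P2 - P1))"

lemma positive_imp_certificate:
  assumes pos0: "\<forall>y. ell2 m y \<longrightarrow> nonneg_complex (quad y)"
  shows "\<exists>r \<Phi> CF k V. spectral_certificate r \<Phi> CF k V"
proof -
  obtain r F0 CF k L L' where r: "r \<le> m" and F0: "F0 \<in> carrier_mat r m" and CF: "CF \<in> carrier_mat r n"
    and L: "L \<in> carrier_mat k n" and L': "L' \<in> carrier_mat n k" and LL: "L * L' = 1\<^sub>m k"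
    and \<theta>L: "\<forall>x. dim_vec x = n \<longrightarrow> \<theta> x = vnorm2 (L *\<^sub>v x)"
    and LQL: "L * Qg CF * mat_adjoint L = 1\<^sub>m k"
    and R0eq: "R0 = R0' F0 CF"
    and CL: "\<forall>a. dim_vec a = k \<longrightarrow> C *\<^sub>v (mat_adjoint L *\<^sub>v a) = C' F0 CF *\<^sub>v (mat_adjoint L *\<^sub>v a)"
    and AL: "\<forall>a. dim_vec a = k \<longrightarrow> (\<exists>b. dim_vec b = k \<and> A *\<^sub>v (mat_adjoint L *\<^sub>v a) = mat_adjoint L *\<^sub>v b)"
    and \<Gamma>L: "\<forall>u. dim_vec u = m \<longrightarrow> (\<exists>b. dim_vec b = k \<and> \<Gamma> *\<^sub>v u = mat_adjoint L *\<^sub>v b)"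
    and dense: "\<forall>b \<epsilon>. dim_vec b = r \<longrightarrow> 0 < \<epsilon> \<longrightarrow> (\<exists>l. valid l \<and> cost l < vnorm2 b + \<epsilon> \<and> F0 *\<^sub>v seq_of l 0 = b)"
    using factor_construction[OF pos0] by (elim exE conjE) (rule that; assumption)
  note pos = pos0[rule_format]
  note all = pos0 F0 CF L L' LL \<theta>L LQL R0eq CL AL \<Gamma>L dense
  let ?\<Phi> = "realiz F0 CF A \<Gamma>"
  have c0: "?\<Phi> 0 \<in> carrier_mat r m" by (rule realiz_mv(2)[OF A _ carriers(5) CF F0, of 0 "0\<^sub>v m"]) auto
  have \<Phi>0: "?\<Phi> 0 = F0"
  proof (rule mat_eqI_vec[OF c0 F0])
    fix v :: "complex vec" assume "v \<in> carrier_vec m"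
    hence v: "dim_vec v = m" by simp
    have "?\<Phi> 0 *\<^sub>v v = F0 *\<^sub>v v + 0 \<cdot>\<^sub>v (CF *\<^sub>v (resolv n A 0 *\<^sub>v (\<Gamma> *\<^sub>v v)))"
      by (rule realiz_mv(1)[OF A _ carriers(5) CF F0 v]) simp
    also have "\<dots> = F0 *\<^sub>v v" using F0 CF by (intro eq_vecI) (auto simp del: index_mult_mat_vec)
    finally show "?\<Phi> 0 *\<^sub>v v = F0 *\<^sub>v v" .
  qed
  have Rf: "R z = mat_adjoint (?\<Phi> z) * ?\<Phi> z" if "cmod z = 1" for z
    by (rule R_factor[OF all that])
  have dr: "toeplitz_dense_range r m ?\<Phi>" by (rule dense_range[OF all])
  note Xe = X_eq[OF all]
  have Wf: "W_obs C A x = toeplitz_adj r m ?\<Phi> (W_obs CF A x)"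
    if "x \<in> {x \<in> carrier_vec n. \<exists>y. ell2 r y \<and> W_obs C A x = toeplitz_adj r m ?\<Phi> y}" for x
    using W_obs_factor(2)[OF all] that unfolding Xe by simp
  obtain k' V where V: "V \<in> carrier_mat n k'" "mat_adjoint V * V = 1\<^sub>m k'"
    "(\<lambda>w. V *\<^sub>v w) ` carrier_vec k' = {x. rng k L x}"
    "invertible_mat (mat_adjoint V * Qg CF * V)"
    "V * cmat_inv (mat_adjoint V * Qg CF * V) * mat_adjoint V = mat_adjoint L * L"
    by (rule orthonormal_range[OF all])
  \<comment> \<open>Since \<Delta> is \<open>L^* L\<close> here, condition (ii) is the inequality
    \<open>\<theta> x \<ge> <N x, x>\<close>.\<close>
  have p: "psd_mat n (mat_adjoint L * L + P2 - P1)"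
  proof -
    note d = dims carrier_matD[OF L]
    have c: "mat_adjoint L * L + P2 - P1 \<in> carrier_mat n n" by (rule minus_carrier_mat[OF carriers(1)])
    have h: "herm (mat_adjoint L * L + P2 - P1)"
      using herms(1,2) by (simp add: herm_def adjoint_diff adjoint_add adjoint_mult d)
    show ?thesis unfolding psd_mat_iff[OF c h]
    proof
      fix x :: "complex vec" assume "x \<in> carrier_vec n"
      hence x: "dim_vec x = n" by simp
      have "inn ((mat_adjoint L * L + P2 - P1) *\<^sub>v x) x = of_real (vnorm2 (L *\<^sub>v x)) - inn (N *\<^sub>v x) x"
        using x by (simp add: N_def mvs inns inn_mv[of "mat_adjoint L"] d inn_self)
      thus "0 \<le> Re (inn ((mat_adjoint L * L + P2 - P1) *\<^sub>v x) x)"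
        using \<theta>_ge_N[OF pos x] \<theta>L x by simp
    qed
  qed
  have "spectral_certificate r ?\<Phi> CF k' V"
    unfolding spectral_certificate_def Let_def Xe \<Phi>0
    using r CF F0 Rf dr V p Wf[unfolded Xe] unfolding Qg_def
    by (auto simp: realiz_def dims)
  thus ?thesis by blast
qed

text \<open>The lower bound is available for every \<open>x\<close> in the subspace, because its
  defining identity makes \<open>C\<close> and \<open>C'\<close> agree along \<open>A^j x\<close>.
  Evaluated at the best \<open>x\<close> it gives the \<Delta>-form at the initial costate minus the
  \<open>N\<close>-form, which is nonnegative by (ii).\<close>

lemma certificate_imp_positive:
  assumes cert: "spectral_certificate r \<Phi> CF k V" and y: "ell2 m y"
  shows "nonneg_complex (quad y)"
proof -
  define F0 where "F0 = \<Phi> 0"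
  define X where "X = {x \<in> carrier_vec n. \<exists>y. ell2 r y \<and> W_obs C A x = toeplitz_adj r m \<Phi> y}"
  define Q where "Q = Qg CF"
  define \<Omega> where "\<Omega> = mat_adjoint V * Q * V"
  from cert have CF: "CF \<in> carrier_mat r n" and F0: "F0 \<in> carrier_mat r m"
    and \<Phi>: "\<And>z. cmod z \<le> 1 \<Longrightarrow> \<Phi> z = F0 + z \<cdot>\<^sub>m (CF * cmat_inv (1\<^sub>m n - z \<cdot>\<^sub>m A) * \<Gamma>)"
    and R: "\<And>z. cmod z = 1 \<Longrightarrow> R z = mat_adjoint (\<Phi> z) * \<Phi> z"
    and WX: "\<And>x. x \<in> X \<Longrightarrow> W_obs C A x = toeplitz_adj r m \<Phi> (W_obs CF A x)"
    and V: "V \<in> carrier_mat n k" and VX: "(\<lambda>w. V *\<^sub>v w) ` carrier_vec k = X"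
    and inv: "invertible_mat \<Omega>" and psd: "psd_mat n (V * cmat_inv \<Omega> * mat_adjoint V + P2 - P1)"
    unfolding spectral_certificate_def Let_def X_def Q_def \<Omega>_def Qg_def F0_def by blast+
  have \<Phi>r: "\<Phi> z = realiz F0 CF A \<Gamma> z" if "cmod z \<le> 1" for z
    using \<Phi>[OF that] by (simp add: realiz_def dims)
  have Rr: "R z = mat_adjoint (realiz F0 CF A \<Gamma> z) * realiz F0 CF A \<Gamma> z" if "cmod z = 1" for z
    using R[OF that] \<Phi>r[of z] that by simp
  note co = factor_imp_coeffs[OF F0 CF Rr]
  have Qc: "Q \<in> carrier_mat n n" unfolding Q_def by (rule Qg_props(1)[OF F0 CF])
  have \<Omega>c: "\<Omega> \<in> carrier_mat k k" using V Qc by (auto simp: \<Omega>_def)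
  from inv obtain Z where Z: "\<Omega> * Z = 1\<^sub>m k" "Z * \<Omega> = 1\<^sub>m (dim_row Z)"
    using \<Omega>c by (auto simp: invertible_mat_def inverts_mat_def)
  have Zc: "Z \<in> carrier_mat k k"
    using arg_cong[OF Z(1), of dim_col] arg_cong[OF Z(2), of dim_col] \<Omega>c by (intro carrier_matI) auto
  have cinv: "cmat_inv \<Omega> = Z" by (rule cmat_inv_eq[OF \<Omega>c Zc Z(1)])
  note ds = Fdims[OF F0 CF] carrier_matD[OF V] carrier_matD[OF Qc] carrier_matD[OF \<Omega>c] carrier_matD[OF Zc]
  define s where "s = costate y 0"
  have s: "dim_vec s = n" by (simp add: s_def)
  \<comment> \<open>The critical point of \<open>2 Re <V w, s> - <\<Omega> w, w>\<close>, namely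
    \<open>\<Omega>^-1 V^* s\<close>; there the linear and the quadratic term combine to
    \<open><V \<Omega>^-1 V^* s, s>\<close>.\<close>
  define w where "w = Z *\<^sub>v (mat_adjoint V *\<^sub>v s)"
  have w: "dim_vec w = k" by (simp add: w_def ds)
  define x where "x = V *\<^sub>v w"
  have x: "dim_vec x = n" by (simp add: x_def ds)
  have xX: "x \<in> X" unfolding VX[symmetric] x_def by (rule imageI) (simp add: carrier_vecI w)
  have cx: "C *\<^sub>v (A ^\<^sub>m j *\<^sub>v x) = C' F0 CF *\<^sub>v (A ^\<^sub>m j *\<^sub>v x)" for j
  proof -
    have "C *\<^sub>v (A ^\<^sub>m j *\<^sub>v x) = W_obs C A x j" using x Ac by (simp add: W_obs_def mvs ds)
    also have "\<dots> = toeplitz_adj r m \<Phi> (W_obs CF A x) j" by (simp only: WX[OF xX])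
    also have "\<dots> = C' F0 CF *\<^sub>v (A ^\<^sub>m j *\<^sub>v x)"
      by (rule toeplitz_adj_W_obs(2)[OF F0 CF x]) (simp add: \<Phi>r)
    finally show ?thesis .
  qed
  have xs: "inn x s = inn (V * Z * mat_adjoint V *\<^sub>v s) s" using s by (simp add: x_def w_def mvs ds)
  have Qx: "inn (Q *\<^sub>v x) x = inn s x"
  proof -
    have "inn (Q *\<^sub>v x) x = inn (\<Omega> *\<^sub>v w) w" using w by (simp add: x_def \<Omega>_def mvs inn_mv'[of V] ds)
    also have "\<Omega> *\<^sub>v w = (\<Omega> * Z) *\<^sub>v (mat_adjoint V *\<^sub>v s)" by (simp add: w_def mvs ds)
    also have "\<dots> = mat_adjoint V *\<^sub>v s" unfolding Z(1) by (simp add: ds)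
    also have "inn (mat_adjoint V *\<^sub>v s) w = inn s x" using s w by (simp add: x_def inn_mv[of "mat_adjoint V"] ds)
    finally show ?thesis .
  qed
  obtain S where S: "quad y = of_real S" using quad_limit[OF y] by blast
  have "S \<ge> 2 * Re (inn x s) - Re (inn (Q *\<^sub>v x) x) - Re (inn (N *\<^sub>v s) s)"
    unfolding s_def Q_def by (rule quad_lower_bound[OF F0 CF co x cx y S])
  moreover have "Re (inn s x) = Re (inn x s)" by (rule Re_inn_commute) (simp add: s x)
  ultimately have "S \<ge> Re (inn x s) - Re (inn (N *\<^sub>v s) s)" unfolding Qx by simp
  moreover have "inn ((V * Z * mat_adjoint V + P2 - P1) *\<^sub>v s) s = inn x s - inn (N *\<^sub>v s) s"
    unfolding xs N_def using s by (simp add: mvs inns ds)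
  moreover have "0 \<le> Re (inn ((V * Z * mat_adjoint V + P2 - P1) *\<^sub>v s) s)"
    using psd carrier_vecI[OF s] unfolding cinv psd_mat_def nonneg_complex_def inn_def by blast
  ultimately have "0 \<le> S" by simp
  thus ?thesis unfolding S nonneg_complex_def by simp
qed

lemma certificate_imp_psd:
  assumes cert: "spectral_certificate r \<Phi> CF k V" and z: "cmod z = 1"
  shows "psd_mat m (R z)"
proof -
  have Rz: "R z = mat_adjoint (\<Phi> z) * \<Phi> z" using cert z unfolding spectral_certificate_def by blast
  have Rc: "R z \<in> carrier_mat m m" by (rule R_carrier) (simp add: z)
  have d: "dim_col (\<Phi> z) = m" using carrier_matD(2)[OF Rc] by (simp add: Rz)
  have h: "herm (R z)" by (simp add: Rz herm_def adjoint_mult)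
  have "inn (R z *\<^sub>v v) v = of_real (vnorm2 (\<Phi> z *\<^sub>v v))" if "v \<in> carrier_vec m" for v
    unfolding Rz using that d by (simp add: mv_assoc inn_mv[of "mat_adjoint (\<Phi> z)"] inn_self)
  thus ?thesis unfolding psd_mat_iff[OF Rc h] by simp
qed

lemma zero_mat_psd: "psd_mat m (0\<^sub>m m m)"
proof -
  have "herm (0\<^sub>m m m)" unfolding herm_def by (intro eq_matI) auto
  thus ?thesis by (subst psd_mat_iff) (simp_all add: mv_zero_mat)
qed

text \<open>Pointwise nonnegativity of \<open>R\<close> follows from the factorization contained in
  a certificate, and it is immediate for the zero symbol; the two cases of (ii) are then settled by
  the preceding lemmas.\<close>

lemma positive_iff:
  "(\<forall>y. ell2 m y \<longrightarrow> nonneg_complex (quad y)) \<longleftrightarrow>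
    (\<forall>z. cmod z = 1 \<longrightarrow> psd_mat m (R z)) \<and>
    (if \<forall>z. cmod z = 1 \<longrightarrow> R z = 0\<^sub>m m m then psd_mat n (P2 - P1)
     else \<exists>r \<Phi> CF k V. spectral_certificate r \<Phi> CF k V)"
proof (cases "\<forall>z. cmod z = 1 \<longrightarrow> R z = 0\<^sub>m m m")
  case True
  hence "\<forall>z. cmod z = 1 \<longrightarrow> psd_mat m (R z)" using zero_mat_psd by simp
  moreover have "(\<forall>y. ell2 m y \<longrightarrow> nonneg_complex (quad y)) \<longleftrightarrow> psd_mat n (P2 - P1)"
    by (rule zero_symbol_iff) (use True in blast)
  ultimately show ?thesis unfolding if_P[OF True] by blast
next
  case False
  have "(\<forall>y. ell2 m y \<longrightarrow> nonneg_complex (quad y)) \<longleftrightarrow> (\<exists>r \<Phi> CF k V. spectral_certificate r \<Phi> CF k V)"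
    using positive_imp_certificate certificate_imp_positive by blast
  moreover have "(\<exists>r \<Phi> CF k V. spectral_certificate r \<Phi> CF k V) \<Longrightarrow> \<forall>z. cmod z = 1 \<longrightarrow> psd_mat m (R z)"
    using certificate_imp_psd by blast
  ultimately show ?thesis unfolding if_not_P[OF False] by blast
qed

end

theorem theorem3p2:
  fixes m p q n :: nat
    and A B1 B2 C D1 D2 :: "complex mat"
    and G K R :: "complex \<Rightarrow> complex mat"
    and P1 P2 \<Gamma> :: "complex mat"
  assumes A: "A \<in> carrier_mat n n" and B1: "B1 \<in> carrier_mat n p" and B2: "B2 \<in> carrier_mat n q"
    and C: "C \<in> carrier_mat m n" and D1: "D1 \<in> carrier_mat m p" and D2: "D2 \<in> carrier_mat m q"
    and stable: "stable_mat n A"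
    and obs: "observable n C A"
    and ctrl: "controllable n A (mat_of_cols n (cols B1 @ cols B2))"
    and G_def: "G = realiz D1 C A B1"
    and K_def: "K = realiz D2 C A B2"
    and R_def: "R = (\<lambda>z. G z * mat_adjoint (G z) - K z * mat_adjoint (K z))"
    and P1_def: "P1 = ctrl_gram A B1"
    and P2_def: "P2 = ctrl_gram A B2"
    and Gamma_def: "\<Gamma> = B1 * mat_adjoint D1 - B2 * mat_adjoint D2 + A * (P1 - P2) * mat_adjoint C"
  shows
   "(\<forall>y. ell2 m y \<longrightarrow>
        nonneg_complex (ell2_inner
          (\<lambda>i. toeplitz m p G (toeplitz_adj m p G y) i - toeplitz m q K (toeplitz_adj m q K y) i) y))
    \<longleftrightarrow>
    ((\<forall>\<zeta>. cmod \<zeta> = 1 \<longrightarrow> psd_mat m (R \<zeta>)) \<and>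
     (if (\<forall>\<zeta>. cmod \<zeta> = 1 \<longrightarrow> R \<zeta> = 0\<^sub>m m m) then psd_mat n (P2 - P1)
      else (\<exists>r \<Phi> C\<^sub>\<Phi> k V.
              r \<le> m \<and> C\<^sub>\<Phi> \<in> carrier_mat r n \<and> \<Phi> 0 \<in> carrier_mat r m \<and>
              (\<forall>z. cmod z \<le> 1 \<longrightarrow> \<Phi> z = \<Phi> 0 + z \<cdot>\<^sub>m (C\<^sub>\<Phi> * cmat_inv (1\<^sub>m n - z \<cdot>\<^sub>m A) * \<Gamma>)) \<and>
              (\<forall>\<zeta>. cmod \<zeta> = 1 \<longrightarrow> R \<zeta> = mat_adjoint (\<Phi> \<zeta>) * \<Phi> \<zeta>) \<and>
              toeplitz_dense_range r m \<Phi> \<and>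
              (let X = {x \<in> carrier_vec n. \<exists>y. ell2 r y \<and> W_obs C A x = toeplitz_adj r m \<Phi> y};
                   Q = obs_gram C\<^sub>\<Phi> A
               in (\<forall>x \<in> X. W_obs C A x = toeplitz_adj r m \<Phi> (W_obs C\<^sub>\<Phi> A x)) \<and>
                  V \<in> carrier_mat n k \<and> mat_adjoint V * V = 1\<^sub>m k \<and>
                  (\<lambda>w. V *\<^sub>v w) ` carrier_vec k = X \<and>
                  invertible_mat (mat_adjoint V * Q * V) \<and>
                  psd_mat n (V * cmat_inv (mat_adjoint V * Q * V) * mat_adjoint V + P2 - P1)))))"
proof -
  interpret I: realization_pair m p q n A B1 B2 C D1 D2
    by unfold_locales (rule stable_imp_geo_stable[OF stable] B1 B2 C D1 D2 obs)+
  have G: "I.G = G" and K: "I.K = K" and P1: "I.P1 = P1" and P2: "I.P2 = P2"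
    by (simp_all only: I.G_def I.K_def I.P1_def I.P2_def G_def K_def P1_def P2_def)
  have R: "I.R z = R z" for z by (simp only: I.R_def G K R_def)
  have \<Gamma>: "I.\<Gamma> = \<Gamma>" by (simp only: I.\<Gamma>_def I.N_def P1 P2 Gamma_def)
  show ?thesis
    by (rule I.positive_iff[unfolded I.quad_def I.spectral_certificate_def G K P1 P2 R \<Gamma>])
qed

end
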